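(* Let $k$ be a field, $q\in k\setminus\{0\}$, and let $M$ be a non-zero left $\Lambda(q)$-module of dimension at most $3$. If $M$ is semi-Gorenstein-projective, then all the modules $\Omega^tM$ with $t\ge0$ are $3$-dimensional and local. If $M$ is $\infty$-torsionfree, then all the modules $\mho^tM$ with $t\ge0$ are $3$-dimensional and local. In particular, if $M$ is Gorenstein-projective, then all the modules $\Omega^tM$ and $\mho^tM$ with $t\ge0$ are $3$-dimensional and local.
   Context: $\Lambda=\Lambda(q)$ is the 6-dimensional local $k$-algebra generated by $x,y,z$ with relations $x^2=y^2=z^2=yz=0$, $xy+qyx=0$, $xz-zx=0$, $zy-zx=0$; it has $k$-basis $1,x,y,z,yx,zx$. Modules are finite-dimensional left $\Lambda$-modules. A module is local if its top $M/\operatorname{rad}M$ is simple. $\Omega M$ is the kernel of a projective cover of $M$, and $\mho M$ is the cokernel of a minimal left $\operatorname{add}(\Lambda)$-approximation $M\to P$ of $M$ (i.e. a left minimal map $M\to P$ with $P$ projective such that every homomorphism $M\to\Lambda$ factors through it). $M$ is semi-Gorenstein-projective if $\operatorname{Ext}^i_\Lambda(M,\Lambda)=0$ for all $i\ge1$. $M$ is reflexive if the canonical map $M\to M^{**}$ is an isomorphism, where $M^*=\operatorname{Hom}_\Lambda(M,\Lambda)$. $M$ is $\infty$-torsionfree if $\operatorname{Ext}^i(\operatorname{Tr}M,\Lambda_\Lambda)=0$ for all $i\ge1$ (equivalently, $\mho^tM$ is reflexive for all $t\ge0$). $M$ is Gorenstein-projective iff it is both semi-Gorenstein-projective and $\infty$-torsionfree.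 *)

theory Defs
  imports "Jordan_Normal_Form.VS_Connect" "HOL-Algebra.AbelCoset"
begin

section \<open>Modules over a not necessarily commutative ring\<close>

text \<open>
  The locale \<open>module\<close> of HOL-Algebra requires a commutative ring of scalars, so left modules
  are introduced here, with the same record type and the same axioms. Right \<open>R\<close>-modules are
  left modules over \<open>opposite R\<close>. The fields \<open>mult\<close> and \<open>one\<close> which the record type \<open>module\<close>
  inherits from \<open>ring\<close> play no role.
\<close>

locale left_module = R?: ring R + M?: abelian_group M
  for R :: "('r, 's) ring_scheme" (structure) and M :: "('r, 'm, 'z) module_scheme" (structure) +
  assumes smult_closed: "\<lbrakk>a \<in> carrier R; x \<in> carrier M\<rbrakk> \<Longrightarrow> a \<odot>\<^bsub>M\<^esub> x \<in> carrier M"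
    and smult_l_distr: "\<lbrakk>a \<in> carrier R; b \<in> carrier R; x \<in> carrier M\<rbrakk> \<Longrightarrow>
      (a \<oplus> b) \<odot>\<^bsub>M\<^esub> x = a \<odot>\<^bsub>M\<^esub> x \<oplus>\<^bsub>M\<^esub> b \<odot>\<^bsub>M\<^esub> x"
    and smult_r_distr: "\<lbrakk>a \<in> carrier R; x \<in> carrier M; y \<in> carrier M\<rbrakk> \<Longrightarrow>
      a \<odot>\<^bsub>M\<^esub> (x \<oplus>\<^bsub>M\<^esub> y) = a \<odot>\<^bsub>M\<^esub> x \<oplus>\<^bsub>M\<^esub> a \<odot>\<^bsub>M\<^esub> y"
    and smult_assoc: "\<lbrakk>a \<in> carrier R; b \<in> carrier R; x \<in> carrier M\<rbrakk> \<Longrightarrow>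
      (a \<otimes> b) \<odot>\<^bsub>M\<^esub> x = a \<odot>\<^bsub>M\<^esub> (b \<odot>\<^bsub>M\<^esub> x)"
    and smult_one: "x \<in> carrier M \<Longrightarrow> \<one> \<odot>\<^bsub>M\<^esub> x = x"

definition opposite :: "'r ring \<Rightarrow> 'r ring" where
  "opposite R = R\<lparr>mult := \<lambda>a b. b \<otimes>\<^bsub>R\<^esub> a\<rparr>"

definition mk_module ::
  "'m set \<Rightarrow> 'm \<Rightarrow> ('m \<Rightarrow> 'm \<Rightarrow> 'm) \<Rightarrow> ('r \<Rightarrow> 'm \<Rightarrow> 'm) \<Rightarrow> ('r, 'm) module" where
  "mk_module C z a s =
     \<lparr>carrier = C, mult = undefined, one = undefined, zero = z, add = a, smult = s\<rparr>"

definition regular_module :: "'r ring \<Rightarrow> ('r, 'r) module" where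
  "regular_module R = mk_module (carrier R) \<zero>\<^bsub>R\<^esub> (add R) (mult R)"

definition free_module :: "'r ring \<Rightarrow> nat \<Rightarrow> ('r, nat \<Rightarrow> 'r) module" where
  "free_module R n = mk_module ({..<n} \<rightarrow>\<^sub>E carrier R)
     (\<lambda>i\<in>{..<n}. \<zero>\<^bsub>R\<^esub>)
     (\<lambda>v w. \<lambda>i\<in>{..<n}. v i \<oplus>\<^bsub>R\<^esub> w i)
     (\<lambda>r v. \<lambda>i\<in>{..<n}. r \<otimes>\<^bsub>R\<^esub> v i)"

abbreviation module_homs ::
  "'r ring \<Rightarrow> ('r, 'm) module \<Rightarrow> ('r, 'n) module \<Rightarrow> ('m \<Rightarrow> 'n) set" where
  "module_homs \<equiv> LinearCombinations.module_hom"

text \<open>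
  \<open>module_homs\<close> are total functions; the homomorphisms as a set of maps \<open>M \<rightarrow> N\<close> are obtained
  by fixing the values outside \<open>M\<close>.
\<close>

definition Hom :: "'r ring \<Rightarrow> ('r, 'm) module \<Rightarrow> ('r, 'n) module \<Rightarrow> ('m \<Rightarrow> 'n) set" where
  "Hom R M N = module_homs R M N \<inter> extensional (carrier M)"

definition module_iso :: "'r ring \<Rightarrow> ('r, 'm) module \<Rightarrow> ('r, 'n) module \<Rightarrow> bool" where
  "module_iso R M N \<longleftrightarrow> (\<exists>f \<in> module_homs R M N. bij_betw f (carrier M) (carrier N))"

definition quotient_module :: "('r, 'm) module \<Rightarrow> 'm set \<Rightarrow> ('r, 'm set) module" where
  "quotient_module M U = mk_module (A_RCOSETS M U) U (set_add M)
     (\<lambda>r X. set_add M U ((\<lambda>x. r \<odot>\<^bsub>M\<^esub> x) ` X))"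

text \<open>
  \<open>Module.submodule\<close> is the notion of HOL-Algebra, which does not need a commutative ring.
\<close>

definition simple_module :: "'r ring \<Rightarrow> ('r, 'm) module \<Rightarrow> bool" where
  "simple_module R M \<longleftrightarrow> carrier M \<noteq> {\<zero>\<^bsub>M\<^esub>} \<and>
     (\<forall>U. Module.submodule U R M \<longrightarrow> U = {\<zero>\<^bsub>M\<^esub>} \<or> U = carrier M)"

definition maximal_submodule :: "'r ring \<Rightarrow> 'm set \<Rightarrow> ('r, 'm) module \<Rightarrow> bool" where
  "maximal_submodule R U M \<longleftrightarrow> Module.submodule U R M \<and> U \<noteq> carrier M \<and>
     (\<forall>V. Module.submodule V R M \<and> U \<subseteq> V \<longrightarrow> V = U \<or> V = carrier M)"

definition radical :: "'r ring \<Rightarrow> ('r, 'm) module \<Rightarrow> 'm set" where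
  "radical R M = carrier M \<inter> \<Inter>{U. maximal_submodule R U M}"

definition local_module :: "'r ring \<Rightarrow> ('r, 'm) module \<Rightarrow> bool" where
  "local_module R M \<longleftrightarrow> simple_module R (quotient_module M (radical R M))"

section \<open>Projective covers, approximations, syzygies\<close>

text \<open>
  The finitely generated projective modules are the modules in \<open>add R\<close>, i.e. the direct
  summands of the free modules \<open>R\<^sup>n\<close>. Modules which are determined only up to isomorphism
  are taken with elements in \<open>nat \<Rightarrow> 'r\<close>, the type of the elements of \<open>R\<^sup>n\<close>; every finitely
  generated \<open>R\<close>-module is isomorphic to one of this kind.
\<close>

type_synonym 'r fgmodule = "('r, nat \<Rightarrow> 'r) module"

definition projective :: "'r ring \<Rightarrow> ('r, 'm) module \<Rightarrow> bool" where
  "projective R P \<longleftrightarrow> left_module R P \<and>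
     (\<exists>n. \<exists>i \<in> module_homs R P (free_module R n). \<exists>p \<in> module_homs R (free_module R n) P.
        \<forall>x \<in> carrier P. p (i x) = x)"

definition projective_cover ::
  "'r ring \<Rightarrow> ('r, 'p) module \<Rightarrow> ('p \<Rightarrow> 'm) \<Rightarrow> ('r, 'm) module \<Rightarrow> bool" where
  "projective_cover R P \<pi> M \<longleftrightarrow> projective R P \<and> \<pi> \<in> module_homs R P M \<and>
     \<pi> ` carrier P = carrier M \<and>
     (\<forall>U. Module.submodule U R P \<and> set_add P U (a_kernel P M \<pi>) = carrier P \<longrightarrow> U = carrier P)"

definition minimal_left_approximation ::
  "'r ring \<Rightarrow> ('r, 'm) module \<Rightarrow> ('r, 'p) module \<Rightarrow> ('m \<Rightarrow> 'p) \<Rightarrow> bool" where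
  "minimal_left_approximation R M P f \<longleftrightarrow> projective R P \<and> f \<in> module_homs R M P \<and>
     (\<forall>g \<in> module_homs R M (regular_module R). \<exists>h \<in> module_homs R P (regular_module R).
        \<forall>x \<in> carrier M. g x = h (f x)) \<and>
     (\<forall>h \<in> module_homs R P P. (\<forall>x \<in> carrier M. h (f x) = f x) \<longrightarrow>
        bij_betw h (carrier P) (carrier P))"

definition is_Omega :: "'r ring \<Rightarrow> ('r, 'm) module \<Rightarrow> ('r, 'n) module \<Rightarrow> bool" where
  "is_Omega R M N \<longleftrightarrow> left_module R N \<and>
     (\<exists>(P :: 'r fgmodule) \<pi>. projective_cover R P \<pi> M \<and>
        module_iso R N (P\<lparr>carrier := a_kernel P M \<pi>\<rparr>))"

definition is_mho :: "'r ring \<Rightarrow> ('r, 'm) module \<Rightarrow> ('r, 'n) module \<Rightarrow> bool" where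
  "is_mho R M N \<longleftrightarrow> left_module R N \<and>
     (\<exists>(P :: 'r fgmodule) f. minimal_left_approximation R M P f \<and>
        module_iso R N (quotient_module P (f ` carrier M)))"

text \<open>\<open>is_Omega_pow R t M N\<close> says that \<open>N\<close> is (a copy of) the \<open>t\<close>-th syzygy module of \<open>M\<close>.\<close>

primrec is_Omega_pow :: "'r ring \<Rightarrow> nat \<Rightarrow> ('r, 'm) module \<Rightarrow> 'r fgmodule \<Rightarrow> bool" where
  "is_Omega_pow R 0 M N \<longleftrightarrow> left_module R N \<and> module_iso R N M"
| "is_Omega_pow R (Suc t) M N \<longleftrightarrow> (\<exists>K. is_Omega_pow R t M K \<and> is_Omega R K N)"

primrec is_mho_pow :: "'r ring \<Rightarrow> nat \<Rightarrow> ('r, 'm) module \<Rightarrow> 'r fgmodule \<Rightarrow> bool" where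
  "is_mho_pow R 0 M N \<longleftrightarrow> left_module R N \<and> module_iso R N M"
| "is_mho_pow R (Suc t) M N \<longleftrightarrow> (\<exists>K. is_mho_pow R t M K \<and> is_mho R K N)"

section \<open>Ext groups\<close>

definition projective_resolution ::
  "'r ring \<Rightarrow> ('r, 'm) module \<Rightarrow> (nat \<Rightarrow> ('r, 'p) module) \<Rightarrow> (nat \<Rightarrow> 'p \<Rightarrow> 'p) \<Rightarrow>
   ('p \<Rightarrow> 'm) \<Rightarrow> bool" where
  "projective_resolution R M P d \<epsilon> \<longleftrightarrow>
     (\<forall>i. projective R (P i)) \<and>
     \<epsilon> \<in> module_homs R (P 0) M \<and> \<epsilon> ` carrier (P 0) = carrier M \<and>
     (\<forall>i. d i \<in> module_homs R (P (Suc i)) (P i)) \<and>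
     d 0 ` carrier (P (Suc 0)) = a_kernel (P 0) M \<epsilon> \<and>
     (\<forall>i. d (Suc i) ` carrier (P (Suc (Suc i))) = a_kernel (P (Suc i)) (P i) (d i))"

text \<open>Cocycles and coboundaries of the complex \<open>Hom(P\<^sub>0,N) \<rightarrow> Hom(P\<^sub>1,N) \<rightarrow> \<dots>\<close>.\<close>

definition cocycles ::
  "'r ring \<Rightarrow> (nat \<Rightarrow> ('r, 'p) module) \<Rightarrow> (nat \<Rightarrow> 'p \<Rightarrow> 'p) \<Rightarrow> ('r, 'n) module \<Rightarrow>
   nat \<Rightarrow> ('p \<Rightarrow> 'n) set" where
  "cocycles R P d N i =
     {f \<in> Hom R (P i) N. \<forall>x \<in> carrier (P (Suc i)). f (d i x) = \<zero>\<^bsub>N\<^esub>}"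

primrec coboundaries ::
  "'r ring \<Rightarrow> (nat \<Rightarrow> ('r, 'p) module) \<Rightarrow> (nat \<Rightarrow> 'p \<Rightarrow> 'p) \<Rightarrow> ('r, 'n) module \<Rightarrow>
   nat \<Rightarrow> ('p \<Rightarrow> 'n) set" where
  "coboundaries R P d N 0 = {\<lambda>x \<in> carrier (P 0). \<zero>\<^bsub>N\<^esub>}"
| "coboundaries R P d N (Suc i) =
     (\<lambda>g. compose (carrier (P (Suc i))) g (d i)) ` Hom R (P i) N"

text \<open>
  \<open>Ext_vanishes R i M N\<close> is \<open>Ext\<^sup>i(M, N) = 0\<close> for a module \<open>M\<close> with a resolution by finitely
  generated projective modules (over a finite-dimensional algebra: for every
  finite-dimensional \<open>M\<close>). The cohomology does not depend on the resolution.
\<close>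

definition Ext_vanishes :: "'r ring \<Rightarrow> nat \<Rightarrow> ('r, 'm) module \<Rightarrow> ('r, 'n) module \<Rightarrow> bool" where
  "Ext_vanishes R i M N \<longleftrightarrow>
     (\<forall>(P :: nat \<Rightarrow> 'r fgmodule) d \<epsilon>. projective_resolution R M P d \<epsilon> \<longrightarrow>
        cocycles R P d N i = coboundaries R P d N i)"

section \<open>The transpose and the classes of modules considered\<close>

text \<open>\<open>dual R M = Hom(M, R)\<close> is a right \<open>R\<close>-module via \<open>(f r)(x) = f(x) r\<close>.\<close>

definition dual :: "'r ring \<Rightarrow> ('r, 'm) module \<Rightarrow> ('r, 'm \<Rightarrow> 'r) module" where
  "dual R M = mk_module (Hom R M (regular_module R))
     (\<lambda>x \<in> carrier M. \<zero>\<^bsub>R\<^esub>)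
     (\<lambda>f g. \<lambda>x \<in> carrier M. f x \<oplus>\<^bsub>R\<^esub> g x)
     (\<lambda>r f. \<lambda>x \<in> carrier M. f x \<otimes>\<^bsub>R\<^esub> r)"

text \<open>
  \<open>Tr M\<close> is the cokernel of \<open>p\<^sup>* : P\<^sub>0\<^sup>* \<rightarrow> P\<^sub>1\<^sup>*\<close>, where \<open>p : P\<^sub>1 \<rightarrow> P\<^sub>0\<close> is a minimal projective
  presentation of \<open>M\<close>.
\<close>

definition is_transpose :: "'r ring \<Rightarrow> ('r, 'm) module \<Rightarrow> ('r, 'n) module \<Rightarrow> bool" where
  "is_transpose R M T \<longleftrightarrow> left_module (opposite R) T \<and>
     (\<exists>(P0 :: 'r fgmodule) (P1 :: 'r fgmodule) \<pi> p.
        projective_cover R P0 \<pi> M \<and>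
        projective_cover R P1 p (P0\<lparr>carrier := a_kernel P0 M \<pi>\<rparr>) \<and>
        module_iso (opposite R) T
          (quotient_module (dual R P1)
             ((\<lambda>g. compose (carrier P1) g p) ` carrier (dual R P0))))"

definition semi_Gorenstein_projective :: "'r ring \<Rightarrow> ('r, 'm) module \<Rightarrow> bool" where
  "semi_Gorenstein_projective R M \<longleftrightarrow> (\<forall>i\<ge>1. Ext_vanishes R i M (regular_module R))"

text \<open>\<open>Tr M\<close> is unique up to isomorphism, so the quantifier over \<open>T\<close> is immaterial.\<close>

definition infinitely_torsionfree :: "'r ring \<Rightarrow> ('r, 'm) module \<Rightarrow> bool" where
  "infinitely_torsionfree R M \<longleftrightarrow> (\<forall>T :: 'r fgmodule. is_transpose R M T \<longrightarrow>
     (\<forall>i\<ge>1. Ext_vanishes (opposite R) i T (regular_module (opposite R))))"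

definition Gorenstein_projective :: "'r ring \<Rightarrow> ('r, 'm) module \<Rightarrow> bool" where
  "Gorenstein_projective R M \<longleftrightarrow> semi_Gorenstein_projective R M \<and> infinitely_torsionfree R M"

section \<open>The algebra \<open>\<Lambda>(q)\<close>\<close>

text \<open>
  \<open>Lam a b c d e f\<close> stands for \<open>a + b x + c y + d z + e yx + f zx\<close>. The multiplication table
  comes from the relations: \<open>xy = -q yx\<close>, \<open>xz = zx = zy\<close>; all other products of two generators
  except \<open>yx\<close>, and all products of three generators, are zero.
\<close>

datatype 'k lam = Lam (c_1: 'k) (c_x: 'k) (c_y: 'k) (c_z: 'k) (c_yx: 'k) (c_zx: 'k)

definition lam_add :: "'k::field lam \<Rightarrow> 'k lam \<Rightarrow> 'k lam" where
  "lam_add a b = Lam (c_1 a + c_1 b) (c_x a + c_x b) (c_y a + c_y b) (c_z a + c_z b)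
     (c_yx a + c_yx b) (c_zx a + c_zx b)"

definition lam_mult :: "'k::field \<Rightarrow> 'k lam \<Rightarrow> 'k lam \<Rightarrow> 'k lam" where
  "lam_mult q a b = Lam
     (c_1 a * c_1 b)
     (c_1 a * c_x b + c_x a * c_1 b)
     (c_1 a * c_y b + c_y a * c_1 b)
     (c_1 a * c_z b + c_z a * c_1 b)
     (c_1 a * c_yx b + c_yx a * c_1 b + c_y a * c_x b - q * c_x a * c_y b)
     (c_1 a * c_zx b + c_zx a * c_1 b + c_z a * c_x b + c_x a * c_z b + c_z a * c_y b)"

definition Lambda :: "'k::field \<Rightarrow> 'k lam ring" where
  "Lambda q = \<lparr>carrier = UNIV, mult = lam_mult q, one = Lam 1 0 0 0 0 0,
     zero = Lam 0 0 0 0 0 0, add = lam_add\<rparr>"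

definition lam_scalar :: "'k::field \<Rightarrow> 'k lam" where "lam_scalar c = Lam c 0 0 0 0 0"
definition lam_x :: "'k::field lam" where "lam_x = Lam 0 1 0 0 0 0"
definition lam_y :: "'k::field lam" where "lam_y = Lam 0 0 1 0 0 0"
definition lam_z :: "'k::field lam" where "lam_z = Lam 0 0 0 1 0 0"

lemmas lam_gen_defs = lam_scalar_def lam_x_def lam_y_def lam_z_def
lemmas Lambda_defs = Lambda_def lam_add_def lam_mult_def lam_gen_defs

lemma ring_Lambda: "ring (Lambda q)"
proof (rule ringI)
  show "abelian_group (Lambda q)"
  proof (rule abelian_groupI)
    fix a assume "a \<in> carrier (Lambda q)"
    show "\<exists>b \<in> carrier (Lambda q). b \<oplus>\<^bsub>Lambda q\<^esub> a = \<zero>\<^bsub>Lambda q\<^esub>"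
      by (rule bexI[of _ "Lam (- c_1 a) (- c_x a) (- c_y a) (- c_z a) (- c_yx a) (- c_zx a)"])
        (auto simp: Lambda_defs)
  qed (auto simp: Lambda_defs algebra_simps)
  show "monoid (Lambda q)"
    by (rule monoidI) (auto simp: Lambda_defs algebra_simps)
qed (auto simp: Lambda_defs algebra_simps)

lemma Lambda_relations:
  fixes q :: "'k::field"
  defines "L \<equiv> Lambda q"
  shows "lam_x \<otimes>\<^bsub>L\<^esub> lam_x = \<zero>\<^bsub>L\<^esub>" "lam_y \<otimes>\<^bsub>L\<^esub> lam_y = \<zero>\<^bsub>L\<^esub>" "lam_z \<otimes>\<^bsub>L\<^esub> lam_z = \<zero>\<^bsub>L\<^esub>"
    "lam_y \<otimes>\<^bsub>L\<^esub> lam_z = \<zero>\<^bsub>L\<^esub>"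
    "lam_x \<otimes>\<^bsub>L\<^esub> lam_y \<oplus>\<^bsub>L\<^esub> lam_scalar q \<otimes>\<^bsub>L\<^esub> (lam_y \<otimes>\<^bsub>L\<^esub> lam_x) = \<zero>\<^bsub>L\<^esub>"
    "lam_x \<otimes>\<^bsub>L\<^esub> lam_z = lam_z \<otimes>\<^bsub>L\<^esub> lam_x" "lam_z \<otimes>\<^bsub>L\<^esub> lam_y = lam_z \<otimes>\<^bsub>L\<^esub> lam_x"
    "lam_y \<otimes>\<^bsub>L\<^esub> lam_x = Lam 0 0 0 0 1 0" "lam_z \<otimes>\<^bsub>L\<^esub> lam_x = Lam 0 0 0 0 0 1"
  by (simp_all add: L_def Lambda_defs)

text \<open>
  \<open>\<Lambda>(q)\<close> is the \<open>k\<close>-algebra presented by the generators and relations: every family of elements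
  satisfying the relations in a \<open>k\<close>-algebra comes from a unique algebra homomorphism.
\<close>

lemma Lambda_universal:
  fixes \<phi> :: "'k::field \<Rightarrow> 'a::ring_1" and X Y Z :: 'a and q :: 'k
  assumes \<phi>: "\<phi> 1 = 1" "\<And>c d. \<phi> (c + d) = \<phi> c + \<phi> d" "\<And>c d. \<phi> (c * d) = \<phi> c * \<phi> d"
    and central: "\<And>c u. \<phi> c * u = u * \<phi> c"
    and rel: "X * X = 0" "Y * Y = 0" "Z * Z = 0" "Y * Z = 0"
      "X * Y + \<phi> q * (Y * X) = 0" "X * Z - Z * X = 0" "Z * Y - Z * X = 0"
  shows "\<exists>!h. (\<forall>a b. h (a \<oplus>\<^bsub>Lambda q\<^esub> b) = h a + h b) \<and>
    (\<forall>a b. h (a \<otimes>\<^bsub>Lambda q\<^esub> b) = h a * h b) \<and> (\<forall>c. h (lam_scalar c) = \<phi> c) \<and>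
    h lam_x = X \<and> h lam_y = Y \<and> h lam_z = Z"
proof -
  define h where "h a = \<phi> (c_1 a) + \<phi> (c_x a) * X + \<phi> (c_y a) * Y + \<phi> (c_z a) * Z
    + \<phi> (c_yx a) * (Y * X) + \<phi> (c_zx a) * (Z * X)" for a
  have \<phi>0: "\<phi> 0 = 0" using \<phi>(2)[of 0 0] by simp
  have \<phi>m: "\<phi> (- c) = - \<phi> c" for c
    using \<phi>(2)[of c "- c"] \<phi>0 by (simp add: eq_neg_iff_add_eq_0 add.commute)
  have \<phi>d: "\<phi> (c - d) = \<phi> c - \<phi> d" for c d
    using \<phi>(2)[of c "- d"] \<phi>m by simp
  have XY: "X * Y = - (\<phi> q * (Y * X))" using rel(5) by (simp add: eq_neg_iff_add_eq_0)
  have XZ: "X * Z = Z * X" and ZY: "Z * Y = Z * X" using rel(6,7) by simp_all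
  have r3: "X * (X * w) = 0" "Y * (Y * w) = 0" "Z * (Z * w) = 0" "Y * (Z * w) = 0" for w
    using rel(1-4) by (simp_all flip: mult.assoc)
  have mv: "X * (\<phi> c * w) = \<phi> c * (X * w)" "Y * (\<phi> c * w) = \<phi> c * (Y * w)"
    "Z * (\<phi> c * w) = \<phi> c * (Z * w)" for c w
    using central[of c] by (metis mult.assoc)+
  have m1: "X * \<phi> c = \<phi> c * X" "Y * \<phi> c = \<phi> c * Y" "Z * \<phi> c = \<phi> c * Z" for c
    using central by metis+
  have XYX: "X * (Y * X) = 0"
    using arg_cong[OF XY, of "\<lambda>u. u * X"] by (simp add: mult.assoc rel r3)
  have XZX: "X * (Z * X) = 0"
    using arg_cong[OF XZ, of "\<lambda>u. u * X"] by (simp add: mult.assoc rel r3)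
  have ZYX: "Z * (Y * X) = 0"
    using arg_cong[OF ZY, of "\<lambda>u. u * X"] by (simp add: mult.assoc rel r3)
  note red = rel(1-4) r3 XY XZ ZY XYX XZX ZYX
  have pp: "\<phi> c * (\<phi> d * w) = \<phi> (c * d) * w" for c d w by (simp add: \<phi>(3) mult.assoc)
  have ex: "(\<forall>a b. h (a \<oplus>\<^bsub>Lambda q\<^esub> b) = h a + h b) \<and>
    (\<forall>a b. h (a \<otimes>\<^bsub>Lambda q\<^esub> b) = h a * h b) \<and> (\<forall>c. h (lam_scalar c) = \<phi> c) \<and>
    h lam_x = X \<and> h lam_y = Y \<and> h lam_z = Z"
  proof (intro conjI allI)
    fix a b
    show "h (a \<oplus>\<^bsub>Lambda q\<^esub> b) = h a + h b"
      by (simp add: h_def Lambda_defs \<phi>(2) distrib_right)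
    have X: "X * h b = \<phi> (c_1 b) * X - \<phi> (c_y b * q) * (Y * X) + \<phi> (c_z b) * (Z * X)"
      unfolding h_def by (simp add: distrib_left mv m1 red pp)
    have Y: "Y * h b = \<phi> (c_1 b) * Y + \<phi> (c_x b) * (Y * X)"
      unfolding h_def by (simp add: distrib_left mv m1 red)
    have Z: "Z * h b = \<phi> (c_1 b) * Z + \<phi> (c_x b) * (Z * X) + \<phi> (c_y b) * (Z * X)"
      unfolding h_def by (simp add: distrib_left mv m1 red)
    have YX: "Y * (X * h b) = \<phi> (c_1 b) * (Y * X)" and ZX: "Z * (X * h b) = \<phi> (c_1 b) * (Z * X)"
      unfolding X by (simp_all add: distrib_left right_diff_distrib mv red)
    have "h a * h b = \<phi> (c_1 a) * h b + \<phi> (c_x a) * (X * h b) + \<phi> (c_y a) * (Y * h b)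
      + \<phi> (c_z a) * (Z * h b) + \<phi> (c_yx a) * (Y * (X * h b)) + \<phi> (c_zx a) * (Z * (X * h b))"
      unfolding h_def[of a] by (simp add: distrib_right mult.assoc)
    also have "\<dots> = h (a \<otimes>\<^bsub>Lambda q\<^esub> b)"
      unfolding YX ZX unfolding X Y Z unfolding h_def Lambda_defs
      by (simp add: distrib_left right_diff_distrib distrib_right left_diff_distrib
          \<phi>(2) \<phi>d pp \<phi>(3)[symmetric] mult.commute[where 'a = 'k] mult.left_commute[where 'a = 'k])
    finally have "h a * h b = h (a \<otimes>\<^bsub>Lambda q\<^esub> b)" .
    then show "h (a \<otimes>\<^bsub>Lambda q\<^esub> b) = h a * h b" ..
  qed (simp_all add: h_def Lambda_defs \<phi> \<phi>0)
  have uniq: "g = h" if g: "(\<forall>a b. g (a \<oplus>\<^bsub>Lambda q\<^esub> b) = g a + g b) \<and>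
    (\<forall>a b. g (a \<otimes>\<^bsub>Lambda q\<^esub> b) = g a * g b) \<and> (\<forall>c. g (lam_scalar c) = \<phi> c) \<and>
    g lam_x = X \<and> g lam_y = Y \<and> g lam_z = Z" for g
  proof
    fix a
    let ?p = "\<lambda>u v. u \<oplus>\<^bsub>Lambda q\<^esub> v" and ?m = "\<lambda>u v. u \<otimes>\<^bsub>Lambda q\<^esub> v"
    have "a = ?p (?p (?p (?p (?p (lam_scalar (c_1 a)) (?m (lam_scalar (c_x a)) lam_x))
      (?m (lam_scalar (c_y a)) lam_y)) (?m (lam_scalar (c_z a)) lam_z))
      (?m (lam_scalar (c_yx a)) (?m lam_y lam_x))) (?m (lam_scalar (c_zx a)) (?m lam_z lam_x))"
      by (cases a) (simp add: Lambda_defs)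
    then have "g a = g \<dots>" by (rule arg_cong)
    also have "\<dots> = h a" using g by (simp add: h_def)
    finally show "g a = h a" .
  qed
  from ex uniq show ?thesis by (rule ex1I)
qed

text \<open>The underlying \<open>k\<close>-space of a \<open>\<Lambda>(q)\<close>-module.\<close>

definition k_space :: "('k::field lam, 'm) module \<Rightarrow> ('k, 'm) module" where
  "k_space M = mk_module (carrier M) \<zero>\<^bsub>M\<^esub> (add M) (\<lambda>c v. lam_scalar c \<odot>\<^bsub>M\<^esub> v)"

definition finite_dimensional :: "('k::field lam, 'm) module \<Rightarrow> bool" where
  "finite_dimensional M \<longleftrightarrow> vectorspace.fin_dim class_ring (k_space M)"

definition k_dim :: "('k::field lam, 'm) module \<Rightarrow> nat" where
  "k_dim M = vectorspace.dim class_ring (k_space M)"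

lemma vectorspace_k_space:
  assumes "left_module (Lambda q) M"
  shows "vectorspace class_ring (k_space M)"
proof -
  interpret left_module "Lambda q" M by fact
  have s: "lam_scalar (c + d) = lam_scalar c \<oplus>\<^bsub>Lambda q\<^esub> lam_scalar d"
    "lam_scalar (c * d) = lam_scalar c \<otimes>\<^bsub>Lambda q\<^esub> lam_scalar d"
    "lam_scalar 1 = \<one>\<^bsub>Lambda q\<^esub>" "lam_scalar c \<in> carrier (Lambda q)" for c d
    by (simp_all add: Lambda_defs)
  have "abelian_group (k_space M)"
  proof (rule abelian_groupI)
    fix x assume "x \<in> carrier (k_space M)"
    then show "\<exists>y \<in> carrier (k_space M). y \<oplus>\<^bsub>k_space M\<^esub> x = \<zero>\<^bsub>k_space M\<^esub>"
      by (intro bexI[of _ "\<ominus>\<^bsub>M\<^esub> x"]) (simp_all add: k_space_def mk_module_def M.l_neg)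
  qed (simp_all add: k_space_def mk_module_def M.a_ac)
  then have "Module.module class_ring (k_space M)"
    by (intro moduleI class_cring.cring_axioms)
      (simp_all add: k_space_def mk_module_def s smult_closed smult_l_distr smult_r_distr
        smult_assoc smult_one)
  then show ?thesis
    by (simp add: vectorspace_def class_field)
qed

end

theory Submission
  imports Defs
begin

text \<open>
  Write \<open>J\<close> for the radical of \<open>R = \<Lambda>(q)\<close>. The algebra is local of dimension \<open>6\<close> with \<open>dim J = 5\<close>,
  \<open>dim J\<^sup>2 = 2\<close> and \<open>J\<^sup>3 = 0\<close>, and the theorem follows from these numbers on both sides by counting
  dimensions.

  Let \<open>Ext\<^sup>1(M, R) = 0\<close>, and let \<open>U\<close> be the kernel of a projective cover \<open>R\<^sup>t \<rightarrow> M\<close>. It lies in \<open>J\<^sup>t\<close>, so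
  \<open>J U\<close> lies in \<open>(J\<^sup>2)\<^sup>t\<close> and \<open>U\<close> needs \<open>n \<ge> 4 t - dim M\<close> generators. All homomorphisms \<open>U \<rightarrow> R\<close>
  extend to \<open>R\<^sup>t\<close>. Those with values in \<open>J\<^sup>2\<close> which kill \<open>J U\<close> form a space of dimension \<open>2 n\<close>; at least
  one coordinate function of \<open>R\<^sup>t\<close> does not restrict to such a homomorphism; and an extension matters
  only modulo \<open>J\<^sup>2\<close>. Hence \<open>2 n + 1 \<le> 4 t\<close> (\<open>extension_bound\<close>), so \<open>4 t + 1 \<le> 2 dim M\<close>, and
  \<open>dim M \<le> 3\<close> leaves only \<open>t = 1\<close> and \<open>dim M = 3\<close> (\<open>Ext1_vanishing_cyclic\<close>). Then \<open>\<Omega>M\<close> has dimension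
  \<open>6 - 3 = 3\<close>, it is again semi-Gorenstein-projective, and the argument is repeated.

  On the other side, if \<open>M\<close> is infinitely torsionfree, then it is reflexive and the right module
  \<open>M\<^sup>* = Hom(M, R)\<close> is semi-Gorenstein-projective (\<open>infinitely_torsionfree_reflexive\<close>): in a presentation
  \<open>P\<^sub>1 \<rightarrow> P\<^sub>0 \<rightarrow> M\<close>, the module \<open>M\<^sup>*\<close> is a second syzygy of the transpose. If \<open>p\<close> is the number of
  generators of \<open>M\<^sup>*\<close>, reflexivity yields an embedding \<open>M \<rightarrow> R\<^sup>p\<close> with image containing \<open>(J\<^sup>2)\<^sup>p\<close>
  (\<open>reflexive_left_generates_dual\<close>); so \<open>p = 1\<close>, and \<open>M\<close> is a left ideal strictly between \<open>J\<^sup>2\<close> and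
  \<open>R\<close>, of dimension \<open>3\<close>, which is cyclic by \<open>extension_bound\<close> again (\<open>reflexive_dim_3\<close>). The inclusion
  of \<open>M\<close> in \<open>R\<close> is the minimal left approximation, and \<open>\<mho>M = R/M\<close> has dimension \<open>3\<close>. It is reflexive
  with semi-Gorenstein-projective dual, because \<open>(R/M)\<^sup>*\<close> is the syzygy of \<open>M\<^sup>*\<close>
  (\<open>reflexive_dual_semi_GP_cokernel\<close>). So this argument can also be repeated.

  All modules in question are cyclic and non-zero, hence local (\<open>cyclic_local\<close>).
\<close>


section \<open>Modules, homomorphisms, kernels and quotients\<close>

lemma mk_module_simps [simp]:
  "carrier (mk_module C z a s) = C" "zero (mk_module C z a s) = z"
  "add (mk_module C z a s) = a" "smult (mk_module C z a s) = s"
  by (simp_all add: mk_module_def)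

lemma regular_module_simps [simp]:
  "carrier (regular_module R) = carrier R" "zero (regular_module R) = zero R"
  "add (regular_module R) = add R" "smult (regular_module R) = mult R"
  by (simp_all add: regular_module_def)

lemma free_module_simps:
  "carrier (free_module R n) = ({..<n} \<rightarrow>\<^sub>E carrier R)"
  "zero (free_module R n) = (\<lambda>i\<in>{..<n}. \<zero>\<^bsub>R\<^esub>)"
  "add (free_module R n) = (\<lambda>v w. \<lambda>i\<in>{..<n}. v i \<oplus>\<^bsub>R\<^esub> w i)"
  "smult (free_module R n) = (\<lambda>r v. \<lambda>i\<in>{..<n}. r \<otimes>\<^bsub>R\<^esub> v i)"
  by (simp_all add: free_module_def)

declare free_module_simps(2-4) [simp]

lemma dual_simps [simp]:
  "carrier (dual R M) = Hom R M (regular_module R)"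
  "zero (dual R M) = (\<lambda>x \<in> carrier M. \<zero>\<^bsub>R\<^esub>)"
  "add (dual R M) = (\<lambda>f g. \<lambda>x \<in> carrier M. f x \<oplus>\<^bsub>R\<^esub> g x)"
  "smult (dual R M) = (\<lambda>r f. \<lambda>x \<in> carrier M. f x \<otimes>\<^bsub>R\<^esub> r)"
  by (simp_all add: dual_def)

lemma opposite_simps [simp]:
  "carrier (opposite R) = carrier R" "zero (opposite R) = zero R" "one (opposite R) = one R"
  "add (opposite R) = add R" "mult (opposite R) = (\<lambda>a b. b \<otimes>\<^bsub>R\<^esub> a)"
  by (simp_all add: opposite_def)

lemma quotient_module_simps [simp]:
  "carrier (quotient_module M U) = A_RCOSETS M U" "zero (quotient_module M U) = U"
  "add (quotient_module M U) = set_add M"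
  "smult (quotient_module M U) = (\<lambda>r X. set_add M U ((\<lambda>x. r \<odot>\<^bsub>M\<^esub> x) ` X))"
  by (simp_all add: quotient_module_def)

lemma opposite_opposite [simp]: "opposite (opposite R) = R"
  by (simp add: opposite_def)

lemma a_kernel_iff [simp]: "x \<in> a_kernel M N f \<longleftrightarrow> x \<in> carrier M \<and> f x = \<zero>\<^bsub>N\<^esub>"
  by (simp add: a_kernel_def')

lemma left_moduleI:
  assumes "ring R" "abelian_group M"
    and "\<And>a x. a \<in> carrier R \<Longrightarrow> x \<in> carrier M \<Longrightarrow> a \<odot>\<^bsub>M\<^esub> x \<in> carrier M"
    and "\<And>a b x. a \<in> carrier R \<Longrightarrow> b \<in> carrier R \<Longrightarrow> x \<in> carrier M \<Longrightarrow>
      (a \<oplus>\<^bsub>R\<^esub> b) \<odot>\<^bsub>M\<^esub> x = a \<odot>\<^bsub>M\<^esub> x \<oplus>\<^bsub>M\<^esub> b \<odot>\<^bsub>M\<^esub> x"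
    and "\<And>a x y. a \<in> carrier R \<Longrightarrow> x \<in> carrier M \<Longrightarrow> y \<in> carrier M \<Longrightarrow>
      a \<odot>\<^bsub>M\<^esub> (x \<oplus>\<^bsub>M\<^esub> y) = a \<odot>\<^bsub>M\<^esub> x \<oplus>\<^bsub>M\<^esub> a \<odot>\<^bsub>M\<^esub> y"
    and "\<And>a b x. a \<in> carrier R \<Longrightarrow> b \<in> carrier R \<Longrightarrow> x \<in> carrier M \<Longrightarrow>
      (a \<otimes>\<^bsub>R\<^esub> b) \<odot>\<^bsub>M\<^esub> x = a \<odot>\<^bsub>M\<^esub> (b \<odot>\<^bsub>M\<^esub> x)"
    and "\<And>x. x \<in> carrier M \<Longrightarrow> \<one>\<^bsub>R\<^esub> \<odot>\<^bsub>M\<^esub> x = x"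
  shows "left_module R M"
  using assms by (simp add: left_module_def left_module_axioms_def)

context left_module
begin

lemma smult_l_null [simp]: "x \<in> carrier M \<Longrightarrow> \<zero> \<odot>\<^bsub>M\<^esub> x = \<zero>\<^bsub>M\<^esub>"
proof -
  assume x: "x \<in> carrier M"
  have "\<zero> \<odot>\<^bsub>M\<^esub> x \<oplus>\<^bsub>M\<^esub> \<zero> \<odot>\<^bsub>M\<^esub> x = \<zero> \<odot>\<^bsub>M\<^esub> x \<oplus>\<^bsub>M\<^esub> \<zero>\<^bsub>M\<^esub>"
    using x smult_l_distr[of \<zero> \<zero> x] by (simp add: smult_closed)
  then show ?thesis using x by (simp add: smult_closed)
qed

lemma smult_r_null [simp]: "a \<in> carrier R \<Longrightarrow> a \<odot>\<^bsub>M\<^esub> \<zero>\<^bsub>M\<^esub> = \<zero>\<^bsub>M\<^esub>"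
proof -
  assume a: "a \<in> carrier R"
  have "a \<odot>\<^bsub>M\<^esub> \<zero>\<^bsub>M\<^esub> \<oplus>\<^bsub>M\<^esub> a \<odot>\<^bsub>M\<^esub> \<zero>\<^bsub>M\<^esub> = a \<odot>\<^bsub>M\<^esub> \<zero>\<^bsub>M\<^esub> \<oplus>\<^bsub>M\<^esub> \<zero>\<^bsub>M\<^esub>"
    using a smult_r_distr[of a "\<zero>\<^bsub>M\<^esub>" "\<zero>\<^bsub>M\<^esub>"] by (simp add: smult_closed)
  then show ?thesis using a by (simp add: smult_closed)
qed

lemma smult_l_minus: "a \<in> carrier R \<Longrightarrow> x \<in> carrier M \<Longrightarrow> (\<ominus> a) \<odot>\<^bsub>M\<^esub> x = \<ominus>\<^bsub>M\<^esub> (a \<odot>\<^bsub>M\<^esub> x)"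
proof -
  assume a: "a \<in> carrier R" and x: "x \<in> carrier M"
  have "(\<ominus> a) \<odot>\<^bsub>M\<^esub> x \<oplus>\<^bsub>M\<^esub> a \<odot>\<^bsub>M\<^esub> x = \<zero>\<^bsub>M\<^esub>"
    using a x smult_l_distr[of "\<ominus> a" a x] by (simp add: R.l_neg)
  then show ?thesis using a x by (simp add: M.minus_equality smult_closed)
qed

lemma smult_minus_one: "x \<in> carrier M \<Longrightarrow> (\<ominus> \<one>) \<odot>\<^bsub>M\<^esub> x = \<ominus>\<^bsub>M\<^esub> x"
  by (simp add: smult_l_minus smult_one)

lemma ring_axioms': "ring R"
  by (rule R.ring_axioms)

lemma diff_zero_iff: "x \<in> carrier M \<Longrightarrow> y \<in> carrier M \<Longrightarrow> x \<oplus>\<^bsub>M\<^esub> (\<ominus>\<^bsub>M\<^esub> y) = \<zero>\<^bsub>M\<^esub> \<longleftrightarrow> x = y"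
  by (metis M.a_inv_closed M.minus_equality M.minus_minus M.r_neg)

end

lemma submoduleI:
  assumes "left_module R M" and sub: "U \<subseteq> carrier M" and z: "\<zero>\<^bsub>M\<^esub> \<in> U"
    and a: "\<And>x y. x \<in> U \<Longrightarrow> y \<in> U \<Longrightarrow> x \<oplus>\<^bsub>M\<^esub> y \<in> U"
    and s: "\<And>r x. r \<in> carrier R \<Longrightarrow> x \<in> U \<Longrightarrow> r \<odot>\<^bsub>M\<^esub> x \<in> U"
  shows "Module.submodule U R M"
proof -
  interpret left_module R M by fact
  have inv: "\<ominus>\<^bsub>M\<^esub> x \<in> U" if "x \<in> U" for x
    using that sub s[of "\<ominus>\<^bsub>R\<^esub> \<one>\<^bsub>R\<^esub>" x] smult_minus_one[of x] by auto
  show ?thesis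
    unfolding Module.submodule_def submodule_axioms_def
  proof (intro conjI allI impI)
    show "subgroup U (add_monoid M)"
      using sub z a inv by (intro M.add.subgroupI) (auto simp: a_inv_def)
  qed (use s in auto)
qed

lemma submoduleD:
  assumes "Module.submodule U R M"
  shows "U \<subseteq> carrier M" "\<zero>\<^bsub>M\<^esub> \<in> U" "\<And>x y. x \<in> U \<Longrightarrow> y \<in> U \<Longrightarrow> x \<oplus>\<^bsub>M\<^esub> y \<in> U"
    "\<And>r x. r \<in> carrier R \<Longrightarrow> x \<in> U \<Longrightarrow> r \<odot>\<^bsub>M\<^esub> x \<in> U"
  using assms subgroup.subset[of U "add_monoid M"] subgroup.one_closed[of U "add_monoid M"]
    subgroup.m_closed[of U "add_monoid M"]
  by (auto simp: Module.submodule_def submodule_axioms_def)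

lemma submodule_neg:
  assumes "left_module R M" "Module.submodule U R M" "x \<in> U"
  shows "\<ominus>\<^bsub>M\<^esub> x \<in> U"
proof -
  interpret left_module R M by fact
  have "(\<ominus>\<^bsub>R\<^esub> \<one>\<^bsub>R\<^esub>) \<odot>\<^bsub>M\<^esub> x \<in> U" using submoduleD[OF assms(2)] assms(3) by simp
  then show ?thesis using submoduleD(1)[OF assms(2)] assms(3) by (simp add: smult_minus_one subsetD)
qed

lemma left_module_submodule:
  assumes "left_module R M" "Module.submodule U R M"
  shows "left_module R (M\<lparr>carrier := U\<rparr>)"
proof -
  interpret left_module R M by fact
  note U = submoduleD[OF assms(2)]
  have Uc: "x \<in> U \<Longrightarrow> x \<in> carrier M" for x using U(1) by auto
  show ?thesis
  proof (rule left_moduleI)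
    show "abelian_group (M\<lparr>carrier := U\<rparr>)"
    proof (rule abelian_groupI)
      fix x assume "x \<in> carrier (M\<lparr>carrier := U\<rparr>)"
      then show "\<exists>y\<in>carrier (M\<lparr>carrier := U\<rparr>). y \<oplus>\<^bsub>M\<lparr>carrier := U\<rparr>\<^esub> x = \<zero>\<^bsub>M\<lparr>carrier := U\<rparr>\<^esub>"
        using submodule_neg[OF assms] Uc by (auto intro!: bexI[of _ "\<ominus>\<^bsub>M\<^esub> x"] simp: M.l_neg)
    qed (use U Uc in \<open>auto simp: M.a_ac\<close>)
  qed (use U Uc in \<open>auto simp: smult_l_distr smult_r_distr smult_assoc smult_one ring_axioms'\<close>)
qed

lemma homI:
  assumes "\<And>x. x \<in> carrier M \<Longrightarrow> f x \<in> carrier N"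
    and "\<And>x y. x \<in> carrier M \<Longrightarrow> y \<in> carrier M \<Longrightarrow> f (x \<oplus>\<^bsub>M\<^esub> y) = f x \<oplus>\<^bsub>N\<^esub> f y"
    and "\<And>r x. r \<in> carrier R \<Longrightarrow> x \<in> carrier M \<Longrightarrow> f (r \<odot>\<^bsub>M\<^esub> x) = r \<odot>\<^bsub>N\<^esub> f x"
  shows "f \<in> module_homs R M N"
  using assms by (simp add: LinearCombinations.module_hom_def)

lemma homD:
  assumes "f \<in> module_homs R M N"
  shows "\<And>x. x \<in> carrier M \<Longrightarrow> f x \<in> carrier N"
    and "\<And>x y. x \<in> carrier M \<Longrightarrow> y \<in> carrier M \<Longrightarrow> f (x \<oplus>\<^bsub>M\<^esub> y) = f x \<oplus>\<^bsub>N\<^esub> f y"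
    and "\<And>r x. r \<in> carrier R \<Longrightarrow> x \<in> carrier M \<Longrightarrow> f (r \<odot>\<^bsub>M\<^esub> x) = r \<odot>\<^bsub>N\<^esub> f x"
  using assms by (auto simp: LinearCombinations.module_hom_def)

lemma hom_zero:
  assumes "f \<in> module_homs R M N" "left_module R M" "left_module R N"
  shows "f \<zero>\<^bsub>M\<^esub> = \<zero>\<^bsub>N\<^esub>"
proof -
  interpret M: left_module R M by fact
  interpret N: left_module R N by fact
  have "f (\<zero>\<^bsub>R\<^esub> \<odot>\<^bsub>M\<^esub> \<zero>\<^bsub>M\<^esub>) = \<zero>\<^bsub>R\<^esub> \<odot>\<^bsub>N\<^esub> f \<zero>\<^bsub>M\<^esub>" by (rule homD(3)[OF assms(1)]) simp_all
  then show ?thesis using homD(1)[OF assms(1)] by simp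
qed

lemma hom_minus:
  assumes "f \<in> module_homs R M N" "left_module R M" "left_module R N" "x \<in> carrier M"
  shows "f (\<ominus>\<^bsub>M\<^esub> x) = \<ominus>\<^bsub>N\<^esub> f x"
proof -
  interpret M: left_module R M by fact
  interpret N: left_module R N by fact
  have "f ((\<ominus>\<^bsub>R\<^esub> \<one>\<^bsub>R\<^esub>) \<odot>\<^bsub>M\<^esub> x) = (\<ominus>\<^bsub>R\<^esub> \<one>\<^bsub>R\<^esub>) \<odot>\<^bsub>N\<^esub> f x" using homD[OF assms(1)] assms(4) by simp
  then show ?thesis
    using homD(1)[OF assms(1)] assms(4) by (simp add: M.smult_minus_one N.smult_minus_one)
qed

lemma hom_comp:
  assumes "f \<in> module_homs R M N" "g \<in> module_homs R N L"
  shows "g \<circ> f \<in> module_homs R M L"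
  using homD[OF assms(1)] homD[OF assms(2)] by (intro homI) auto

lemma hom_cong:
  assumes "f \<in> module_homs R M N" "\<And>x. x \<in> carrier M \<Longrightarrow> g x = f x" "left_module R M"
  shows "g \<in> module_homs R M N"
proof -
  interpret left_module R M by fact
  show ?thesis using homD[OF assms(1)] assms(2) by (intro homI) (auto simp: smult_closed)
qed

lemma hom_restrict:
  assumes "f \<in> module_homs R M N" "left_module R M"
  shows "restrict f (carrier M) \<in> Hom R M N"
  using hom_cong[OF assms(1), of "restrict f (carrier M)"] assms(2) by (simp add: Hom_def)

lemma HomD:
  assumes "f \<in> Hom R M N"
  shows "f \<in> module_homs R M N" "f \<in> extensional (carrier M)"
  using assms by (auto simp: Hom_def)

lemma Hom_eqI:
  assumes "f \<in> Hom R M N" "g \<in> Hom R M N" "\<And>x. x \<in> carrier M \<Longrightarrow> f x = g x"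
  shows "f = g"
  using assms by (auto simp: Hom_def intro: extensionalityI)

lemma hom_codomain_restrict:
  assumes "f \<in> module_homs R M N" "\<And>x. x \<in> carrier M \<Longrightarrow> f x \<in> U"
  shows "f \<in> module_homs R M (N\<lparr>carrier := U\<rparr>)"
  using homD[OF assms(1)] assms(2) by (intro homI) auto

lemma hom_codomain_extend:
  assumes "f \<in> module_homs R M (N\<lparr>carrier := U\<rparr>)" "U \<subseteq> carrier N"
  shows "f \<in> module_homs R M N"
  using homD[OF assms(1)] assms(2) by (intro homI) auto

lemma submodule_kernel:
  assumes "f \<in> module_homs R M N" "left_module R M" "left_module R N"
  shows "Module.submodule (a_kernel M N f) R M"
proof -
  interpret M: left_module R M by fact
  interpret N: left_module R N by fact
  show ?thesis
    using homD[OF assms(1)] hom_zero[OF assms]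
    by (intro submoduleI[OF assms(2)]) (auto simp: M.smult_closed)
qed

lemma submodule_image:
  assumes "f \<in> module_homs R M N" "left_module R M" "left_module R N"
    "Module.submodule U R M"
  shows "Module.submodule (f ` U) R N"
proof -
  note U = submoduleD[OF assms(4)] and f = homD[OF assms(1)]
  show ?thesis
  proof (rule submoduleI[OF assms(3)])
    show "\<zero>\<^bsub>N\<^esub> \<in> f ` U" using U(2) hom_zero[OF assms(1-3)] by (metis imageI)
  next
    fix x y assume "x \<in> f ` U" "y \<in> f ` U"
    then obtain a b where "a \<in> U" "b \<in> U" "x = f a" "y = f b" by auto
    moreover from this have "f (a \<oplus>\<^bsub>M\<^esub> b) = f a \<oplus>\<^bsub>N\<^esub> f b" using U(1) by (intro f(2)) auto
    ultimately show "x \<oplus>\<^bsub>N\<^esub> y \<in> f ` U" using U by (metis imageI)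
  next
    fix r x assume "r \<in> carrier R" "x \<in> f ` U"
    then obtain a where "a \<in> U" "x = f a" "r \<in> carrier R" by auto
    moreover from this have "f (r \<odot>\<^bsub>M\<^esub> a) = r \<odot>\<^bsub>N\<^esub> f a" using U(1) by (intro f(3)) auto
    ultimately show "r \<odot>\<^bsub>N\<^esub> x \<in> f ` U" using U by (metis imageI)
  qed (use U f in auto)
qed

lemma submodule_carrier:
  assumes "left_module R M"
  shows "Module.submodule (carrier M) R M"
proof -
  interpret left_module R M by fact
  show ?thesis by (intro submoduleI[OF assms]) (auto simp: smult_closed)
qed

lemma hom_inj_onI:
  assumes "f \<in> module_homs R M N" "left_module R M" "left_module R N"
    "\<And>x. x \<in> carrier M \<Longrightarrow> f x = \<zero>\<^bsub>N\<^esub> \<Longrightarrow> x = \<zero>\<^bsub>M\<^esub>"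
  shows "inj_on f (carrier M)"
proof (rule inj_onI)
  interpret M: left_module R M by fact
  interpret N: left_module R N by fact
  fix x y assume xy: "x \<in> carrier M" "y \<in> carrier M" "f x = f y"
  have "f (x \<oplus>\<^bsub>M\<^esub> (\<ominus>\<^bsub>M\<^esub> y)) = \<zero>\<^bsub>N\<^esub>"
    using xy homD[OF assms(1)] hom_minus[OF assms(1-3)] by (simp add: N.M.r_neg)
  then have "x \<oplus>\<^bsub>M\<^esub> (\<ominus>\<^bsub>M\<^esub> y) = \<zero>\<^bsub>M\<^esub>" using assms(4) xy by simp
  then show "x = y" using M.diff_zero_iff xy by simp
qed

lemma hom_inj_zero_iff:
  assumes "f \<in> module_homs R M N" "left_module R M" "left_module R N" "inj_on f (carrier M)"
    "x \<in> carrier M"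
  shows "f x = \<zero>\<^bsub>N\<^esub> \<longleftrightarrow> x = \<zero>\<^bsub>M\<^esub>"
proof -
  interpret M: left_module R M by fact
  show ?thesis
    using inj_on_eq_iff[OF assms(4,5) M.M.zero_closed] unfolding hom_zero[OF assms(1-3)] .
qed

lemma hom_eq_iff_diff:
  assumes "f \<in> module_homs R M N" "left_module R M" "left_module R N"
    "x \<in> carrier M" "y \<in> carrier M"
  shows "f x = f y \<longleftrightarrow> x \<oplus>\<^bsub>M\<^esub> (\<ominus>\<^bsub>M\<^esub> y) \<in> a_kernel M N f"
proof -
  interpret M: left_module R M by fact
  interpret N: left_module R N by fact
  show ?thesis
    using assms homD[OF assms(1)] hom_minus[OF assms(1-3)] N.diff_zero_iff[of "f x" "f y"] by simp
qed

lemma hom_inv_into: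
  assumes "f \<in> module_homs R M N" "left_module R M" "bij_betw f (carrier M) (carrier N)"
  shows "inv_into (carrier M) f \<in> module_homs R N M"
    "bij_betw (inv_into (carrier M) f) (carrier N) (carrier M)"
proof -
  interpret left_module R M by fact
  show "bij_betw (inv_into (carrier M) f) (carrier N) (carrier M)"
    by (rule bij_betw_inv_into[OF assms(3)])
  note g = this
  let ?g = "inv_into (carrier M) f"
  have gc: "?g y \<in> carrier M" if "y \<in> carrier N" for y using g that by (auto simp: bij_betw_def)
  have fg: "f (?g y) = y" if "y \<in> carrier N" for y
    using assms(3) that by (simp add: bij_betw_inv_into_right)
  have gf: "?g (f x) = x" if "x \<in> carrier M" for x
    using assms(3) that by (simp add: bij_betw_inv_into_left)
  show "?g \<in> module_homs R N M"
  proof (rule homI)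
    fix x y assume "x \<in> carrier N" "y \<in> carrier N"
    then show "?g (x \<oplus>\<^bsub>N\<^esub> y) = ?g x \<oplus>\<^bsub>M\<^esub> ?g y"
      using homD(2)[OF assms(1), of "?g x" "?g y"] gf[of "?g x \<oplus>\<^bsub>M\<^esub> ?g y"] by (simp add: gc fg)
  next
    fix r x assume "r \<in> carrier R" "x \<in> carrier N"
    then show "?g (r \<odot>\<^bsub>N\<^esub> x) = r \<odot>\<^bsub>M\<^esub> ?g x"
      using homD(3)[OF assms(1), of r "?g x"] gf[of "r \<odot>\<^bsub>M\<^esub> ?g x"] by (simp add: gc fg smult_closed)
  qed (rule gc)
qed

lemma hom_factor:
  assumes "p \<in> module_homs R A B" "f \<in> module_homs R A C"
    and "left_module R A" "left_module R B" "left_module R C"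
    and surj: "p ` carrier A = carrier B"
    and ker: "\<And>x. x \<in> carrier A \<Longrightarrow> p x = \<zero>\<^bsub>B\<^esub> \<Longrightarrow> f x = \<zero>\<^bsub>C\<^esub>"
  shows "\<exists>g \<in> module_homs R B C. \<forall>x \<in> carrier A. g (p x) = f x"
proof -
  interpret A: left_module R A by fact
  interpret B: left_module R B by fact
  define s where "s = inv_into (carrier A) p"
  have s: "s y \<in> carrier A" "p (s y) = y" if "y \<in> carrier B" for y
    using that surj by (auto simp: s_def inv_into_into f_inv_into_f)
  have eq: "f x = f y" if "x \<in> carrier A" "y \<in> carrier A" "p x = p y" for x y
    using that hom_eq_iff_diff[OF assms(1,3,4), of x y] hom_eq_iff_diff[OF assms(2,3,5), of x y] ker
    by auto
  have fs: "f (s (p x)) = f x" if "x \<in> carrier A" for x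
    using that homD(1)[OF assms(1)] s by (intro eq) auto
  have "f \<circ> s \<in> module_homs R B C"
  proof (rule homI)
    fix x y assume xy: "x \<in> carrier B" "y \<in> carrier B"
    have "f (s (x \<oplus>\<^bsub>B\<^esub> y)) = f (s x \<oplus>\<^bsub>A\<^esub> s y)"
      using xy s homD[OF assms(1)] by (intro eq) auto
    then show "(f \<circ> s) (x \<oplus>\<^bsub>B\<^esub> y) = (f \<circ> s) x \<oplus>\<^bsub>C\<^esub> (f \<circ> s) y"
      using xy s homD[OF assms(2)] by simp
  next
    fix r x assume rx: "r \<in> carrier R" "x \<in> carrier B"
    have "f (s (r \<odot>\<^bsub>B\<^esub> x)) = f (r \<odot>\<^bsub>A\<^esub> s x)"
      using rx s homD[OF assms(1)] by (intro eq) (auto simp: A.smult_closed B.smult_closed)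
    then show "(f \<circ> s) (r \<odot>\<^bsub>B\<^esub> x) = r \<odot>\<^bsub>C\<^esub> (f \<circ> s) x"
      using rx s homD[OF assms(2)] by simp
  qed (use s homD[OF assms(2)] in auto)
  then show ?thesis using fs by (intro bexI[of _ "f \<circ> s"]) auto
qed

lemma iso_of_same_kernel:
  assumes "p \<in> module_homs R A B" "f \<in> module_homs R A C"
    and "left_module R A" "left_module R B" "left_module R C"
    and "p ` carrier A = carrier B" "f ` carrier A = carrier C"
    and ker: "\<And>x. x \<in> carrier A \<Longrightarrow> p x = \<zero>\<^bsub>B\<^esub> \<longleftrightarrow> f x = \<zero>\<^bsub>C\<^esub>"
  shows "\<exists>g \<in> module_homs R B C. bij_betw g (carrier B) (carrier C) \<and> (\<forall>x \<in> carrier A. g (p x) = f x)"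
proof -
  obtain g where g: "g \<in> module_homs R B C" "\<forall>x \<in> carrier A. g (p x) = f x"
    using hom_factor[OF assms(1-6)] ker by blast
  have "inj_on g (carrier B)"
  proof (rule hom_inj_onI[OF g(1) assms(4,5)])
    fix y assume y: "y \<in> carrier B" "g y = \<zero>\<^bsub>C\<^esub>"
    then obtain x where "x \<in> carrier A" "y = p x" using assms(6) by auto
    then show "y = \<zero>\<^bsub>B\<^esub>" using y g(2) ker by auto
  qed
  moreover have "g ` carrier B = carrier C"
    using g(2) assms(6,7) by (metis image_cong image_image)
  ultimately show ?thesis using g by (auto simp: bij_betw_def)
qed

lemma left_module_image:
  assumes "left_module R P" and surj: "p ` carrier P = carrier Q" and z: "p \<zero>\<^bsub>P\<^esub> = \<zero>\<^bsub>Q\<^esub>"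
    and add: "\<And>x y. x \<in> carrier P \<Longrightarrow> y \<in> carrier P \<Longrightarrow> p (x \<oplus>\<^bsub>P\<^esub> y) = p x \<oplus>\<^bsub>Q\<^esub> p y"
    and sm: "\<And>r x. r \<in> carrier R \<Longrightarrow> x \<in> carrier P \<Longrightarrow> p (r \<odot>\<^bsub>P\<^esub> x) = r \<odot>\<^bsub>Q\<^esub> p x"
  shows "left_module R Q" "p \<in> module_homs R P Q"
proof -
  interpret left_module R P by fact
  have rep: "\<exists>a \<in> carrier P. x = p a" if "x \<in> carrier Q" for x
  proof -
    have "x \<in> p ` carrier P" unfolding surj by (rule that)
    then show ?thesis by blast
  qed
  have pc: "p a \<in> carrier Q" if "a \<in> carrier P" for a unfolding surj[symmetric] using that by simp
  note ps = add[symmetric] sm[symmetric] z[symmetric] pc smult_closed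
  show "left_module R Q"
  proof (rule left_moduleI)
    show "abelian_group Q"
    proof (rule abelian_groupI)
      fix x y assume "x \<in> carrier Q" "y \<in> carrier Q"
      then obtain a b where ab: "a \<in> carrier P" "x = p a" "b \<in> carrier P" "y = p b"
        using rep by blast
      show "x \<oplus>\<^bsub>Q\<^esub> y \<in> carrier Q" using ab by (simp add: ps)
      show "x \<oplus>\<^bsub>Q\<^esub> y = y \<oplus>\<^bsub>Q\<^esub> x" using ab by (simp add: ps M.a_comm)
      fix w assume "w \<in> carrier Q"
      then obtain c where "c \<in> carrier P" "w = p c" using rep by blast
      then show "x \<oplus>\<^bsub>Q\<^esub> y \<oplus>\<^bsub>Q\<^esub> w = x \<oplus>\<^bsub>Q\<^esub> (y \<oplus>\<^bsub>Q\<^esub> w)" using ab by (simp add: ps M.a_assoc)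
    next
      fix x assume "x \<in> carrier Q"
      then obtain a where a: "a \<in> carrier P" "x = p a" using rep by blast
      show "\<zero>\<^bsub>Q\<^esub> \<oplus>\<^bsub>Q\<^esub> x = x" using a by (simp add: ps)
      have "p (\<ominus>\<^bsub>P\<^esub> a) \<oplus>\<^bsub>Q\<^esub> x = \<zero>\<^bsub>Q\<^esub>" using a by (simp add: ps M.l_neg)
      then show "\<exists>y\<in>carrier Q. y \<oplus>\<^bsub>Q\<^esub> x = \<zero>\<^bsub>Q\<^esub>" using pc[of "\<ominus>\<^bsub>P\<^esub> a"] a by blast
    qed (simp add: ps)
  next
    fix r s x assume r: "r \<in> carrier R" "s \<in> carrier R" and "x \<in> carrier Q"
    then obtain a where a: "a \<in> carrier P" "x = p a" using rep by blast
    show "(r \<oplus>\<^bsub>R\<^esub> s) \<odot>\<^bsub>Q\<^esub> x = r \<odot>\<^bsub>Q\<^esub> x \<oplus>\<^bsub>Q\<^esub> s \<odot>\<^bsub>Q\<^esub> x" "(r \<otimes>\<^bsub>R\<^esub> s) \<odot>\<^bsub>Q\<^esub> x = r \<odot>\<^bsub>Q\<^esub> (s \<odot>\<^bsub>Q\<^esub> x)"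
      using a r by (simp_all add: ps smult_l_distr smult_assoc)
    fix y assume "y \<in> carrier Q"
    then obtain b where b: "b \<in> carrier P" "y = p b" using rep by blast
    then show "r \<odot>\<^bsub>Q\<^esub> (x \<oplus>\<^bsub>Q\<^esub> y) = r \<odot>\<^bsub>Q\<^esub> x \<oplus>\<^bsub>Q\<^esub> r \<odot>\<^bsub>Q\<^esub> y"
      using a r by (simp add: ps smult_r_distr)
  next
    fix r x assume r: "r \<in> carrier R" and "x \<in> carrier Q"
    then obtain a where a: "a \<in> carrier P" "x = p a" using rep by blast
    then show "r \<odot>\<^bsub>Q\<^esub> x \<in> carrier Q" using r by (simp add: ps)
  next
    fix x assume "x \<in> carrier Q"
    then obtain a where a: "a \<in> carrier P" "x = p a" using rep by blast
    then show "\<one>\<^bsub>R\<^esub> \<odot>\<^bsub>Q\<^esub> x = x" by (simp add: ps smult_one)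
  qed (rule ring_axioms')
  show "p \<in> module_homs R P Q" using pc add sm by (intro homI)
qed

lemma quotient_projection:
  assumes "left_module R P" "Module.submodule U R P"
  defines "p \<equiv> \<lambda>x. a_r_coset P U x"
  shows "left_module R (quotient_module P U)"
    and "p \<in> module_homs R P (quotient_module P U)"
    and "p ` carrier P = carrier (quotient_module P U)"
    and "\<And>x. x \<in> carrier P \<Longrightarrow> p x = \<zero>\<^bsub>quotient_module P U\<^esub> \<longleftrightarrow> x \<in> U"
proof -
  interpret left_module R P by fact
  note U = submoduleD[OF assms(2)]
  have "additive_subgroup U P"
    using assms(2) by (auto simp: Module.submodule_def additive_subgroup_def)
  then interpret U: abelian_subgroup U P
    by (intro abelian_subgroupI3 M.abelian_group_axioms)
  let ?Q = "quotient_module P U"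
  have surj: "p ` carrier P = carrier ?Q"
    by (auto simp: p_def A_RCOSETS_def')
  have add: "p (x \<oplus>\<^bsub>P\<^esub> y) = p x <+>\<^bsub>P\<^esub> p y" if "x \<in> carrier P" "y \<in> carrier P" for x y
    unfolding p_def using U.a_rcos_sum[OF that] by simp
  have mem: "y \<in> p x \<longleftrightarrow> (\<exists>u\<in>U. y = u \<oplus>\<^bsub>P\<^esub> x)" for x y
    by (auto simp: p_def a_r_coset_def')
  have sm: "p (r \<odot>\<^bsub>P\<^esub> x) = r \<odot>\<^bsub>?Q\<^esub> p x" if r: "r \<in> carrier R" and x: "x \<in> carrier P" for r x
  proof (rule Set.set_eqI)
    fix y
    have "y \<in> r \<odot>\<^bsub>?Q\<^esub> p x \<longleftrightarrow> (\<exists>u\<in>U. \<exists>v\<in>U. y = u \<oplus>\<^bsub>P\<^esub> (r \<odot>\<^bsub>P\<^esub> (v \<oplus>\<^bsub>P\<^esub> x)))"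
    proof -
      have "p x = (\<lambda>v. v \<oplus>\<^bsub>P\<^esub> x) ` U" by (auto simp: mem)
      then show ?thesis by (auto simp: set_add_def')
    qed
    also have "\<dots> \<longleftrightarrow> (\<exists>u\<in>U. \<exists>v\<in>U. y = (u \<oplus>\<^bsub>P\<^esub> r \<odot>\<^bsub>P\<^esub> v) \<oplus>\<^bsub>P\<^esub> r \<odot>\<^bsub>P\<^esub> x)"
    proof -
      have "u \<oplus>\<^bsub>P\<^esub> (r \<odot>\<^bsub>P\<^esub> (v \<oplus>\<^bsub>P\<^esub> x)) = (u \<oplus>\<^bsub>P\<^esub> r \<odot>\<^bsub>P\<^esub> v) \<oplus>\<^bsub>P\<^esub> r \<odot>\<^bsub>P\<^esub> x" if "u \<in> U" "v \<in> U" for u v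
        using that U(1) r x by (simp add: smult_r_distr smult_closed M.a_assoc subsetD)
      then show ?thesis by (intro bex_cong refl) (simp only:)
    qed
    also have "\<dots> \<longleftrightarrow> (\<exists>u\<in>U. y = u \<oplus>\<^bsub>P\<^esub> r \<odot>\<^bsub>P\<^esub> x)"
    proof
      assume "\<exists>u\<in>U. y = u \<oplus>\<^bsub>P\<^esub> r \<odot>\<^bsub>P\<^esub> x"
      then obtain u where "u \<in> U" "y = u \<oplus>\<^bsub>P\<^esub> r \<odot>\<^bsub>P\<^esub> x" by auto
      then have "y = (u \<oplus>\<^bsub>P\<^esub> r \<odot>\<^bsub>P\<^esub> \<zero>\<^bsub>P\<^esub>) \<oplus>\<^bsub>P\<^esub> r \<odot>\<^bsub>P\<^esub> x" using U(1) r by (auto simp: subsetD)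
      then show "\<exists>u\<in>U. \<exists>v\<in>U. y = (u \<oplus>\<^bsub>P\<^esub> r \<odot>\<^bsub>P\<^esub> v) \<oplus>\<^bsub>P\<^esub> r \<odot>\<^bsub>P\<^esub> x" using \<open>u \<in> U\<close> U(2) by (intro bexI)
    next
      assume "\<exists>u\<in>U. \<exists>v\<in>U. y = (u \<oplus>\<^bsub>P\<^esub> r \<odot>\<^bsub>P\<^esub> v) \<oplus>\<^bsub>P\<^esub> r \<odot>\<^bsub>P\<^esub> x"
      then obtain u v where "u \<in> U" "v \<in> U" "y = (u \<oplus>\<^bsub>P\<^esub> r \<odot>\<^bsub>P\<^esub> v) \<oplus>\<^bsub>P\<^esub> r \<odot>\<^bsub>P\<^esub> x" by auto
      then show "\<exists>u\<in>U. y = u \<oplus>\<^bsub>P\<^esub> r \<odot>\<^bsub>P\<^esub> x" using U(3)[of u "r \<odot>\<^bsub>P\<^esub> v"] U(4)[OF r, of v] by (intro bexI[of _ "u \<oplus>\<^bsub>P\<^esub> r \<odot>\<^bsub>P\<^esub> v"]) simp_all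
    qed
    finally show "y \<in> p (r \<odot>\<^bsub>P\<^esub> x) \<longleftrightarrow> y \<in> r \<odot>\<^bsub>?Q\<^esub> p x" unfolding mem by (rule sym)
  qed
  have z: "p \<zero>\<^bsub>P\<^esub> = U" unfolding p_def
    using M.a_coset_add_zero U(1) by auto
  show "left_module R ?Q" "p \<in> module_homs R P ?Q"
    by (rule left_module_image[OF assms(1) surj _ _ sm]; simp add: z add)+
  show "p ` carrier P = carrier ?Q" by (rule surj)
  show "p x = \<zero>\<^bsub>?Q\<^esub> \<longleftrightarrow> x \<in> U" if x: "x \<in> carrier P" for x
  proof
    assume "p x = \<zero>\<^bsub>?Q\<^esub>"
    then have "\<zero>\<^bsub>P\<^esub> \<oplus>\<^bsub>P\<^esub> x \<in> U" using mem[of "\<zero>\<^bsub>P\<^esub> \<oplus>\<^bsub>P\<^esub> x" x] U(2) by auto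
    then show "x \<in> U" using x by simp
  next
    assume "x \<in> U"
    then show "p x = \<zero>\<^bsub>?Q\<^esub>" unfolding p_def using U.a_rcos_const by simp
  qed
qed

lemma iso_quotient_iff:
  assumes "left_module R P" "left_module R N" "Module.submodule U R P"
  shows "module_iso R N (quotient_module P U) \<longleftrightarrow>
    (\<exists>c \<in> module_homs R P N. c ` carrier P = carrier N \<and> (\<forall>x \<in> carrier P. c x = \<zero>\<^bsub>N\<^esub> \<longleftrightarrow> x \<in> U))"
    (is "?l \<longleftrightarrow> ?r")
proof
  let ?p = "\<lambda>x. a_r_coset P U x"
  note q = quotient_projection[OF assms(1,3)]
  assume ?l
  then obtain f where f: "f \<in> module_homs R N (quotient_module P U)"
    "bij_betw f (carrier N) (carrier (quotient_module P U))" by (auto simp: module_iso_def)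
  let ?g = "inv_into (carrier N) f"
  note g = hom_inv_into[OF f(1) assms(2) f(2)]
  have "?g \<circ> ?p \<in> module_homs R P N" by (rule hom_comp[OF q(2) g(1)])
  moreover have "(?g \<circ> ?p) ` carrier P = carrier N"
    using g(2) q(3) unfolding image_comp[symmetric] bij_betw_def by simp
  moreover have "(?g \<circ> ?p) x = \<zero>\<^bsub>N\<^esub> \<longleftrightarrow> x \<in> U" if "x \<in> carrier P" for x
  proof -
    have "(?g \<circ> ?p) x = \<zero>\<^bsub>N\<^esub> \<longleftrightarrow> ?p x = \<zero>\<^bsub>quotient_module P U\<^esub>"
      unfolding comp_def
      by (rule hom_inj_zero_iff[OF g(1) q(1) assms(2) bij_betw_imp_inj_on[OF g(2)] homD(1)[OF q(2) that]])
    then show ?thesis using q(4)[OF that] by (simp only:)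
  qed
  ultimately show ?r by (intro bexI[of _ "?g \<circ> ?p"]) auto
next
  let ?p = "\<lambda>x. a_r_coset P U x"
  note q = quotient_projection[OF assms(1,3)]
  assume ?r
  then obtain c where c: "c \<in> module_homs R P N" "c ` carrier P = carrier N"
    "\<forall>x \<in> carrier P. c x = \<zero>\<^bsub>N\<^esub> \<longleftrightarrow> x \<in> U" by auto
  show ?l
    unfolding module_iso_def
    using iso_of_same_kernel[OF c(1) q(2) assms(1,2) q(1) c(2) q(3)] c(3) q(4) by blast
qed

text \<open>
  Syzygies, cosyzygies and transposes have to have elements of a prescribed type; cokernels are moved
  there along a choice of representatives.
\<close>

lemma module_transport:
  assumes "left_module R M" "inj_on g (carrier M)"
  shows "\<exists>N. carrier N = g ` carrier M \<and> left_module R N \<and> g \<in> module_homs R M N"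
proof -
  interpret left_module R M by fact
  define h where "h = inv_into (carrier M) g"
  have h[simp]: "h (g x) = x" if "x \<in> carrier M" for x using that assms(2) by (simp add: h_def)
  define N where "N = mk_module (g ` carrier M) (g \<zero>\<^bsub>M\<^esub>) (\<lambda>a b. g (h a \<oplus>\<^bsub>M\<^esub> h b)) (\<lambda>r a. g (r \<odot>\<^bsub>M\<^esub> h a))"
  have N: "carrier N = g ` carrier M" "zero N = g \<zero>\<^bsub>M\<^esub>"
    "add N = (\<lambda>a b. g (h a \<oplus>\<^bsub>M\<^esub> h b))" "smult N = (\<lambda>r a. g (r \<odot>\<^bsub>M\<^esub> h a))" by (simp_all add: N_def)
  have "left_module R N" "g \<in> module_homs R M N"
    by (rule left_module_image[OF assms(1), where p = g]; simp add: N)+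
  then show ?thesis using N(1) by blast
qed

lemma module_iso_sym:
  assumes "module_iso R M N" "left_module R M"
  shows "module_iso R N M"
  unfolding module_iso_def using assms(1)[unfolded module_iso_def] hom_inv_into[OF _ assms(2)] by blast

lemma left_module_regular:
  assumes "ring R" shows "left_module R (regular_module R)"
proof -
  interpret R: ring R by fact
  show ?thesis
  proof (rule left_moduleI)
    show "abelian_group (regular_module R)"
    proof (rule abelian_groupI)
      fix x assume "x \<in> carrier (regular_module R)"
      then show "\<exists>y\<in>carrier (regular_module R). y \<oplus>\<^bsub>regular_module R\<^esub> x = \<zero>\<^bsub>regular_module R\<^esub>"
        by (auto intro!: bexI[of _ "\<ominus>\<^bsub>R\<^esub> x"] simp: R.l_neg)
    qed (auto simp: R.a_ac)
  qed (auto simp: R.l_distr R.r_distr R.m_assoc R.ring_axioms)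
qed

lemma left_module_free:
  assumes "ring R" shows "left_module R (free_module R n)"
proof -
  interpret R: ring R by fact
  note [simp] = free_module_simps(1)
  have P: "v \<in> carrier (free_module R n) \<Longrightarrow> i < n \<Longrightarrow> v i \<in> carrier R" for v i by auto
  have ext: "restrict f {..<n} = v" if "v \<in> carrier (free_module R n)" "\<And>i. i < n \<Longrightarrow> f i = v i" for f v
    using that by (auto intro!: extensionalityI[of _ "{..<n}"] simp: PiE_def)
  note fs = free_module_simps(2-4)
  show ?thesis
  proof (rule left_moduleI)
    show "abelian_group (free_module R n)"
    proof (rule abelian_groupI)
      fix x assume x: "x \<in> carrier (free_module R n)"
      have "(\<lambda>i\<in>{..<n}. \<ominus>\<^bsub>R\<^esub> x i) \<in> carrier (free_module R n)"
        using x by auto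
      moreover have "(\<lambda>i\<in>{..<n}. \<ominus>\<^bsub>R\<^esub> x i) \<oplus>\<^bsub>free_module R n\<^esub> x = \<zero>\<^bsub>free_module R n\<^esub>"
        unfolding fs by (intro restrict_ext) (simp add: P[OF x] R.l_neg)
      ultimately show "\<exists>y\<in>carrier (free_module R n). y \<oplus>\<^bsub>free_module R n\<^esub> x = \<zero>\<^bsub>free_module R n\<^esub>" by blast
      show "\<zero>\<^bsub>free_module R n\<^esub> \<oplus>\<^bsub>free_module R n\<^esub> x = x"
        unfolding fs by (intro ext x) (simp add: P[OF x])
    next
      fix x y assume x: "x \<in> carrier (free_module R n)" and y: "y \<in> carrier (free_module R n)"
      show "x \<oplus>\<^bsub>free_module R n\<^esub> y = y \<oplus>\<^bsub>free_module R n\<^esub> x"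
        unfolding fs by (intro restrict_ext) (simp add: P[OF x] P[OF y] R.a_comm)
      fix z assume z: "z \<in> carrier (free_module R n)"
      show "x \<oplus>\<^bsub>free_module R n\<^esub> y \<oplus>\<^bsub>free_module R n\<^esub> z = x \<oplus>\<^bsub>free_module R n\<^esub> (y \<oplus>\<^bsub>free_module R n\<^esub> z)"
        unfolding fs by (intro restrict_ext) (simp add: P[OF x] P[OF y] P[OF z] R.a_assoc)
    qed auto
  next
    fix x assume x: "x \<in> carrier (free_module R n)"
    show "\<one>\<^bsub>R\<^esub> \<odot>\<^bsub>free_module R n\<^esub> x = x"
      unfolding fs by (intro ext x) (simp add: P[OF x])
    fix a b assume "a \<in> carrier R" "b \<in> carrier R"
    then show "(a \<oplus>\<^bsub>R\<^esub> b) \<odot>\<^bsub>free_module R n\<^esub> x = a \<odot>\<^bsub>free_module R n\<^esub> x \<oplus>\<^bsub>free_module R n\<^esub> b \<odot>\<^bsub>free_module R n\<^esub> x"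
      and "(a \<otimes>\<^bsub>R\<^esub> b) \<odot>\<^bsub>free_module R n\<^esub> x = a \<odot>\<^bsub>free_module R n\<^esub> (b \<odot>\<^bsub>free_module R n\<^esub> x)"
      unfolding fs by (intro restrict_ext; simp add: P[OF x] R.l_distr R.m_assoc)+
  next
    fix a x y assume a: "a \<in> carrier R" and x: "x \<in> carrier (free_module R n)"
      and y: "y \<in> carrier (free_module R n)"
    show "a \<odot>\<^bsub>free_module R n\<^esub> (x \<oplus>\<^bsub>free_module R n\<^esub> y) = a \<odot>\<^bsub>free_module R n\<^esub> x \<oplus>\<^bsub>free_module R n\<^esub> a \<odot>\<^bsub>free_module R n\<^esub> y"
      unfolding fs by (intro restrict_ext) (simp add: P[OF x] P[OF y] a R.r_distr)
  qed (auto simp: R.ring_axioms)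
qed

lemma ring_opposite:
  assumes "ring R" shows "ring (opposite R)"
proof -
  interpret R: ring R by fact
  show ?thesis
  proof (rule ringI)
    show "abelian_group (opposite R)"
    proof (rule abelian_groupI)
      fix x assume "x \<in> carrier (opposite R)"
      then show "\<exists>y\<in>carrier (opposite R). y \<oplus>\<^bsub>opposite R\<^esub> x = \<zero>\<^bsub>opposite R\<^esub>"
        by (auto intro!: bexI[of _ "\<ominus>\<^bsub>R\<^esub> x"] simp: R.l_neg)
    qed (auto simp: R.a_ac)
    show "Group.monoid (opposite R)" by (rule monoidI) (auto simp: R.m_assoc)
  qed (auto simp: R.l_distr R.r_distr)
qed

lemma left_module_dual:
  assumes "left_module R M" shows "left_module (opposite R) (dual R M)"
proof -
  interpret left_module R M by fact
  have H: "f \<in> carrier (dual R M) \<Longrightarrow> x \<in> carrier M \<Longrightarrow> f x \<in> carrier R" for f x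
    using homD(1)[OF HomD(1), of f R M "regular_module R" x] by simp
  have Ha: "f \<in> carrier (dual R M) \<Longrightarrow> x \<in> carrier M \<Longrightarrow> y \<in> carrier M \<Longrightarrow> f (x \<oplus>\<^bsub>M\<^esub> y) = f x \<oplus>\<^bsub>R\<^esub> f y" for f x y
    using homD(2)[OF HomD(1), of f R M "regular_module R" x y] by simp
  have Hs: "f \<in> carrier (dual R M) \<Longrightarrow> x \<in> carrier M \<Longrightarrow> r \<in> carrier R \<Longrightarrow> f (r \<odot>\<^bsub>M\<^esub> x) = r \<otimes>\<^bsub>R\<^esub> f x" for f x r
    using homD(3)[OF HomD(1), of f R M "regular_module R" r x] by simp
  have mem: "restrict f (carrier M) \<in> carrier (dual R M)"
    if "\<And>x. x \<in> carrier M \<Longrightarrow> f x \<in> carrier R"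
      "\<And>x y. x \<in> carrier M \<Longrightarrow> y \<in> carrier M \<Longrightarrow> f (x \<oplus>\<^bsub>M\<^esub> y) = f x \<oplus>\<^bsub>R\<^esub> f y"
      "\<And>x r. x \<in> carrier M \<Longrightarrow> r \<in> carrier R \<Longrightarrow> f (r \<odot>\<^bsub>M\<^esub> x) = r \<otimes>\<^bsub>R\<^esub> f x" for f
  proof -
    have "f \<in> module_homs R M (regular_module R)" using that by (intro homI) simp_all
    from hom_restrict[OF this assms] show ?thesis by simp
  qed
  have ext: "restrict f (carrier M) = g" if "g \<in> carrier (dual R M)"
    "\<And>x. x \<in> carrier M \<Longrightarrow> f x = g x" for f g
    using that by (auto simp: Hom_def intro!: extensionalityI[of _ "carrier M"])
  note ds = dual_simps(2-4)
  show ?thesis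
  proof (rule left_moduleI)
    show "abelian_group (dual R M)"
    proof (rule abelian_groupI)
      fix f assume f: "f \<in> carrier (dual R M)"
      have "(\<lambda>x\<in>carrier M. \<ominus>\<^bsub>R\<^esub> f x) \<in> carrier (dual R M)"
        by (rule mem) (simp_all add: H[OF f] Ha[OF f] Hs[OF f] R.minus_add R.r_minus)
      moreover have "(\<lambda>x\<in>carrier M. \<ominus>\<^bsub>R\<^esub> f x) \<oplus>\<^bsub>dual R M\<^esub> f = \<zero>\<^bsub>dual R M\<^esub>"
        unfolding ds by (intro restrict_ext) (simp add: H[OF f] R.l_neg)
      ultimately show "\<exists>y\<in>carrier (dual R M). y \<oplus>\<^bsub>dual R M\<^esub> f = \<zero>\<^bsub>dual R M\<^esub>" by blast
      show "\<zero>\<^bsub>dual R M\<^esub> \<oplus>\<^bsub>dual R M\<^esub> f = f"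
        unfolding ds by (intro ext f) (simp add: H[OF f])
    next
      fix f g assume f: "f \<in> carrier (dual R M)" and g: "g \<in> carrier (dual R M)"
      note fg = H[OF f] H[OF g] Ha[OF f] Ha[OF g] Hs[OF f] Hs[OF g]
      show "f \<oplus>\<^bsub>dual R M\<^esub> g \<in> carrier (dual R M)"
        unfolding ds by (rule mem) (simp_all add: fg R.a_ac R.r_distr)
      show "f \<oplus>\<^bsub>dual R M\<^esub> g = g \<oplus>\<^bsub>dual R M\<^esub> f"
        unfolding ds by (intro restrict_ext) (simp add: fg R.a_comm)
      fix h assume h: "h \<in> carrier (dual R M)"
      show "f \<oplus>\<^bsub>dual R M\<^esub> g \<oplus>\<^bsub>dual R M\<^esub> h = f \<oplus>\<^bsub>dual R M\<^esub> (g \<oplus>\<^bsub>dual R M\<^esub> h)"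
        unfolding ds by (intro restrict_ext) (simp add: fg H[OF h] R.a_assoc)
    next
      show "\<zero>\<^bsub>dual R M\<^esub> \<in> carrier (dual R M)" unfolding ds by (rule mem) simp_all
    qed
  next
    fix r f assume r: "r \<in> carrier (opposite R)" and f: "f \<in> carrier (dual R M)"
    note fs = H[OF f] Ha[OF f] Hs[OF f]
    show "r \<odot>\<^bsub>dual R M\<^esub> f \<in> carrier (dual R M)"
      unfolding ds using r by (intro mem) (simp_all add: fs R.l_distr R.m_assoc)
    fix s assume s: "s \<in> carrier (opposite R)"
    show "(r \<oplus>\<^bsub>opposite R\<^esub> s) \<odot>\<^bsub>dual R M\<^esub> f = r \<odot>\<^bsub>dual R M\<^esub> f \<oplus>\<^bsub>dual R M\<^esub> s \<odot>\<^bsub>dual R M\<^esub> f"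
      and "(r \<otimes>\<^bsub>opposite R\<^esub> s) \<odot>\<^bsub>dual R M\<^esub> f = r \<odot>\<^bsub>dual R M\<^esub> (s \<odot>\<^bsub>dual R M\<^esub> f)"
      unfolding ds using r s by (intro restrict_ext; simp add: fs R.r_distr R.m_assoc)+
    fix g assume g: "g \<in> carrier (dual R M)"
    show "r \<odot>\<^bsub>dual R M\<^esub> (f \<oplus>\<^bsub>dual R M\<^esub> g) = r \<odot>\<^bsub>dual R M\<^esub> f \<oplus>\<^bsub>dual R M\<^esub> r \<odot>\<^bsub>dual R M\<^esub> g"
      unfolding ds using r by (intro restrict_ext) (simp add: fs H[OF g] R.l_distr)
  next
    fix f assume f: "f \<in> carrier (dual R M)"
    show "\<one>\<^bsub>opposite R\<^esub> \<odot>\<^bsub>dual R M\<^esub> f = f"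
      unfolding ds by (intro ext f) (simp add: H[OF f])
  qed (simp add: ring_opposite ring_axioms')
qed

section \<open>Free and projective modules\<close>

definition unit_fam :: "'r ring \<Rightarrow> nat \<Rightarrow> nat \<Rightarrow> nat \<Rightarrow> 'r" where
  "unit_fam R n i = (\<lambda>j\<in>{..<n}. if j = i then \<one>\<^bsub>R\<^esub> else \<zero>\<^bsub>R\<^esub>)"

definition lin_comb :: "('r, 'm) module \<Rightarrow> nat \<Rightarrow> (nat \<Rightarrow> 'm) \<Rightarrow> (nat \<Rightarrow> 'r) \<Rightarrow> 'm" where
  "lin_comb M n x v = finsum M (\<lambda>i. v i \<odot>\<^bsub>M\<^esub> x i) {..<n}"

lemma unit_fam_closed: "ring R \<Longrightarrow> unit_fam R n i \<in> carrier (free_module R n)"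
  by (auto simp: unit_fam_def ring.ring_simprules free_module_simps(1))

lemma free_mem: "v \<in> carrier (free_module R n) \<Longrightarrow> i < n \<Longrightarrow> v i \<in> carrier R"
  by (auto simp: free_module_simps(1))

lemma free_eqI:
  assumes "v \<in> carrier (free_module R n)" "w \<in> carrier (free_module R n)" "\<And>i. i < n \<Longrightarrow> v i = w i"
  shows "v = w"
  using assms by (auto intro!: extensionalityI[of _ "{..<n}"] simp: PiE_def free_module_simps(1))

lemma free_coord_hom: "i < n \<Longrightarrow> (\<lambda>v. v i) \<in> module_homs R (free_module R n) (regular_module R)"
  by (intro homI) (auto simp: free_module_simps(1))

lemma hom_finsum:
  assumes "f \<in> module_homs R A B" "left_module R A" "left_module R B" "\<And>i. i < n \<Longrightarrow> g i \<in> carrier A"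
  shows "f (finsum A g {..<n::nat}) = finsum B (\<lambda>i. f (g i)) {..<n}"
  using assms(4)
proof (induction n)
  case 0
  interpret A: left_module R A by fact
  interpret B: left_module R B by fact
  show ?case using hom_zero[OF assms(1-3)] by simp
next
  case (Suc n)
  interpret A: left_module R A by fact
  interpret B: left_module R B by fact
  note f = homD[OF assms(1)]
  have g: "g i \<in> carrier A" if "i \<le> n" for i using Suc.prems that by simp
  have "finsum A g {..<Suc n} = g n \<oplus>\<^bsub>A\<^esub> finsum A g {..<n}"
    using g unfolding lessThan_Suc by (subst A.M.finsum_insert) (auto simp: Pi_def)
  moreover have "finsum B (\<lambda>i. f (g i)) {..<Suc n} = f (g n) \<oplus>\<^bsub>B\<^esub> finsum B (\<lambda>i. f (g i)) {..<n}"
    using g f(1) unfolding lessThan_Suc by (subst B.M.finsum_insert) (auto simp: Pi_def)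
  moreover have "finsum A g {..<n} \<in> carrier A" using g by (intro A.M.finsum_closed) auto
  ultimately show ?case using Suc.IH g f(2) by simp
qed

lemma (in left_module) smult_finsum:
  assumes "\<And>i. i < n \<Longrightarrow> x i \<in> carrier M" "r \<in> carrier R"
  shows "r \<odot>\<^bsub>M\<^esub> finsum M x {..<n::nat} = finsum M (\<lambda>i. r \<odot>\<^bsub>M\<^esub> x i) {..<n}"
  using assms(1)
proof (induction n)
  case (Suc n)
  have x: "x i \<in> carrier M" if "i \<le> n" for i using Suc.prems that by simp
  have "finsum M x {..<Suc n} = x n \<oplus>\<^bsub>M\<^esub> finsum M x {..<n}"
    using x unfolding lessThan_Suc by (subst M.finsum_insert) (auto simp: Pi_def)
  moreover have "finsum M (\<lambda>i. r \<odot>\<^bsub>M\<^esub> x i) {..<Suc n} = r \<odot>\<^bsub>M\<^esub> x n \<oplus>\<^bsub>M\<^esub> finsum M (\<lambda>i. r \<odot>\<^bsub>M\<^esub> x i) {..<n}"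
    using x assms(2) unfolding lessThan_Suc by (subst M.finsum_insert) (auto simp: Pi_def smult_closed)
  moreover have "finsum M x {..<n} \<in> carrier M" using x by (intro M.finsum_closed) auto
  ultimately show ?case using Suc.IH x assms(2) smult_r_distr by simp
qed (use assms(2) in simp)

lemma lin_comb_closed:
  assumes "left_module R M" "\<And>i. i < n \<Longrightarrow> x i \<in> carrier M" "v \<in> carrier (free_module R n)"
  shows "lin_comb M n x v \<in> carrier M"
proof -
  interpret left_module R M by fact
  show ?thesis
    unfolding lin_comb_def using assms(2) free_mem[OF assms(3)]
    by (intro M.finsum_closed) (auto simp: smult_closed)
qed

lemma lin_comb_hom:
  assumes M: "left_module R M" and x: "\<And>i. i < n \<Longrightarrow> x i \<in> carrier M"
  shows "lin_comb M n x \<in> module_homs R (free_module R n) M"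
proof (rule homI)
  interpret left_module R M by fact
  fix v w assume v: "v \<in> carrier (free_module R n)" and w: "w \<in> carrier (free_module R n)"
  have "finsum M (\<lambda>i. (v \<oplus>\<^bsub>free_module R n\<^esub> w) i \<odot>\<^bsub>M\<^esub> x i) {..<n} =
    finsum M (\<lambda>i. v i \<odot>\<^bsub>M\<^esub> x i \<oplus>\<^bsub>M\<^esub> w i \<odot>\<^bsub>M\<^esub> x i) {..<n}"
    using x free_mem[OF v] free_mem[OF w]
    by (intro M.finsum_cong') (auto simp: smult_closed smult_l_distr)
  also have "\<dots> = finsum M (\<lambda>i. v i \<odot>\<^bsub>M\<^esub> x i) {..<n} \<oplus>\<^bsub>M\<^esub> finsum M (\<lambda>i. w i \<odot>\<^bsub>M\<^esub> x i) {..<n}"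
    using x free_mem[OF v] free_mem[OF w]
    by (intro M.finsum_addf) (auto simp: smult_closed)
  finally show "lin_comb M n x (v \<oplus>\<^bsub>free_module R n\<^esub> w) = lin_comb M n x v \<oplus>\<^bsub>M\<^esub> lin_comb M n x w"
    by (simp add: lin_comb_def)
next
  interpret left_module R M by fact
  fix r v assume r: "r \<in> carrier R" and v: "v \<in> carrier (free_module R n)"
  have "finsum M (\<lambda>i. (r \<odot>\<^bsub>free_module R n\<^esub> v) i \<odot>\<^bsub>M\<^esub> x i) {..<n} =
    finsum M (\<lambda>i. r \<odot>\<^bsub>M\<^esub> (v i \<odot>\<^bsub>M\<^esub> x i)) {..<n}"
    using x r free_mem[OF v]
    by (intro M.finsum_cong') (auto simp: smult_closed smult_assoc)
  also have "\<dots> = r \<odot>\<^bsub>M\<^esub> finsum M (\<lambda>i. v i \<odot>\<^bsub>M\<^esub> x i) {..<n}"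
    using x r free_mem[OF v] by (intro smult_finsum[symmetric]) (auto simp: smult_closed)
  finally show "lin_comb M n x (r \<odot>\<^bsub>free_module R n\<^esub> v) = r \<odot>\<^bsub>M\<^esub> lin_comb M n x v"
    by (simp add: lin_comb_def)
qed (rule lin_comb_closed[OF M x])

lemma lin_comb_unit:
  assumes M: "left_module R M" and x: "\<And>i. i < n \<Longrightarrow> x i \<in> carrier M" and i: "i < n"
  shows "lin_comb M n x (unit_fam R n i) = x i"
proof -
  interpret left_module R M by fact
  have "lin_comb M n x (unit_fam R n i) = finsum M (\<lambda>j. if i = j then x j else \<zero>\<^bsub>M\<^esub>) {..<n}"
    unfolding lin_comb_def using x by (intro M.finsum_cong') (auto simp: unit_fam_def smult_one)
  also have "\<dots> = x i" using x i by (intro M.finsum_singleton) auto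
  finally show ?thesis .
qed

lemma lin_comb_cong:
  assumes "left_module R M" "\<And>i. i < n \<Longrightarrow> x i \<in> carrier M" "\<And>i. i < n \<Longrightarrow> x i = y i" "v \<in> carrier (free_module R n)"
  shows "lin_comb M n x v = lin_comb M n y v"
proof -
  interpret left_module R M by fact
  show ?thesis
    unfolding lin_comb_def using assms(2,3) free_mem[OF assms(4)]
    by (intro M.finsum_cong') (auto simp: smult_closed)
qed

lemma free_expansion:
  assumes "ring R" "v \<in> carrier (free_module R n)"
  shows "lin_comb (free_module R n) n (unit_fam R n) v = v"
proof -
  interpret R: ring R by fact
  interpret F: left_module R "free_module R n" by (rule left_module_free[OF assms(1)])
  interpret L: left_module R "regular_module R" by (rule left_module_regular[OF assms(1)])
  note u = unit_fam_closed[OF assms(1), of n]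
  show ?thesis
  proof (rule free_eqI)
    show "lin_comb (free_module R n) n (unit_fam R n) v \<in> carrier (free_module R n)"
      by (rule lin_comb_closed[OF F.left_module_axioms u assms(2)])
    fix i assume i: "i < n"
    let ?g = "\<lambda>j. v j \<odot>\<^bsub>free_module R n\<^esub> unit_fam R n j"
    have "lin_comb (free_module R n) n (unit_fam R n) v i = finsum (regular_module R) (\<lambda>j. ?g j i) {..<n}"
      unfolding lin_comb_def
      using hom_finsum[OF free_coord_hom[OF i] F.left_module_axioms L.left_module_axioms, of n ?g]
        F.smult_closed[OF free_mem[OF assms(2)] u] by simp
    also have "\<dots> = finsum (regular_module R) (\<lambda>j. if i = j then v j else \<zero>\<^bsub>regular_module R\<^esub>) {..<n}"
      using i free_mem[OF assms(2)] by (intro L.M.finsum_cong') (auto simp: unit_fam_def)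
    also have "\<dots> = v i" using i free_mem[OF assms(2)] by (intro L.M.finsum_singleton) auto
    finally show "lin_comb (free_module R n) n (unit_fam R n) v i = v i" .
  qed (rule assms(2))
qed

lemma free_1_eq:
  assumes "ring R" "v \<in> carrier (free_module R 1)"
  shows "v = v 0 \<odot>\<^bsub>free_module R 1\<^esub> unit_fam R 1 0"
proof -
  interpret R: ring R by fact
  show ?thesis
    using assms(2) free_mem[OF assms(2), of 0]
    by (intro free_eqI[OF assms(2)]) (auto simp: unit_fam_def free_module_simps(1))
qed

lemma hom_lin_comb:
  assumes "f \<in> module_homs R A B" "left_module R A" "left_module R B" "\<And>i. i < n \<Longrightarrow> x i \<in> carrier A"
    "v \<in> carrier (free_module R n)"
  shows "f (lin_comb A n x v) = lin_comb B n (\<lambda>i. f (x i)) v"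
proof -
  interpret A: left_module R A by fact
  interpret B: left_module R B by fact
  have "f (lin_comb A n x v) = finsum B (\<lambda>i. f (v i \<odot>\<^bsub>A\<^esub> x i)) {..<n}"
    unfolding lin_comb_def using assms(4) free_mem[OF assms(5)]
    by (intro hom_finsum[OF assms(1-3)]) (simp add: A.smult_closed)
  also have "\<dots> = lin_comb B n (\<lambda>i. f (x i)) v"
    unfolding lin_comb_def using homD[OF assms(1)] assms(4) free_mem[OF assms(5)]
    by (intro B.M.finsum_cong') (auto simp: B.smult_closed)
  finally show ?thesis .
qed

lemma hom_free_eq:
  assumes "f \<in> module_homs R (free_module R n) B" "left_module R B" "v \<in> carrier (free_module R n)"
  shows "f v = lin_comb B n (\<lambda>i. f (unit_fam R n i)) v"
proof -
  interpret B: left_module R B by fact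
  have "f v = f (lin_comb (free_module R n) n (unit_fam R n) v)"
    by (rule arg_cong[OF free_expansion[OF B.ring_axioms' assms(3)], symmetric])
  also have "\<dots> = lin_comb B n (\<lambda>i. f (unit_fam R n i)) v"
    by (rule hom_lin_comb[OF assms(1) left_module_free[OF B.ring_axioms'] assms(2)
      unit_fam_closed[OF B.ring_axioms'] assms(3)])
  finally show ?thesis .
qed

lemma hom_id: "left_module R M \<Longrightarrow> (\<lambda>x. x) \<in> module_homs R M M"
  by (intro homI) auto

lemma projective_free:
  assumes "ring R" shows "projective R (free_module R n)"
  unfolding projective_def
  by (intro conjI exI[of _ n] bexI[of _ "\<lambda>x. x"] ballI refl left_module_free[OF assms]
      hom_id[OF left_module_free[OF assms]])

lemma projective_left_module: "projective R P \<Longrightarrow> left_module R P"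
  by (simp add: projective_def)

text \<open>
  Lifting is done on the images of the unit vectors of a free module of which the given
  projective module is a retract.
\<close>

lemma projective_lift:
  assumes P: "projective R P" and A: "left_module R A" and B: "left_module R B"
    and g: "g \<in> module_homs R A B" "g ` carrier A = carrier B" and f: "f \<in> module_homs R P B"
  shows "\<exists>h \<in> module_homs R P A. \<forall>x \<in> carrier P. g (h x) = f x"
proof -
  interpret A: left_module R A by fact
  obtain n i p where i: "i \<in> module_homs R P (free_module R n)"
    and p: "p \<in> module_homs R (free_module R n) P" and pi: "\<And>x. x \<in> carrier P \<Longrightarrow> p (i x) = x"
    using P by (auto simp: projective_def)
  let ?F = "free_module R n" and ?u = "unit_fam R n"
  have u: "?u j \<in> carrier ?F" for j by (rule unit_fam_closed[OF A.ring_axioms'])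
  have fp: "f \<circ> p \<in> module_homs R ?F B" by (rule hom_comp[OF p f])
  define a where "a j = inv_into (carrier A) g (f (p (?u j)))" for j
  have im: "f (p (?u j)) \<in> g ` carrier A" for j
    using homD(1)[OF fp u, of j] unfolding g(2) comp_def .
  have a: "a j \<in> carrier A" "g (a j) = f (p (?u j))" for j
    unfolding a_def by (rule inv_into_into[OF im], rule f_inv_into_f[OF im])
  let ?h = "lin_comb A n a"
  have h: "?h \<in> module_homs R ?F A" by (rule lin_comb_hom[OF A a(1)])
  have "g (?h v) = f (p v)" if v: "v \<in> carrier ?F" for v
  proof -
    have "g (?h v) = lin_comb B n (\<lambda>j. f (p (?u j))) v"
      using hom_lin_comb[OF g(1) A B, of n a v] a v by simp
    also have "\<dots> = (f \<circ> p) v" using hom_free_eq[OF fp B v] by simp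
    finally show ?thesis by simp
  qed
  then show ?thesis
    using hom_comp[OF i h] homD(1)[OF i] pi by (intro bexI[of _ "?h \<circ> i"]) auto
qed

section \<open>Projective resolutions and Ext\<close>

definition fin_gen :: "'r ring \<Rightarrow> ('r, 'm) module \<Rightarrow> bool" where
  "fin_gen R M \<longleftrightarrow> (\<exists>n. \<exists>f \<in> module_homs R (free_module R n) M.
     f ` carrier (free_module R n) = carrier M)"

definition noetherian :: "'r ring \<Rightarrow> bool" where
  "noetherian R \<longleftrightarrow> (\<forall>n U. Module.submodule U R (free_module R n) \<longrightarrow>
     fin_gen R ((free_module R n)\<lparr>carrier := U\<rparr>))"

lemma fin_gen_surj:
  assumes "fin_gen R M" "g \<in> module_homs R M N" "g ` carrier M = carrier N"
  shows "fin_gen R N"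
proof -
  obtain n f where f: "f \<in> module_homs R (free_module R n) M"
    "f ` carrier (free_module R n) = carrier M"
    using assms(1) by (auto simp: fin_gen_def)
  then have "(g \<circ> f) ` carrier (free_module R n) = carrier N"
    using assms(3) by (simp only: image_comp[symmetric])
  then show ?thesis using hom_comp[OF f(1) assms(2)] unfolding fin_gen_def by blast
qed

lemma fin_gen_embedded:
  assumes "noetherian R" "left_module R K" "j \<in> module_homs R K (free_module R n)" "inj_on j (carrier K)"
  shows "fin_gen R K"
proof -
  interpret K: left_module R K by fact
  let ?U = "j ` carrier K"
  have F: "left_module R (free_module R n)" by (rule left_module_free[OF K.ring_axioms'])
  have sub: "Module.submodule ?U R (free_module R n)"
    by (rule submodule_image[OF assms(3) assms(2) F submodule_carrier[OF assms(2)]])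
  then have fg: "fin_gen R ((free_module R n)\<lparr>carrier := ?U\<rparr>)"
    using assms(1) by (simp add: noetherian_def)
  have "j \<in> module_homs R K ((free_module R n)\<lparr>carrier := ?U\<rparr>)"
    by (rule hom_codomain_restrict[OF assms(3)]) simp
  moreover have "bij_betw j (carrier K) (carrier ((free_module R n)\<lparr>carrier := ?U\<rparr>))"
    using assms(4) by (simp add: bij_betw_def)
  ultimately show ?thesis
    using fin_gen_surj[OF fg] hom_inv_into[OF _ assms(2)] by (metis bij_betw_def)
qed

text \<open>
  Each kernel is a submodule of a finitely generated free module, hence again the image of one. The
  recursion runs over the pairs of a rank and a submodule, choosing generators at every step.
\<close>

lemma resolution_exists:
  fixes R :: "'r ring" and M :: "('r, 'm) module"
  assumes R: "ring R" "noetherian R" and M: "left_module R M" "fin_gen R M"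
  shows "\<exists>(P :: nat \<Rightarrow> 'r fgmodule) d \<epsilon>. projective_resolution R M P d \<epsilon>"
proof -
  obtain m \<epsilon> where e: "\<epsilon> \<in> module_homs R (free_module R m) M"
    "\<epsilon> ` carrier (free_module R m) = carrier M"
    using M(2) by (auto simp: fin_gen_def)
  let ?F = "free_module R"
  note F = left_module_free[OF R(1)]
  define good where "good n U s \<longleftrightarrow> snd s \<in> module_homs R (?F (fst s)) (?F n) \<and>
      snd s ` carrier (?F (fst s)) = U" for n U and s :: "nat \<times> ((nat \<Rightarrow> 'r) \<Rightarrow> nat \<Rightarrow> 'r)"
  have ex: "\<exists>s. good n U s" if sub: "Module.submodule U R (?F n)" for n U
  proof -
    obtain k f where "f \<in> module_homs R (?F k) ((?F n)\<lparr>carrier := U\<rparr>)" "f ` carrier (?F k) = U"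
      using R(2)[unfolded noetherian_def, rule_format, OF sub] unfolding fin_gen_def by auto
    then have "good n U (k, f)"
      using hom_codomain_extend[OF _ submoduleD(1)[OF sub]] by (simp add: good_def)
    then show ?thesis ..
  qed
  define next_step where "next_step n U = (SOME s. good n U s)" for n U
  have nxt: "good n U (next_step n U)" if "Module.submodule U R (?F n)" for n U
    unfolding next_step_def by (rule someI_ex[OF ex[OF that]])
  define st where "st = rec_nat (m, a_kernel (?F m) M \<epsilon>)
    (\<lambda>_ s. let t = next_step (fst s) (snd s) in (fst t, a_kernel (?F (fst t)) (?F (fst s)) (snd t)))"
  define d where "d i = snd (next_step (fst (st i)) (snd (st i)))" for i
  have st0: "st 0 = (m, a_kernel (?F m) M \<epsilon>)" by (simp add: st_def)
  have fstS: "fst (st (Suc i)) = fst (next_step (fst (st i)) (snd (st i)))" for i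
    by (simp add: st_def Let_def)
  have sndS: "snd (st (Suc i)) = a_kernel (?F (fst (st (Suc i)))) (?F (fst (st i))) (d i)" for i
    by (simp add: st_def d_def Let_def)
  have sub: "Module.submodule (snd (st i)) R (?F (fst (st i)))" for i
  proof (induction i)
    case 0
    show ?case using submodule_kernel[OF e(1) F M(1)] by (simp add: st0)
  next
    case (Suc i)
    then have "good (fst (st i)) (snd (st i)) (next_step (fst (st i)) (snd (st i)))" by (rule nxt)
    then have "d i \<in> module_homs R (?F (fst (st (Suc i)))) (?F (fst (st i)))"
      by (simp add: good_def d_def fstS)
    then show ?case unfolding sndS by (rule submodule_kernel[OF _ F F])
  qed
  have d: "d i \<in> module_homs R (?F (fst (st (Suc i)))) (?F (fst (st i)))"
    "d i ` carrier (?F (fst (st (Suc i)))) = snd (st i)" for i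
    using nxt[OF sub, of i] by (simp_all add: good_def d_def fstS)
  have "projective_resolution R M (\<lambda>i. ?F (fst (st i))) d \<epsilon>"
    unfolding projective_resolution_def
  proof (intro conjI allI)
    fix i
    show "projective R (?F (fst (st i)))" by (rule projective_free[OF R(1)])
    show "d i \<in> module_homs R (?F (fst (st (Suc i)))) (?F (fst (st i)))" by (rule d)
    show "d (Suc i) ` carrier (?F (fst (st (Suc (Suc i))))) =
      a_kernel (?F (fst (st (Suc i)))) (?F (fst (st i))) (d i)"
      unfolding d(2) by (rule sndS)
  qed (use e st0 d(2)[of 0] in simp_all)
  then show ?thesis by blast
qed

lemma projective_resolutionD:
  assumes "projective_resolution R M P d \<epsilon>"
  shows "\<And>i. projective R (P i)" "\<And>i. left_module R (P i)"
    "\<epsilon> \<in> module_homs R (P 0) M" "\<epsilon> ` carrier (P 0) = carrier M"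
    "\<And>i. d i \<in> module_homs R (P (Suc i)) (P i)"
    "d 0 ` carrier (P (Suc 0)) = a_kernel (P 0) M \<epsilon>"
    "\<And>i. d (Suc i) ` carrier (P (Suc (Suc i))) = a_kernel (P (Suc i)) (P i) (d i)"
  using assms by (auto simp: projective_resolution_def projective_def)

lemma Ext_vanishes_iso:
  assumes "module_iso R K M" "left_module R K" "left_module R M" "Ext_vanishes R i M N"
  shows "Ext_vanishes R i K N"
  unfolding Ext_vanishes_def
proof (intro allI impI)
  fix P :: "nat \<Rightarrow> 'a fgmodule" and d \<epsilon>
  assume res: "projective_resolution R K P d \<epsilon>"
  note r = projective_resolutionD[OF res]
  obtain f where f: "f \<in> module_homs R K M" "bij_betw f (carrier K) (carrier M)"
    using assms(1) by (auto simp: module_iso_def)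
  have "f (\<epsilon> x) = \<zero>\<^bsub>M\<^esub> \<longleftrightarrow> \<epsilon> x = \<zero>\<^bsub>K\<^esub>" if "x \<in> carrier (P 0)" for x
    by (rule hom_inj_zero_iff[OF f(1) assms(2,3) bij_betw_imp_inj_on[OF f(2)] homD(1)[OF r(3) that]])
  then have ker: "a_kernel (P 0) M (f \<circ> \<epsilon>) = a_kernel (P 0) K \<epsilon>" unfolding a_kernel_def' comp_def by blast
  have "(f \<circ> \<epsilon>) ` carrier (P 0) = carrier M"
    using r(4) f(2) by (simp only: image_comp[symmetric] bij_betw_def)
  then have "projective_resolution R M P d (f \<circ> \<epsilon>)"
    unfolding projective_resolution_def using r ker hom_comp[OF r(3) f(1)] by simp
  then show "cocycles R P d N i = coboundaries R P d N i"
    using assms(4) unfolding Ext_vanishes_def by blast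
qed

text \<open>
  The sequence \<open>0 \<rightarrow> K \<rightarrow> Q \<rightarrow> M \<rightarrow> 0\<close>. In its uses \<open>Q\<close> is projective, so that a resolution of \<open>K\<close>,
  continued by \<open>Q\<close>, is a resolution of \<open>M\<close>; all statements on \<open>Ext\<close> are obtained from such resolutions.
\<close>

definition short_exact ::
  "'r ring \<Rightarrow> ('r, 'k) module \<Rightarrow> ('k \<Rightarrow> 'q) \<Rightarrow> ('r, 'q) module \<Rightarrow> ('q \<Rightarrow> 'm) \<Rightarrow> ('r, 'm) module \<Rightarrow> bool" where
  "short_exact R K j Q \<pi> M \<longleftrightarrow> left_module R K \<and> left_module R Q \<and> left_module R M \<and>
     j \<in> module_homs R K Q \<and> inj_on j (carrier K) \<and>
     \<pi> \<in> module_homs R Q M \<and> \<pi> ` carrier Q = carrier M \<and> j ` carrier K = a_kernel Q M \<pi>"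

lemma short_exact_kernel:
  assumes "left_module R Q" "left_module R M" "\<pi> \<in> module_homs R Q M" "\<pi> ` carrier Q = carrier M"
  shows "short_exact R (Q\<lparr>carrier := a_kernel Q M \<pi>\<rparr>) (\<lambda>x. x) Q \<pi> M"
proof -
  note sub = submodule_kernel[OF assms(3,1,2)]
  note K = left_module_submodule[OF assms(1) sub]
  show ?thesis
    unfolding short_exact_def
    using K assms hom_codomain_extend[OF hom_id[OF K] submoduleD(1)[OF sub]] by (auto simp: a_kernel_def')
qed

lemma splice_resolution:
  assumes se: "short_exact R K j Q \<pi> M" and Q: "projective R Q"
    and res: "projective_resolution R K P d \<epsilon>"
  shows "projective_resolution R M (case_nat Q P) (case_nat (j \<circ> \<epsilon>) d) \<pi>"
proof -
  note r = projective_resolutionD[OF res]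
  have K: "left_module R K" and QL: "left_module R Q" and j: "j \<in> module_homs R K Q" "inj_on j (carrier K)"
    and im: "j ` carrier K = a_kernel Q M \<pi>"
    using se by (auto simp: short_exact_def)
  interpret K: left_module R K by fact
  have "j (\<epsilon> x) = \<zero>\<^bsub>Q\<^esub> \<longleftrightarrow> \<epsilon> x = \<zero>\<^bsub>K\<^esub>" if "x \<in> carrier (P 0)" for x
    by (rule hom_inj_zero_iff[OF j(1) K QL j(2) homD(1)[OF r(3) that]])
  then have ker: "a_kernel (P 0) Q (j \<circ> \<epsilon>) = a_kernel (P 0) K \<epsilon>" unfolding a_kernel_def' comp_def by blast
  have im': "(j \<circ> \<epsilon>) ` carrier (P 0) = a_kernel Q M \<pi>"
    using r(4) im by (simp only: image_comp[symmetric])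
  show ?thesis
    unfolding projective_resolution_def
  proof (intro conjI allI)
    fix i
    show "projective R (case_nat Q P i)" using Q r(1) by (cases i) simp_all
    show "case_nat (j \<circ> \<epsilon>) d i \<in> module_homs R (case_nat Q P (Suc i)) (case_nat Q P i)"
      using hom_comp[OF r(3) j(1)] r(5) by (cases i) simp_all
    show "case_nat (j \<circ> \<epsilon>) d (Suc i) ` carrier (case_nat Q P (Suc (Suc i))) =
      a_kernel (case_nat Q P (Suc i)) (case_nat Q P i) (case_nat (j \<circ> \<epsilon>) d i)"
      using ker r(6,7) by (cases i) simp_all
  qed (use se im' in \<open>simp_all add: short_exact_def\<close>)
qed

lemma Ext_shift:
  fixes R :: "'r ring" and Q :: "'r fgmodule"
  assumes se: "short_exact R K j Q \<pi> M" and Q: "projective R Q"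
    and ext: "Ext_vanishes R (Suc (Suc i)) M N"
  shows "Ext_vanishes R (Suc i) K N"
  unfolding Ext_vanishes_def
proof (intro allI impI)
  fix P :: "nat \<Rightarrow> 'r fgmodule" and d \<epsilon>
  assume "projective_resolution R K P d \<epsilon>"
  from splice_resolution[OF se Q this]
  have "cocycles R (case_nat Q P) (case_nat (j \<circ> \<epsilon>) d) N (Suc (Suc i)) =
    coboundaries R (case_nat Q P) (case_nat (j \<circ> \<epsilon>) d) N (Suc (Suc i))"
    using ext unfolding Ext_vanishes_def by blast
  then show "cocycles R P d N (Suc i) = coboundaries R P d N (Suc i)"
    by (simp add: cocycles_def)
qed

lemma semi_Gorenstein_projective_kernel:
  fixes R :: "'r ring" and Q :: "'r fgmodule"
  assumes "short_exact R K j Q \<pi> M" "projective R Q" "semi_Gorenstein_projective R M"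
  shows "semi_Gorenstein_projective R K"
  unfolding semi_Gorenstein_projective_def
proof (intro allI impI)
  fix i :: nat assume "1 \<le> i"
  then obtain i' where i: "i = Suc i'" by (cases i) auto
  show "Ext_vanishes R i K (regular_module R)"
    unfolding i using assms(3) by (intro Ext_shift[OF assms(1,2)]) (simp add: semi_Gorenstein_projective_def)
qed

lemma semi_Gorenstein_projective_iso:
  assumes "module_iso R K M" "left_module R K" "left_module R M" "semi_Gorenstein_projective R M"
  shows "semi_Gorenstein_projective R K"
  using assms(4) Ext_vanishes_iso[OF assms(1-3)] unfolding semi_Gorenstein_projective_def by blast

text \<open>
  A homomorphism \<open>K \<rightarrow> N\<close> gives a cocycle of degree one for a resolution of \<open>M\<close> which continues a
  resolution of \<open>K\<close> by \<open>Q\<close>. It is a coboundary if and only if the homomorphism extends to \<open>Q\<close>.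
\<close>

lemma Ext1_extend:
  fixes R :: "'r ring" and Q :: "'r fgmodule"
  assumes se: "short_exact R K j Q \<pi> M" and Q: "projective R Q" and ext: "Ext_vanishes R 1 M N"
    and R: "noetherian R" and K: "fin_gen R K" and N: "left_module R N"
    and f: "f \<in> module_homs R K N"
  shows "\<exists>g \<in> module_homs R Q N. \<forall>x \<in> carrier K. g (j x) = f x"
proof -
  have KL: "left_module R K" using se by (simp add: short_exact_def)
  interpret K: left_module R K by fact
  obtain P :: "nat \<Rightarrow> 'r fgmodule" and d \<epsilon> where res: "projective_resolution R K P d \<epsilon>"
    using resolution_exists[OF K.ring_axioms' R KL K] by blast
  note r = projective_resolutionD[OF res]
  let ?P = "case_nat Q P" and ?d = "case_nat (j \<circ> \<epsilon>) d"
  define h where "h = restrict (f \<circ> \<epsilon>) (carrier (P 0))"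
  have h: "h \<in> Hom R (P 0) N" unfolding h_def by (rule hom_restrict[OF hom_comp[OF r(3) f] r(2)])
  have "h (d 0 x) = \<zero>\<^bsub>N\<^esub>" if x: "x \<in> carrier (P (Suc 0))" for x
  proof -
    have "d 0 x \<in> a_kernel (P 0) K \<epsilon>" using r(6) x by blast
    then show ?thesis using hom_zero[OF f KL N] by (simp add: h_def)
  qed
  then have "h \<in> cocycles R ?P ?d N 1" using h by (simp add: cocycles_def)
  also have "cocycles R ?P ?d N 1 = coboundaries R ?P ?d N 1"
    using ext splice_resolution[OF se Q res] unfolding Ext_vanishes_def by blast
  finally obtain g where g: "g \<in> Hom R Q N" "h = compose (carrier (P 0)) g (j \<circ> \<epsilon>)" by auto
  have "g (j x) = f x" if "x \<in> carrier K" for x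
  proof -
    have "x \<in> \<epsilon> ` carrier (P 0)" unfolding r(4) by (rule that)
    then obtain y where y: "y \<in> carrier (P 0)" "x = \<epsilon> y" by blast
    then have "h y = g (j x)" using g(2) by (simp add: compose_def)
    then show ?thesis using y by (simp add: h_def)
  qed
  then show ?thesis using HomD(1)[OF g(1)] by blast
qed

section \<open>Infinitely torsionfree modules and the dual module\<close>

lemma quotient_copy:
  fixes P :: "('r, 'p) module"
  assumes "left_module R P" "Module.submodule U R P"
  shows "\<exists>(N :: ('r, 'p) module) c. left_module R N \<and> c \<in> module_homs R P N \<and>
    c ` carrier P = carrier N \<and> (\<forall>x \<in> carrier P. c x = \<zero>\<^bsub>N\<^esub> \<longleftrightarrow> x \<in> U)"
proof -
  let ?p = "\<lambda>x. a_r_coset P U x" and ?Q = "quotient_module P U"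
  note q = quotient_projection[OF assms]
  have "inj_on (inv_into (carrier P) ?p) (carrier ?Q)"
    unfolding q(3)[symmetric] by (rule inj_on_inv_into) simp
  from module_transport[OF q(1) this] obtain N where N: "left_module R N"
    "carrier N = inv_into (carrier P) ?p ` carrier ?Q"
    "inv_into (carrier P) ?p \<in> module_homs R ?Q N" by blast
  have "bij_betw (inv_into (carrier P) ?p) (carrier ?Q) (carrier N)"
    using \<open>inj_on _ _\<close> N(2) by (simp add: bij_betw_def)
  then have "module_iso R ?Q N" unfolding module_iso_def using N(3) by blast
  then have "module_iso R N ?Q" using module_iso_sym q(1) by blast
  then show ?thesis
    unfolding iso_quotient_iff[OF assms(1) N(1) assms(2)] using N(1) by blast
qed

text \<open>
  The pairing \<open>\<Sum> v\<^sub>i w\<^sub>i\<close> identifies \<open>R\<^sup>n\<close> as a right module with the dual of the left module \<open>R\<^sup>n\<close>,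
  and conversely.
\<close>

definition pairing :: "'r ring \<Rightarrow> nat \<Rightarrow> (nat \<Rightarrow> 'r) \<Rightarrow> (nat \<Rightarrow> 'r) \<Rightarrow> 'r" where
  "pairing R n v w = lin_comb (regular_module R) n w v"

lemma carrier_free_opposite [simp]: "carrier (free_module (opposite R) n) = carrier (free_module R n)"
  by (simp add: free_module_simps(1))

lemma unit_fam_opposite [simp]: "unit_fam (opposite R) n = unit_fam R n"
  by (simp add: unit_fam_def fun_eq_iff)

lemma finsum_regular_opposite:
  "finsum (regular_module (opposite R)) f A = finsum (regular_module R) f A"
  by (simp add: finsum_def)

lemma pairing_opposite: "pairing (opposite R) n w v = pairing R n v w"
  by (simp add: pairing_def lin_comb_def finsum_regular_opposite)

lemma pairing_eq_zero:
  assumes "ring R" "\<And>i. i < n \<Longrightarrow> v i \<otimes>\<^bsub>R\<^esub> w i = \<zero>\<^bsub>R\<^esub>"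
  shows "pairing R n v w = \<zero>\<^bsub>R\<^esub>"
proof -
  interpret L: left_module R "regular_module R" by (rule left_module_regular[OF assms(1)])
  have "pairing R n v w = finsum (regular_module R) (\<lambda>i. \<zero>\<^bsub>regular_module R\<^esub>) {..<n}"
    unfolding pairing_def lin_comb_def using assms(2) by (intro L.M.finsum_cong') auto
  then show ?thesis by simp
qed

lemma pairing_hom_left:
  assumes "ring R" "w \<in> carrier (free_module R n)"
  shows "(\<lambda>v. pairing R n v w) \<in> module_homs R (free_module R n) (regular_module R)"
  unfolding pairing_def using free_mem[OF assms(2)]
  by (intro lin_comb_hom left_module_regular assms(1)) simp

lemma pairing_hom_right:
  assumes "ring R" "v \<in> carrier (free_module R n)"
  shows "pairing R n v \<in> module_homs (opposite R) (free_module (opposite R) n) (regular_module (opposite R))"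
  using pairing_hom_left[OF ring_opposite[OF assms(1)], of v n] assms(2) by (simp add: pairing_opposite)

lemma pairing_closed:
  assumes "ring R" "v \<in> carrier (free_module R n)" "w \<in> carrier (free_module R n)"
  shows "pairing R n v w \<in> carrier R"
  using homD(1)[OF pairing_hom_left[OF assms(1,3)] assms(2)] by simp

lemma hom_free_pairing:
  assumes "ring R" "f \<in> module_homs R (free_module R n) (regular_module R)" "v \<in> carrier (free_module R n)"
  shows "f v = pairing R n v (\<lambda>i\<in>{..<n}. f (unit_fam R n i))"
proof -
  have c: "f (unit_fam R n i) \<in> carrier R" for i
    using homD(1)[OF assms(2) unit_fam_closed[OF assms(1)]] by simp
  have "f v = lin_comb (regular_module R) n (\<lambda>i. f (unit_fam R n i)) v"
    by (rule hom_free_eq[OF assms(2) left_module_regular[OF assms(1)] assms(3)])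
  also have "\<dots> = lin_comb (regular_module R) n (\<lambda>i\<in>{..<n}. f (unit_fam R n i)) v"
    by (rule lin_comb_cong[OF left_module_regular[OF assms(1)] _ _ assms(3)]) (simp_all add: c)
  finally show ?thesis by (simp add: pairing_def)
qed

lemma hom_free_pairing_opposite:
  assumes "ring R" "f \<in> module_homs (opposite R) (free_module (opposite R) n) (regular_module (opposite R))"
    "v \<in> carrier (free_module R n)"
  shows "f v = pairing R n (\<lambda>i\<in>{..<n}. f (unit_fam R n i)) v"
  using hom_free_pairing[OF ring_opposite[OF assms(1)] assms(2)] assms(3) by (simp add: pairing_opposite)

lemma pairing_unit_right:
  assumes "ring R" "v \<in> carrier (free_module R n)" "i < n"
  shows "pairing R n v (unit_fam R n i) = v i"
proof -
  interpret R: ring R by fact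
  have "(\<lambda>i\<in>{..<n}. unit_fam R n i i') = unit_fam R n i'" if "i' < n" for i'
    using that by (auto simp: unit_fam_def)
  then show ?thesis
    using hom_free_pairing[OF assms(1) free_coord_hom[OF assms(3)] assms(2)] assms(3) by simp
qed

lemma pairing_unit_left:
  assumes "ring R" "v \<in> carrier (free_module R n)" "i < n"
  shows "pairing R n (unit_fam R n i) v = v i"
  using pairing_unit_right[OF ring_opposite[OF assms(1)], of v n i] assms(2,3) by (simp add: pairing_opposite)

lemma dual_mem:
  assumes "left_module R M" "f \<in> module_homs R M (regular_module R)"
  shows "restrict f (carrier M) \<in> carrier (dual R M)"
  using hom_restrict[OF assms(2,1)] by simp

text \<open>
  The two conditions are injectivity and surjectivity of the canonical map \<open>M \<rightarrow> M\<^sup>*\<^sup>*\<close>.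
\<close>

definition reflexive_module :: "'r ring \<Rightarrow> ('r, 'm) module \<Rightarrow> bool" where
  "reflexive_module R M \<longleftrightarrow>
     (\<forall>x \<in> carrier M. (\<forall>f \<in> carrier (dual R M). f x = \<zero>\<^bsub>R\<^esub>) \<longrightarrow> x = \<zero>\<^bsub>M\<^esub>) \<and>
     (\<forall>\<phi> \<in> module_homs (opposite R) (dual R M) (regular_module (opposite R)).
        \<exists>x \<in> carrier M. \<forall>f \<in> carrier (dual R M). \<phi> f = f x)"

text \<open>
  A form of being infinitely torsionfree which does not mention the transpose; for this reason
  it can be followed from a module to its cosyzygy.
\<close>

definition reflexive_dual_semi_GP :: "'r ring \<Rightarrow> ('r, 'm) module \<Rightarrow> bool" where
  "reflexive_dual_semi_GP R M \<longleftrightarrow> reflexive_module R M \<and>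
     semi_Gorenstein_projective (opposite R) (dual R M)"

text \<open>
  The homomorphism \<open>\<pi>\<^sup>* : M\<^sup>* \<rightarrow> (R\<^sup>a)\<^sup>*\<close>, with the dual of \<open>R\<^sup>a\<close> identified with the right module \<open>R\<^sup>a\<close>.
\<close>

lemma dual_embedding:
  fixes R :: "'r ring" and M :: "('r, 'm) module"
  assumes M: "left_module R M" and pi: "\<pi> \<in> module_homs R (free_module R a) M"
    "\<pi> ` carrier (free_module R a) = carrier M"
  defines "j \<equiv> \<lambda>f :: 'm \<Rightarrow> 'r. \<lambda>i\<in>{..<a}. f (\<pi> (unit_fam R a i))"
  shows "j \<in> module_homs (opposite R) (dual R M) (free_module (opposite R) a)"
    and "inj_on j (carrier (dual R M))"
    and "\<And>f v. f \<in> carrier (dual R M) \<Longrightarrow> v \<in> carrier (free_module R a) \<Longrightarrow> f (\<pi> v) = pairing R a v (j f)"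
proof -
  interpret M: left_module R M by fact
  note R = M.ring_axioms'
  have fh: "f \<in> module_homs R M (regular_module R)" if "f \<in> carrier (dual R M)" for f
    using that by (simp add: HomD(1))
  show jp: "f (\<pi> v) = pairing R a v (j f)"
    if "f \<in> carrier (dual R M)" "v \<in> carrier (free_module R a)" for f v
    using hom_free_pairing[OF R hom_comp[OF pi(1) fh[OF that(1)]] that(2)] by (simp add: j_def)
  have piu: "\<pi> (unit_fam R a i) \<in> carrier M" for i by (rule homD(1)[OF pi(1) unit_fam_closed[OF R]])
  have jc: "j f \<in> carrier (free_module (opposite R) a)" if "f \<in> carrier (dual R M)" for f
    using homD(1)[OF fh[OF that] piu] by (auto simp: j_def free_module_simps(1))
  show "j \<in> module_homs (opposite R) (dual R M) (free_module (opposite R) a)"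
    by (intro homI jc) (auto simp: j_def piu)
  show "inj_on j (carrier (dual R M))"
  proof (rule inj_onI)
    fix f g assume fg: "f \<in> carrier (dual R M)" "g \<in> carrier (dual R M)" "j f = j g"
    show "f = g"
    proof (rule Hom_eqI[of _ R M "regular_module R"])
      fix x assume "x \<in> carrier M"
      then obtain v where v: "v \<in> carrier (free_module R a)" "x = \<pi> v" using pi(2) by blast
      then show "f x = g x" using jp[OF fg(1) v(1)] jp[OF fg(2) v(1)] fg(3) by simp
    qed (use fg in simp_all)
  qed
qed

text \<open>
  Dualizing the presentation \<open>R\<^sup>b \<rightarrow> R\<^sup>a \<rightarrow> M\<close> gives an exact sequence
  \<open>0 \<rightarrow> M\<^sup>* \<rightarrow> R\<^sup>a \<rightarrow> R\<^sup>b \<rightarrow> T \<rightarrow> 0\<close> of right modules, where \<open>T\<close> is the transpose. Let \<open>I\<close> be the image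
  of the map in the middle. Then \<open>I\<close> and \<open>M\<^sup>*\<close> inherit the vanishing of \<open>Ext\<close> from \<open>T\<close>. Moreover homomorphisms
  \<open>M\<^sup>* \<rightarrow> R\<close> extend to \<open>R\<^sup>a\<close>, so they are evaluations at images of elements of the left module \<open>R\<^sup>a\<close>;
  and homomorphisms \<open>I \<rightarrow> R\<close> extend to \<open>R\<^sup>b\<close>, so an element of \<open>R\<^sup>a\<close> on whose image all of \<open>M\<^sup>*\<close>
  vanishes comes from \<open>R\<^sup>b\<close>.
\<close>

lemma infinitely_torsionfree_reflexive:
  fixes R :: "'r ring" and M :: "('r, 'm) module"
  assumes noeth: "noetherian (opposite R)" and M: "left_module R M"
    and cov: "projective_cover R (free_module R a) \<pi> M"
    and cov1: "projective_cover R (free_module R b) p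
      ((free_module R a)\<lparr>carrier := a_kernel (free_module R a) M \<pi>\<rparr>)"
    and tf: "infinitely_torsionfree R M"
  shows "reflexive_dual_semi_GP R M"
proof -
  interpret M: left_module R M by fact
  note R = M.ring_axioms' and R' = ring_opposite[OF M.ring_axioms']
  let ?R' = "opposite R"
  let ?F0 = "free_module R a" and ?F1 = "free_module R b"
  let ?Q0 = "free_module ?R' a" and ?Q1 = "free_module ?R' b"
  let ?K = "a_kernel ?F0 M \<pi>"
  have pi: "\<pi> \<in> module_homs R ?F0 M" "\<pi> ` carrier ?F0 = carrier M"
    using cov by (auto simp: projective_cover_def)
  have pK: "p \<in> module_homs R ?F1 (?F0\<lparr>carrier := ?K\<rparr>)" "p ` carrier ?F1 = ?K"
    using cov1 by (auto simp: projective_cover_def)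
  have p: "p \<in> module_homs R ?F1 ?F0"
    by (rule hom_codomain_extend[OF pK(1)]) auto
  note F = left_module_free[OF R] and Q = left_module_free[OF R'] and L = left_module_regular[OF R]
    and L' = left_module_regular[OF R'] and D = left_module_dual[OF M]
  note u = unit_fam_closed[OF R]
  define A where "A w = (\<lambda>j\<in>{..<b}. pairing R a (p (unit_fam R b j)) w)" for w
  have pu: "p (unit_fam R b j) \<in> carrier ?F0" for j by (rule homD(1)[OF p u])
  have pp: "pairing R a (p v) w = pairing R b v (A w)"
    if "v \<in> carrier ?F1" "w \<in> carrier ?F0" for v w
    using hom_free_pairing[OF R hom_comp[OF p pairing_hom_left[OF R that(2)]] that(1)]
    by (simp add: A_def)
  have Ac: "A w \<in> carrier ?Q1" if "w \<in> carrier ?F0" for w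
    using pairing_closed[OF R pu that] by (auto simp: A_def free_module_simps(1))
  have A: "A \<in> module_homs ?R' ?Q0 ?Q1"
  proof (rule homI)
    fix v w assume v: "v \<in> carrier ?Q0" and w: "w \<in> carrier ?Q0"
    show "A (v \<oplus>\<^bsub>?Q0\<^esub> w) = A v \<oplus>\<^bsub>?Q1\<^esub> A w"
      using homD(2)[OF pairing_hom_right[OF R pu] v w] by (auto simp: A_def)
  next
    fix r v assume r: "r \<in> carrier ?R'" and v: "v \<in> carrier ?Q0"
    show "A (r \<odot>\<^bsub>?Q0\<^esub> v) = r \<odot>\<^bsub>?Q1\<^esub> A v"
      using homD(3)[OF pairing_hom_right[OF R pu] r v] by (auto simp: A_def)
  qed (use Ac in simp)
  define W where "W = A ` carrier ?Q0"
  let ?I = "?Q1\<lparr>carrier := W\<rparr>"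
  have Wsub: "Module.submodule W ?R' ?Q1"
    unfolding W_def by (rule submodule_image[OF A Q Q submodule_carrier[OF Q]])
  have I: "left_module ?R' ?I" by (rule left_module_submodule[OF Q Wsub])
  obtain T :: "'r fgmodule" and c where T: "left_module ?R' T" and c: "c \<in> module_homs ?R' ?Q1 T"
    "c ` carrier ?Q1 = carrier T" "\<forall>x \<in> carrier ?Q1. c x = \<zero>\<^bsub>T\<^esub> \<longleftrightarrow> x \<in> W"
    using quotient_copy[OF Q Wsub] by blast

  \<comment> \<open>Evaluation at the unit vectors identifies the dual of the left module \<open>R\<^sup>b\<close> with \<open>Q1\<close>.\<close>
  define th where "th g = (\<lambda>j\<in>{..<b}. g (unit_fam R b j))" for g :: "(nat \<Rightarrow> 'r) \<Rightarrow> 'r"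
  have gh: "g \<in> module_homs R ?F1 (regular_module R)" if "g \<in> carrier (dual R ?F1)" for g
    using that by (simp add: HomD(1))
  have thp: "g v = pairing R b v (th g)" if "g \<in> carrier (dual R ?F1)" "v \<in> carrier ?F1" for g v
    unfolding th_def by (rule hom_free_pairing[OF R gh[OF that(1)] that(2)])
  have thc: "th g \<in> carrier ?Q1" if "g \<in> carrier (dual R ?F1)" for g
    using homD(1)[OF gh[OF that] u] by (auto simp: th_def free_module_simps(1))
  have th: "th \<in> module_homs ?R' (dual R ?F1) ?Q1"
    by (intro homI thc) (auto simp: th_def u)
  have thr: "th (restrict (\<lambda>v. pairing R b v w) (carrier ?F1)) = w" if "w \<in> carrier ?F1" for w
  proof (rule free_eqI[of _ R b])
    show "th (restrict (\<lambda>v. pairing R b v w) (carrier ?F1)) \<in> carrier ?F1"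
      using thc dual_mem[OF F pairing_hom_left[OF R that]] by simp
  qed (use that u in \<open>auto simp: th_def pairing_unit_left[OF R that]\<close>)
  have th_surj: "th ` carrier (dual R ?F1) = carrier ?Q1"
  proof (intro subset_antisym subsetI)
    fix w assume "w \<in> carrier ?Q1"
    then have w: "w \<in> carrier ?F1" by simp
    show "w \<in> th ` carrier (dual R ?F1)"
      using thr[OF w, symmetric] dual_mem[OF F pairing_hom_left[OF R w]] by (rule image_eqI)
  qed (use thc in auto)
  let ?B = "(\<lambda>g. compose (carrier ?F1) g p) ` carrier (dual R ?F0)"
  have th_im: "th g \<in> W \<longleftrightarrow> g \<in> ?B" if g: "g \<in> carrier (dual R ?F1)" for g
  proof
    assume "th g \<in> W"
    then obtain w where w: "w \<in> carrier ?F0" "th g = A w" by (auto simp: W_def)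
    let ?h = "restrict (\<lambda>v. pairing R a v w) (carrier ?F0)"
    have h: "?h \<in> carrier (dual R ?F0)" by (rule dual_mem[OF F pairing_hom_left[OF R w(1)]])
    have "g v = compose (carrier ?F1) ?h p v" if "v \<in> carrier ?F1" for v
      using thp[OF g that] pp[OF that w(1)] w(2) that homD(1)[OF p that] by (simp add: compose_def)
    then have "g = compose (carrier ?F1) ?h p"
      using g by (auto simp: Hom_def intro!: extensionalityI[of _ "carrier ?F1"])
    then show "g \<in> ?B" using h by (rule image_eqI)
  next
    assume "g \<in> ?B"
    then obtain h where h: "h \<in> carrier (dual R ?F0)" "g = compose (carrier ?F1) h p" by auto
    let ?w = "\<lambda>i\<in>{..<a}. h (unit_fam R a i)"
    have hh: "h \<in> module_homs R ?F0 (regular_module R)" using h(1) by (simp add: HomD(1))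
    have w: "?w \<in> carrier ?F0" using homD(1)[OF hh u] by (auto simp: free_module_simps(1))
    have "th g = A ?w"
      using hom_free_pairing[OF R hh pu] u by (auto simp: th_def A_def h(2) compose_def)
    then show "th g \<in> W" using w by (auto simp: W_def)
  qed
  have DF1: "left_module ?R' (dual R ?F1)" by (rule left_module_dual[OF F])
  have cth: "c \<circ> th \<in> module_homs ?R' (dual R ?F1) T" by (rule hom_comp[OF th c(1)])
  have cth_surj: "(c \<circ> th) ` carrier (dual R ?F1) = carrier T"
    using th_surj c(2) by (simp only: image_comp[symmetric])
  have cth_ker: "\<forall>g \<in> carrier (dual R ?F1). (c \<circ> th) g = \<zero>\<^bsub>T\<^esub> \<longleftrightarrow> g \<in> ?B"
    using c(3) thc th_im by simp
  have Bsub: "Module.submodule ?B ?R' (dual R ?F1)"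
  proof -
    have "?B = a_kernel (dual R ?F1) T (c \<circ> th)"
    proof
      show "?B \<subseteq> a_kernel (dual R ?F1) T (c \<circ> th)"
      proof
        fix g assume g: "g \<in> ?B"
        then obtain h where h: "h \<in> Hom R ?F0 (regular_module R)" "g = compose (carrier ?F1) h p" by auto
        have "restrict (h \<circ> p) (carrier ?F1) \<in> carrier (dual R ?F1)"
          by (rule dual_mem[OF F hom_comp[OF p HomD(1)[OF h(1)]]])
        moreover have "restrict (h \<circ> p) (carrier ?F1) = g" by (auto simp: h(2) compose_def)
        ultimately show "g \<in> a_kernel (dual R ?F1) T (c \<circ> th)" using cth_ker g unfolding a_kernel_iff by blast
      qed
      show "a_kernel (dual R ?F1) T (c \<circ> th) \<subseteq> ?B"
      proof
        fix g assume "g \<in> a_kernel (dual R ?F1) T (c \<circ> th)"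
        then have "g \<in> carrier (dual R ?F1)" "(c \<circ> th) g = \<zero>\<^bsub>T\<^esub>" unfolding a_kernel_iff by auto
        then show "g \<in> ?B" using bspec[OF cth_ker, of g] by (simp only:)
      qed
    qed
    then show ?thesis using submodule_kernel[OF cth DF1 T] by (simp only:)
  qed
  have "module_iso ?R' T (quotient_module (dual R ?F1) ?B)"
    unfolding iso_quotient_iff[OF DF1 T Bsub] using cth cth_surj cth_ker by blast
  then have "is_transpose R M T"
    unfolding is_transpose_def using T cov cov1 by blast
  then have sgT: "semi_Gorenstein_projective ?R' T"
    using tf by (simp add: infinitely_torsionfree_def semi_Gorenstein_projective_def)
  then have ext1T: "Ext_vanishes ?R' 1 T (regular_module ?R')"
    unfolding semi_Gorenstein_projective_def by blast
  have WQ: "W \<subseteq> carrier ?Q1" by (rule submoduleD(1)[OF Wsub])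
  have incl: "(\<lambda>x. x) \<in> module_homs ?R' ?I ?Q1"
    by (rule hom_codomain_extend[OF _ WQ]) (use hom_id[OF I] in simp)
  have E1: "short_exact ?R' ?I (\<lambda>x. x) ?Q1 c T"
    unfolding short_exact_def using I Q T incl c WQ by (auto simp: a_kernel_def')
  have sgI: "semi_Gorenstein_projective ?R' ?I"
    by (rule semi_Gorenstein_projective_kernel[OF E1 projective_free[OF R'] sgT])
  then have ext1I: "Ext_vanishes ?R' 1 ?I (regular_module ?R')"
    unfolding semi_Gorenstein_projective_def by blast
  define j where "j f = (\<lambda>i\<in>{..<a}. f (\<pi> (unit_fam R a i)))" for f :: "'m \<Rightarrow> 'r"
  note emb = dual_embedding[OF M pi, folded j_def]
  have j: "j \<in> module_homs ?R' (dual R M) ?Q0" and j_inj: "inj_on j (carrier (dual R M))"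
    and jp: "\<And>f v. f \<in> carrier (dual R M) \<Longrightarrow> v \<in> carrier ?F0 \<Longrightarrow> f (\<pi> v) = pairing R a v (j f)"
    using emb by (simp_all add: j_def[abs_def])
  have fh: "f \<in> module_homs R M (regular_module R)" if "f \<in> carrier (dual R M)" for f
    using that by (simp add: HomD(1))
  have piu: "\<pi> (unit_fam R a i) \<in> carrier M" for i by (rule homD(1)[OF pi(1) u])
  have jc: "j f \<in> carrier ?Q0" if "f \<in> carrier (dual R M)" for f
    by (rule homD(1)[OF j that])
  have j_im: "j ` carrier (dual R M) = a_kernel ?Q0 ?I A"
  proof (intro subset_antisym subsetI)
    fix w assume "w \<in> j ` carrier (dual R M)"
    then obtain f where f: "f \<in> carrier (dual R M)" "w = j f" by auto
    have "pairing R a (p (unit_fam R b i)) w = \<zero>\<^bsub>R\<^esub>" for i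
    proof -
      have "p (unit_fam R b i) \<in> ?K" using pK(2) u by blast
      then have "f (\<pi> (p (unit_fam R b i))) = \<zero>\<^bsub>R\<^esub>"
        using hom_zero[OF fh[OF f(1)] M L] by simp
      then show ?thesis using jp[OF f(1) pu] f(2) by simp
    qed
    then show "w \<in> a_kernel ?Q0 ?I A" using jc[OF f(1)] f(2) by (auto simp: A_def)
  next
    fix w assume "w \<in> a_kernel ?Q0 ?I A"
    then have w: "w \<in> carrier ?F0" and Aw: "A w = \<zero>\<^bsub>?Q1\<^esub>" by auto
    have "pairing R a v w = \<zero>\<^bsub>R\<^esub>" if v: "v \<in> carrier ?F0" "\<pi> v = \<zero>\<^bsub>M\<^esub>" for v
    proof -
      have "v \<in> p ` carrier ?F1" unfolding pK(2) using v by simp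
      then obtain z where z: "z \<in> carrier ?F1" "v = p z" by auto
      then have "pairing R a v w = pairing R b z (\<zero>\<^bsub>?Q1\<^esub>)" using pp[OF z(1) w] Aw by simp
      also have "\<dots> = \<zero>\<^bsub>R\<^esub>" using hom_zero[OF pairing_hom_right[OF R z(1)] Q L'] by simp
      finally show ?thesis .
    qed
    then obtain f where f: "f \<in> module_homs R M (regular_module R)"
      "\<forall>v \<in> carrier ?F0. f (\<pi> v) = pairing R a v w"
      using hom_factor[OF pi(1) pairing_hom_left[OF R w] F M L pi(2)] by auto
    have "j (restrict f (carrier M)) = w"
    proof (rule free_eqI[of _ R a])
      show "j (restrict f (carrier M)) \<in> carrier ?F0" using jc[OF dual_mem[OF M f(1)]] by simp
    qed (use w f(2) u piu pairing_unit_left[OF R w] in \<open>auto simp: j_def\<close>)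
    then show "w \<in> j ` carrier (dual R M)" using dual_mem[OF M f(1)] by (intro image_eqI[OF sym])
  qed
  have AI: "A \<in> module_homs ?R' ?Q0 ?I" by (rule hom_codomain_restrict[OF A]) (simp add: W_def)
  have E2: "short_exact ?R' (dual R M) j ?Q0 A ?I"
    unfolding short_exact_def using D Q I j j_inj AI j_im by (simp add: W_def)
  have sgD: "semi_Gorenstein_projective ?R' (dual R M)"
    by (rule semi_Gorenstein_projective_kernel[OF E2 projective_free[OF R'] sgI])
  have "reflexive_module R M"
    unfolding reflexive_module_def
  proof (intro conjI ballI impI)
    fix x assume x: "x \<in> carrier M" and x0: "\<forall>f\<in>carrier (dual R M). f x = \<zero>\<^bsub>R\<^esub>"
    obtain v where v: "v \<in> carrier ?F0" "x = \<pi> v" using pi(2) x by blast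
    have "pairing R a v w = \<zero>\<^bsub>R\<^esub>" if "w \<in> carrier ?Q0" "A w = \<zero>\<^bsub>?I\<^esub>" for w
    proof -
      have "w \<in> j ` carrier (dual R M)" unfolding j_im using that by simp
      then show ?thesis using jp v x0 by auto
    qed
    then obtain g where g: "g \<in> module_homs ?R' ?I (regular_module ?R')"
      "\<forall>w \<in> carrier ?Q0. g (A w) = pairing R a v w"
      using hom_factor[OF AI pairing_hom_right[OF R v(1)] Q I L'] by (auto simp: W_def)
    have "fin_gen ?R' ?I" by (rule fin_gen_embedded[OF noeth I incl]) simp
    then obtain G where G: "G \<in> module_homs ?R' ?Q1 (regular_module ?R')" "\<forall>x \<in> W. G x = g x"
      using Ext1_extend[OF E1 projective_free[OF R'] ext1T noeth _ L' g(1)] by auto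
    let ?z = "\<lambda>i\<in>{..<b}. G (unit_fam R b i)"
    have z: "?z \<in> carrier ?F1" using homD(1)[OF G(1), of "unit_fam R b _"] u by (auto simp: free_module_simps(1))
    have vz: "pairing R a v w = pairing R a (p ?z) w" if w: "w \<in> carrier ?F0" for w
    proof -
      have "pairing R a v w = G (A w)" using g(2) G(2) w by (auto simp: W_def)
      also have "\<dots> = pairing R b ?z (A w)" using hom_free_pairing_opposite[OF R G(1)] Ac[OF w] by simp
      finally show ?thesis using pp[OF z w] by simp
    qed
    have "v = p ?z"
    proof (rule free_eqI[OF v(1) homD(1)[OF p z]])
      fix i assume "i < a"
      then show "v i = p ?z i"
        using vz[OF u, of i] pairing_unit_right[OF R v(1)] pairing_unit_right[OF R homD(1)[OF p z]] by simp
    qed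
    then have "v \<in> ?K" using pK(2) z by blast
    then show "x = \<zero>\<^bsub>M\<^esub>" using v(2) by simp
  next
    fix f assume f: "f \<in> module_homs ?R' (dual R M) (regular_module ?R')"
    have "fin_gen ?R' (dual R M)" by (rule fin_gen_embedded[OF noeth D j j_inj])
    then obtain G where G: "G \<in> module_homs ?R' ?Q0 (regular_module ?R')"
      "\<forall>g \<in> carrier (dual R M). G (j g) = f g"
      using Ext1_extend[OF E2 projective_free[OF R'] ext1I noeth _ L' f] by blast
    let ?z = "\<lambda>i\<in>{..<a}. G (unit_fam R a i)"
    have z: "?z \<in> carrier ?F0" using homD(1)[OF G(1), of "unit_fam R a _"] u by (auto simp: free_module_simps(1))
    have "f g = g (\<pi> ?z)" if g: "g \<in> carrier (dual R M)" for g
    proof -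
      have "f g = G (j g)" by (rule bspec[OF G(2) g, symmetric])
      also have "\<dots> = pairing R a ?z (j g)"
        using jc[OF g] by (intro hom_free_pairing_opposite[OF R G(1)]) simp
      finally have "f g = pairing R a ?z (j g)" .
      then show ?thesis using jp[OF g z] by simp
    qed
    then show "\<exists>x\<in>carrier M. \<forall>g\<in>carrier (dual R M). f g = g x"
      using homD(1)[OF pi(1) z] by blast
  qed
  then show ?thesis using sgD by (simp add: reflexive_dual_semi_GP_def)
qed

text \<open>
  The dual of \<open>N\<close> is the kernel of the epimorphism \<open>R \<rightarrow> M\<^sup>*\<close> of right modules which sends \<open>1\<close> to \<open>F\<close>;
  so \<open>N\<^sup>*\<close> inherits the vanishing of \<open>Ext\<close> from \<open>M\<^sup>*\<close>, and homomorphisms \<open>N\<^sup>* \<rightarrow> R\<close> extend to \<open>R\<close>, which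
  makes them evaluations. If \<open>N\<^sup>*\<close> vanishes on \<open>c a\<close>, then \<open>F r \<mapsto> a r\<close> is a well-defined homomorphism
  \<open>M\<^sup>* \<rightarrow> R\<close>, hence the evaluation at some \<open>x\<close>, and \<open>a = F x\<close> is in the kernel of \<open>c\<close>.
\<close>

lemma reflexive_dual_semi_GP_cokernel:
  fixes R :: "'r ring" and M :: "('r, 'm) module" and N :: "('r, 'n) module"
  assumes noeth: "noetherian (opposite R)" and M: "left_module R M" and N: "left_module R N"
    and S: "reflexive_dual_semi_GP R M"
    and F: "F \<in> module_homs R M (regular_module R)"
    and app: "\<And>g. g \<in> module_homs R M (regular_module R) \<Longrightarrow>
      \<exists>r \<in> carrier R. \<forall>x \<in> carrier M. g x = F x \<otimes>\<^bsub>R\<^esub> r"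
    and c: "c \<in> module_homs R (regular_module R) N" "c ` carrier R = carrier N"
    and ker: "\<And>r. r \<in> carrier R \<Longrightarrow> c r = \<zero>\<^bsub>N\<^esub> \<longleftrightarrow> r \<in> F ` carrier M"
  shows "reflexive_dual_semi_GP R N"
proof -
  interpret M: left_module R M by fact
  interpret N: left_module R N by fact
  note R = M.ring_axioms' and R' = ring_opposite[OF M.ring_axioms']
  let ?R' = "opposite R"
  let ?Q = "free_module ?R' 1"
  note Q = left_module_free[OF R', of 1] and L = left_module_regular[OF R]
    and L' = left_module_regular[OF R'] and D = left_module_dual[OF M] and DN = left_module_dual[OF N]
  have Fc: "F x \<in> carrier R" if "x \<in> carrier M" for x using homD(1)[OF F that] by simp
  have c1: "c \<one>\<^bsub>R\<^esub> \<in> carrier N" using homD(1)[OF c(1), of "\<one>\<^bsub>R\<^esub>"] by simp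
  have cr: "c r = r \<odot>\<^bsub>N\<^esub> c \<one>\<^bsub>R\<^esub>" if "r \<in> carrier R" for r
    using homD(3)[OF c(1), of r "\<one>\<^bsub>R\<^esub>"] that by simp
  have gh: "g \<in> module_homs R N (regular_module R)" if "g \<in> carrier (dual R N)" for g
    using that by (simp add: HomD(1))
  have gr: "g (c r) = r \<otimes>\<^bsub>R\<^esub> g (c \<one>\<^bsub>R\<^esub>)" if "g \<in> carrier (dual R N)" "r \<in> carrier R" for g r
    using homD(3)[OF gh[OF that(1)] that(2) c1] cr[OF that(2)] by simp
  have g1: "g (c \<one>\<^bsub>R\<^esub>) \<in> carrier R" if "g \<in> carrier (dual R N)" for g
    using homD(1)[OF gh[OF that] c1] by simp
  define q where "q v = (\<lambda>x\<in>carrier M. F x \<otimes>\<^bsub>R\<^esub> v 0)" for v :: "nat \<Rightarrow> 'r"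
  define j where "j g = (\<lambda>i\<in>{..<1::nat}. g (c \<one>\<^bsub>R\<^esub>))" for g :: "'n \<Rightarrow> 'r"
  have v0: "v 0 \<in> carrier R" if "v \<in> carrier ?Q" for v using free_mem[OF that] by simp
  have one: "(\<lambda>i\<in>{..<1::nat}. r) \<in> carrier ?Q" if "r \<in> carrier R" for r
    using that by (auto simp: free_module_simps(1))
  have Fr: "(\<lambda>x. F x \<otimes>\<^bsub>R\<^esub> r) \<in> module_homs R M (regular_module R)" if "r \<in> carrier R" for r
    using homD[OF F] that Fc by (intro homI) (auto simp: M.R.l_distr M.R.m_assoc)
  have qc: "q v \<in> carrier (dual R M)" if "v \<in> carrier ?Q" for v
    unfolding q_def by (rule dual_mem[OF M Fr[OF v0[OF that]]])
  have q: "q \<in> module_homs ?R' ?Q (dual R M)"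
  proof (rule homI)
    fix v w assume v: "v \<in> carrier ?Q" and w: "w \<in> carrier ?Q"
    show "q (v \<oplus>\<^bsub>?Q\<^esub> w) = q v \<oplus>\<^bsub>dual R M\<^esub> q w"
      using v0[OF v] v0[OF w] Fc by (auto simp: q_def M.R.r_distr)
  next
    fix r v assume r: "r \<in> carrier ?R'" and v: "v \<in> carrier ?Q"
    show "q (r \<odot>\<^bsub>?Q\<^esub> v) = r \<odot>\<^bsub>dual R M\<^esub> q v"
      using v0[OF v] r Fc by (auto simp: q_def M.R.m_assoc)
  qed (rule qc)
  have q_surj: "q ` carrier ?Q = carrier (dual R M)"
  proof (intro subset_antisym subsetI)
    fix f assume f: "f \<in> carrier (dual R M)"
    then have fh: "f \<in> Hom R M (regular_module R)" by simp
    obtain r where r: "r \<in> carrier R" "\<forall>x \<in> carrier M. f x = F x \<otimes>\<^bsub>R\<^esub> r"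
      using app[OF HomD(1)[OF fh]] by blast
    have "f = q (\<lambda>i\<in>{..<1::nat}. r)"
      using qc[OF one[OF r(1)]] fh r(2) by (intro Hom_eqI[of _ R M "regular_module R"]) (auto simp: q_def)
    then show "f \<in> q ` carrier ?Q" using one[OF r(1)] by (rule image_eqI)
  qed (use qc in auto)
  have jc: "j g \<in> carrier ?Q" if "g \<in> carrier (dual R N)" for g
    unfolding j_def by (rule one[OF g1[OF that]])
  have j: "j \<in> module_homs ?R' (dual R N) ?Q"
    by (intro homI jc) (auto simp: j_def c1)
  have j_inj: "inj_on j (carrier (dual R N))"
  proof (rule inj_onI)
    fix f g assume fg: "f \<in> carrier (dual R N)" "g \<in> carrier (dual R N)" "j f = j g"
    have eq: "f (c \<one>\<^bsub>R\<^esub>) = g (c \<one>\<^bsub>R\<^esub>)" using fun_cong[OF fg(3), of 0] by (simp add: j_def)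
    show "f = g"
    proof (rule Hom_eqI[of _ R N "regular_module R"])
      fix x assume "x \<in> carrier N"
      then obtain r where r: "r \<in> carrier R" "x = c r" using c(2) by blast
      then show "f x = g x" using gr[OF fg(1) r(1)] gr[OF fg(2) r(1)] eq by simp
    qed (use fg in simp_all)
  qed
  have j_im: "j ` carrier (dual R N) = a_kernel ?Q (dual R M) q"
  proof (intro subset_antisym subsetI)
    fix v assume "v \<in> j ` carrier (dual R N)"
    then obtain g where g: "g \<in> carrier (dual R N)" "v = j g" by auto
    have "F x \<otimes>\<^bsub>R\<^esub> g (c \<one>\<^bsub>R\<^esub>) = \<zero>\<^bsub>R\<^esub>" if x: "x \<in> carrier M" for x
      using gr[OF g(1) Fc[OF x]] ker[OF Fc[OF x]] x hom_zero[OF gh[OF g(1)] N L] by auto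
    then show "v \<in> a_kernel ?Q (dual R M) q" using jc[OF g(1)] g(2) by (auto simp: q_def j_def)
  next
    fix v assume "v \<in> a_kernel ?Q (dual R M) q"
    then have v: "v \<in> carrier ?Q" and qv: "q v = \<zero>\<^bsub>dual R M\<^esub>" by auto
    have z: "F x \<otimes>\<^bsub>R\<^esub> v 0 = \<zero>\<^bsub>R\<^esub>" if "x \<in> carrier M" for x
      using fun_cong[OF qv, of x] that by (simp add: q_def)
    have "(\<lambda>r. r \<otimes>\<^bsub>R\<^esub> v 0) \<in> module_homs R (regular_module R) (regular_module R)"
      using v0[OF v] by (intro homI) (auto simp: M.R.l_distr M.R.m_assoc)
    then obtain g where g: "g \<in> module_homs R N (regular_module R)" "\<forall>r \<in> carrier R. g (c r) = r \<otimes>\<^bsub>R\<^esub> v 0"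
      using hom_factor[OF c(1) _ L N L, of "\<lambda>r. r \<otimes>\<^bsub>R\<^esub> v 0"] c(2) z ker by auto
    have "g (c \<one>\<^bsub>R\<^esub>) = v 0" using g(2) v0[OF v] by simp
    then have "v = j (restrict g (carrier N))"
      using v c1 jc[OF dual_mem[OF N g(1)]] by (intro free_eqI[of _ ?R' 1]) (auto simp: j_def)
    then show "v \<in> j ` carrier (dual R N)" using dual_mem[OF N g(1)] by (rule image_eqI)
  qed
  have E: "short_exact ?R' (dual R N) j ?Q q (dual R M)"
    unfolding short_exact_def using DN Q D j j_inj q q_surj j_im by blast
  have refM: "reflexive_module R M" and sg: "semi_Gorenstein_projective ?R' (dual R M)"
    using S by (auto simp: reflexive_dual_semi_GP_def)
  have sgN: "semi_Gorenstein_projective ?R' (dual R N)"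
    by (rule semi_Gorenstein_projective_kernel[OF E projective_free[OF R'] sg])
  have ext1: "Ext_vanishes ?R' 1 (dual R M) (regular_module ?R')"
    using sg unfolding semi_Gorenstein_projective_def by blast
  have "reflexive_module R N"
    unfolding reflexive_module_def
  proof (intro conjI ballI impI)
    fix n assume n: "n \<in> carrier N" "\<forall>g\<in>carrier (dual R N). g n = \<zero>\<^bsub>R\<^esub>"
    obtain a where a: "a \<in> carrier R" "n = c a" using c(2) n(1) by blast
    have ah: "(\<lambda>v. a \<otimes>\<^bsub>R\<^esub> v 0) \<in> module_homs ?R' ?Q (regular_module ?R')"
      using a(1) v0 by (intro homI) (auto simp: M.R.r_distr M.R.m_assoc)
    have "a \<otimes>\<^bsub>R\<^esub> v 0 = \<zero>\<^bsub>R\<^esub>" if v: "v \<in> carrier ?Q" "q v = \<zero>\<^bsub>dual R M\<^esub>" for v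
    proof -
      have "v \<in> j ` carrier (dual R N)" unfolding j_im using v by simp
      then obtain g where g: "g \<in> carrier (dual R N)" "v = j g" by auto
      then show ?thesis using gr[OF g(1) a(1)] n(2) a(2) by (simp add: j_def)
    qed
    then obtain f where f: "f \<in> module_homs ?R' (dual R M) (regular_module ?R')"
      "\<forall>v \<in> carrier ?Q. f (q v) = a \<otimes>\<^bsub>R\<^esub> v 0"
      using hom_factor[OF q ah Q D L' q_surj] by auto
    obtain x where x: "x \<in> carrier M" "\<forall>g \<in> carrier (dual R M). f g = g x"
      using refM f(1) unfolding reflexive_module_def by blast
    have "f (q (\<lambda>i\<in>{..<1::nat}. \<one>\<^bsub>R\<^esub>)) = a" using f(2) one a(1) by simp
    then have "a = F x" using x qc[OF one[OF M.R.one_closed]] Fc by (simp add: q_def)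
    then show "n = \<zero>\<^bsub>N\<^esub>" using ker[OF a(1)] a(2) x(1) by blast
  next
    fix f assume f: "f \<in> module_homs ?R' (dual R N) (regular_module ?R')"
    have "fin_gen ?R' (dual R N)" by (rule fin_gen_embedded[OF noeth DN j j_inj])
    then obtain G where G: "G \<in> module_homs ?R' ?Q (regular_module ?R')"
      "\<forall>g \<in> carrier (dual R N). G (j g) = f g"
      using Ext1_extend[OF E projective_free[OF R'] ext1 noeth _ L' f] by blast
    let ?e = "\<lambda>i\<in>{..<1::nat}. \<one>\<^bsub>R\<^esub>"
    have z: "G ?e \<in> carrier R" using homD(1)[OF G(1) one[OF M.R.one_closed]] by simp
    have Gv: "G v = G ?e \<otimes>\<^bsub>R\<^esub> v 0" if v: "v \<in> carrier ?Q" for v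
    proof -
      have "v = v 0 \<odot>\<^bsub>?Q\<^esub> ?e"
        using v v0[OF v] by (intro free_eqI[of _ ?R' 1]) (auto simp: free_module_simps(1))
      then have "G v = G (v 0 \<odot>\<^bsub>?Q\<^esub> ?e)" by (rule arg_cong)
      also have "\<dots> = G ?e \<otimes>\<^bsub>R\<^esub> v 0"
        using homD(3)[OF G(1), of "v 0" ?e] v0[OF v] one[OF M.R.one_closed] by simp
      finally show ?thesis .
    qed
    have "f g = g (c (G ?e))" if g: "g \<in> carrier (dual R N)" for g
      using G(2) g Gv[OF jc[OF g]] gr[OF g z] by (simp add: j_def)
    moreover have "c (G ?e) \<in> carrier N" using homD(1)[OF c(1)] z by simp
    ultimately show "\<exists>x\<in>carrier N. \<forall>g\<in>carrier (dual R N). f g = g x" by blast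
  qed
  then show ?thesis using sgN by (simp add: reflexive_dual_semi_GP_def)
qed

section \<open>Linear algebra over the ground field\<close>

definition sub_dim :: "('k::field, 'v) module \<Rightarrow> 'v set \<Rightarrow> nat" where
  "sub_dim V U = vectorspace.dim class_ring (V\<lparr>carrier := U\<rparr>)"

definition k_subspace :: "('k::field, 'v) module \<Rightarrow> 'v set \<Rightarrow> bool" where
  "k_subspace V U \<longleftrightarrow> U \<subseteq> carrier V \<and> \<zero>\<^bsub>V\<^esub> \<in> U \<and> (\<forall>x\<in>U. \<forall>y\<in>U. x \<oplus>\<^bsub>V\<^esub> y \<in> U) \<and>
     (\<forall>c. \<forall>x\<in>U. c \<odot>\<^bsub>V\<^esub> x \<in> U)"

lemma k_subspace_submodule:
  assumes "vectorspace class_ring V" "k_subspace V U"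
  shows "LinearCombinations.submodule class_ring U V" "VectorSpace.subspace class_ring U V"
    "vectorspace class_ring (V\<lparr>carrier := U\<rparr>)"
proof -
  interpret vectorspace class_ring V by fact
  show s: "LinearCombinations.submodule class_ring U V"
    using assms(2) module_axioms by (auto simp: LinearCombinations.submodule_def k_subspace_def)
  then show ss: "VectorSpace.subspace class_ring U V"
    using assms(1) by (simp add: VectorSpace.subspace_def)
  show "vectorspace class_ring (V\<lparr>carrier := U\<rparr>)" by (rule subspace_is_vs[OF ss])
qed

lemma sub_dim_le:
  assumes V: "vectorspace class_ring V" "vectorspace.fin_dim class_ring V" and U: "k_subspace V U"
  shows "vectorspace.fin_dim class_ring (V\<lparr>carrier := U\<rparr>)"
    and "sub_dim V U \<le> vectorspace.dim class_ring V"
    and "sub_dim V U = vectorspace.dim class_ring V \<Longrightarrow> U = carrier V"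
proof -
  interpret V: vectorspace class_ring V by fact
  note s = k_subspace_submodule[OF V(1) U]
  interpret U: vectorspace class_ring "V\<lparr>carrier := U\<rparr>" by (rule s(3))
  have UV: "U \<subseteq> carrier V" using U by (simp add: k_subspace_def)
  have li: "U.lin_dep A \<longleftrightarrow> V.lin_dep A" if "A \<subseteq> U" for A
    by (rule V.span_li_not_depend(2)[OF that s(1)])
  have bound: "finite A \<and> card A \<le> V.dim" if "A \<subseteq> carrier (V\<lparr>carrier := U\<rparr>) \<and> U.lin_indpt A" for A
    using V.li_le_dim[OF V(2), of A] that li[of A] UV by auto
  have "{} \<subseteq> carrier (V\<lparr>carrier := U\<rparr>) \<and> U.lin_indpt {}"
    by (auto simp: U.lin_dep_def)
  from maximal_exists[where P = "\<lambda>A. A \<subseteq> carrier (V\<lparr>carrier := U\<rparr>) \<and> U.lin_indpt A", OF bound this]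
  obtain A where A: "finite A" "maximal A (\<lambda>A. A \<subseteq> carrier (V\<lparr>carrier := U\<rparr>) \<and> U.lin_indpt A)" by blast
  then have basis: "U.basis A" by (intro U.max_li_is_basis) simp
  then show fd: "U.fin_dim" using A(1) by (auto simp: U.basis_def U.fin_dim_def)
  have AU: "A \<subseteq> U" "U.lin_indpt A" using A(2) by (auto simp: maximal_def)
  have d: "U.dim = card A" by (rule U.dim_basis[OF A(1) basis])
  show "sub_dim V U \<le> V.dim" using bound[of A] AU d by (simp add: sub_dim_def)
  assume "sub_dim V U = V.dim"
  then have "V.basis A"
    using A(1) AU UV li[OF AU(1)] d by (intro V.dim_li_is_basis V(2)) (auto simp: sub_dim_def)
  then have "carrier V = V.span A" by (simp add: V.basis_def)
  also have "\<dots> \<subseteq> U" by (rule V.span_is_subset[OF AU(1) s(1)])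
  finally show "U = carrier V" using UV by auto
qed

lemma k_linear_map:
  assumes "vectorspace class_ring V" "vectorspace class_ring W" "T \<in> module_homs class_ring V W"
  shows "linear_map class_ring V W T"
  using assms
  by (auto simp: linear_map_def mod_hom_def mod_hom_axioms_def vectorspace_def)

lemma k_rank_nullity:
  assumes "vectorspace class_ring V" "vectorspace class_ring W" "T \<in> module_homs class_ring V W"
    and "vectorspace.fin_dim class_ring V"
  shows "sub_dim W (T ` carrier V) + sub_dim V {x \<in> carrier V. T x = \<zero>\<^bsub>W\<^esub>} = vectorspace.dim class_ring V"
proof -
  interpret linear_map class_ring V W T by (rule k_linear_map[OF assms(1-3)])
  show ?thesis using rank_nullity[OF assms(4)] by (simp add: sub_dim_def im_def ker_def)
qed

lemma k_linear_zero:
  assumes "vectorspace class_ring V" "vectorspace class_ring W" "T \<in> module_homs class_ring V W"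
  shows "T \<zero>\<^bsub>V\<^esub> = \<zero>\<^bsub>W\<^esub>"
proof -
  interpret linear_map class_ring V W T by (rule k_linear_map[OF assms(1-3)])
  show ?thesis by simp
qed

lemma sub_dim_zero:
  assumes "vectorspace class_ring V"
  shows "sub_dim V {\<zero>\<^bsub>V\<^esub>} = 0"
proof -
  interpret V: vectorspace class_ring V by fact
  have sub: "k_subspace V {\<zero>\<^bsub>V\<^esub>}" by (auto simp: k_subspace_def)
  interpret U: vectorspace class_ring "V\<lparr>carrier := {\<zero>\<^bsub>V\<^esub>}\<rparr>" by (rule k_subspace_submodule(3)[OF assms sub])
  have "U.dim \<le> card ({} :: 'b set)" by (rule U.gen_ge_dim) (auto simp: U.span_empty)
  then show ?thesis by (simp add: sub_dim_def)
qed

lemma sub_dim_image_inj: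
  assumes "vectorspace class_ring V" "vectorspace class_ring W" "T \<in> module_homs class_ring V W"
    and "vectorspace.fin_dim class_ring V" "inj_on T (carrier V)"
  shows "sub_dim W (T ` carrier V) = vectorspace.dim class_ring V"
proof -
  interpret V: vectorspace class_ring V by fact
  note z = k_linear_zero[OF assms(1-3)]
  have "{x \<in> carrier V. T x = \<zero>\<^bsub>W\<^esub>} = {\<zero>\<^bsub>V\<^esub>}"
  proof (intro subset_antisym subsetI)
    fix x assume "x \<in> {x \<in> carrier V. T x = \<zero>\<^bsub>W\<^esub>}"
    then have "x \<in> carrier V" "T x = T \<zero>\<^bsub>V\<^esub>" using z by simp_all
    then have "x = \<zero>\<^bsub>V\<^esub>" by (intro inj_onD[OF assms(5)] V.module.M.zero_closed)
    then show "x \<in> {\<zero>\<^bsub>V\<^esub>}" by simp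
  qed (use z in simp)
  then show ?thesis using k_rank_nullity[OF assms(1-4)] sub_dim_zero[OF assms(1)] by simp
qed

lemma image_fin_dim:
  assumes "vectorspace class_ring V" "vectorspace class_ring W" "T \<in> module_homs class_ring V W"
    and "vectorspace.fin_dim class_ring V" "T ` carrier V = carrier W"
  shows "vectorspace.fin_dim class_ring W"
proof -
  interpret linear_map class_ring V W T by (rule k_linear_map[OF assms(1-3)])
  show ?thesis by (rule surj_fin_dim[OF assms(4,5)])
qed

lemma k_subspace_sub:
  assumes "k_subspace V U" "k_subspace V W" "U \<subseteq> W"
  shows "k_subspace (V\<lparr>carrier := W\<rparr>) U"
  using assms by (auto simp: k_subspace_def)

lemma sub_dim_mono:
  assumes V: "vectorspace class_ring V" "vectorspace.fin_dim class_ring V"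
    and "k_subspace V U" "k_subspace V W" "U \<subseteq> W"
  shows "sub_dim V U \<le> sub_dim V W" and "sub_dim V U = sub_dim V W \<Longrightarrow> U = W"
  using sub_dim_le(2,3)[OF k_subspace_submodule(3)[OF V(1) assms(4)] sub_dim_le(1)[OF V assms(4)]
      k_subspace_sub[OF assms(3-5)]]
  by (simp_all add: sub_dim_def)

lemma k_subspace_image:
  assumes "vectorspace class_ring V" "vectorspace class_ring W" "T \<in> module_homs class_ring V W"
    "k_subspace V U"
  shows "k_subspace W (T ` U)"
proof -
  interpret V: vectorspace class_ring V by fact
  note T = homD[OF assms(3)] and U = assms(4)[unfolded k_subspace_def]
  show ?thesis
    unfolding k_subspace_def
  proof (intro conjI ballI allI)
    show "T ` U \<subseteq> carrier W" using T(1) U by blast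
    show "\<zero>\<^bsub>W\<^esub> \<in> T ` U" using k_linear_zero[OF assms(1-3)] U by (metis imageI)
  next
    fix x y assume "x \<in> T ` U" "y \<in> T ` U"
    then obtain a b where ab: "a \<in> U" "b \<in> U" "x = T a" "y = T b" by blast
    then have "T (a \<oplus>\<^bsub>V\<^esub> b) = x \<oplus>\<^bsub>W\<^esub> y" using T(2)[of a b] U by blast
    then show "x \<oplus>\<^bsub>W\<^esub> y \<in> T ` U" using ab U by (metis imageI)
  next
    fix c x assume "x \<in> T ` U"
    then obtain a where a: "a \<in> U" "x = T a" by blast
    then have "T (c \<odot>\<^bsub>V\<^esub> a) = c \<odot>\<^bsub>W\<^esub> x" using T(3)[of c a] U by auto
    then show "c \<odot>\<^bsub>W\<^esub> x \<in> T ` U" using a U by (metis imageI)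
  qed
qed

section \<open>The algebra and its opposite\<close>

text \<open>
  Right modules over \<open>\<Lambda>(q)\<close> are left modules over the opposite algebra. What is needed below, the
  multiplication of the powers of the radical, is the same for both, so they are treated together.
\<close>

locale lam_ring =
  fixes R :: "'k::field lam ring" (structure)
  assumes lam_cases: "\<exists>q. R = Lambda q \<or> R = opposite (Lambda q)"

lemma lam_ring_Lambda: "lam_ring (Lambda q)"
  by (auto simp: lam_ring_def)

context lam_ring
begin

lemma lam_ring_opposite: "lam_ring (opposite R)"
  using lam_cases by (metis lam_ring_def opposite_opposite)

lemma ring_R: "ring R"
  using lam_cases ring_Lambda ring_opposite by metis

lemma carrier_R [simp]: "carrier R = UNIV"
  using lam_cases by (auto simp: Lambda_def)

lemma R_simps:
  "\<zero> = Lam 0 0 0 0 0 0" "\<one> = Lam 1 0 0 0 0 0" "a \<oplus> b = lam_add a b"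
  using lam_cases by (auto simp: Lambda_def)

lemma R_mult: obtains q where "mult R = lam_mult q" | q where "mult R = (\<lambda>a b. lam_mult q b a)"
  using lam_cases by (auto simp: Lambda_def)

lemma coord_add [simp]:
  "c_1 (a \<oplus> b) = c_1 a + c_1 b" "c_x (a \<oplus> b) = c_x a + c_x b" "c_y (a \<oplus> b) = c_y a + c_y b"
  "c_z (a \<oplus> b) = c_z a + c_z b" "c_yx (a \<oplus> b) = c_yx a + c_yx b" "c_zx (a \<oplus> b) = c_zx a + c_zx b"
  by (simp_all add: R_simps lam_add_def)

lemma coord_zero [simp]:
  "c_1 \<zero> = 0" "c_x \<zero> = 0" "c_y \<zero> = 0" "c_z \<zero> = 0" "c_yx \<zero> = 0" "c_zx \<zero> = 0"
  by (simp_all add: R_simps)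

lemma coord_mult_1 [simp]: "c_1 (a \<otimes> b) = c_1 a * c_1 b"
  by (rule R_mult) (simp_all add: lam_mult_def mult.commute)

lemma c_1_one [simp]: "c_1 \<one> = 1"
  by (simp add: R_simps)

lemma scalar_mult:
  "lam_scalar c \<otimes> a = Lam (c * c_1 a) (c * c_x a) (c * c_y a) (c * c_z a) (c * c_yx a) (c * c_zx a)"
  "a \<otimes> lam_scalar c = Lam (c * c_1 a) (c * c_x a) (c * c_y a) (c * c_z a) (c * c_yx a) (c * c_zx a)"
  by (rule R_mult; simp add: lam_mult_def lam_scalar_def mult.commute)+

lemma scalar_simps:
  "lam_scalar (c + d) = lam_scalar c \<oplus> lam_scalar d"
  "lam_scalar (c * d) = lam_scalar c \<otimes> lam_scalar d"
  "lam_scalar 1 = \<one>"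
  unfolding scalar_mult(1) by (simp_all add: R_simps lam_scalar_def lam_add_def)

text \<open>These are \<open>J\<close> and \<open>J\<^sup>2\<close>; the latter is the socle on either side.\<close>

definition rad :: "'k lam set" where "rad = {a. c_1 a = 0}"

definition soc :: "'k lam set" where "soc = {a. c_1 a = 0 \<and> c_x a = 0 \<and> c_y a = 0 \<and> c_z a = 0}"

lemma rad_mult_rad: "a \<in> rad \<Longrightarrow> b \<in> rad \<Longrightarrow> a \<otimes> b \<in> soc"
  by (rule R_mult) (simp_all add: lam_mult_def rad_def soc_def)

lemma rad_mult_soc: "a \<in> rad \<Longrightarrow> b \<in> soc \<Longrightarrow> a \<otimes> b = \<zero>"
  by (rule R_mult) (simp_all add: lam_mult_def rad_def soc_def R_simps)

lemma soc_mult_rad: "a \<in> soc \<Longrightarrow> b \<in> rad \<Longrightarrow> a \<otimes> b = \<zero>"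
  by (rule R_mult) (simp_all add: lam_mult_def rad_def soc_def R_simps)

lemma mult_soc: "b \<in> soc \<Longrightarrow> a \<otimes> b = lam_scalar (c_1 a) \<otimes> b"
  unfolding scalar_mult by (rule R_mult) (simp_all add: lam_mult_def soc_def)

lemma soc_mult: "a \<in> soc \<Longrightarrow> a \<otimes> b = lam_scalar (c_1 b) \<otimes> a"
  unfolding scalar_mult by (rule R_mult) (simp_all add: lam_mult_def soc_def)

lemma soc_closed:
  "\<zero> \<in> soc" "a \<in> soc \<Longrightarrow> b \<in> soc \<Longrightarrow> a \<oplus> b \<in> soc" "b \<in> soc \<Longrightarrow> a \<otimes> b \<in> soc" "a \<in> soc \<Longrightarrow> a \<otimes> b \<in> soc"
  using mult_soc[of b a] soc_mult[of a b] by (simp_all add: soc_def scalar_mult)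

lemma rad_closed:
  "\<zero> \<in> rad" "a \<in> rad \<Longrightarrow> b \<in> rad \<Longrightarrow> a \<oplus> b \<in> rad" "b \<in> rad \<Longrightarrow> a \<otimes> b \<in> rad" "a \<in> rad \<Longrightarrow> a \<otimes> b \<in> rad"
  by (simp_all add: rad_def)

lemma inverse_exists:
  assumes "a \<notin> rad"
  shows "\<exists>b. b \<otimes> a = \<one> \<and> a \<otimes> b = \<one>"
proof -
  obtain s x y z e f where a: "a = Lam s x y z e f" by (cases a)
  have s: "s \<noteq> 0" using assms by (simp add: rad_def a)
  \<comment> \<open>The coordinates solve \<open>a b = 1\<close> one after the other; they solve \<open>b a = 1\<close> as well.\<close>
  define b where "b q = Lam (1/s) (-x/s^2) (-y/s^2) (-z/s^2)
    (- (e/s - (1 - q) * x * y / s^2) / s) (- (f/s - (2 * x * z + z * y) / s^2) / s)" for q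
  have inv: "lam_mult q (b q) a = Lam 1 0 0 0 0 0" "lam_mult q a (b q) = Lam 1 0 0 0 0 0" for q
    using s by (simp_all add: lam_mult_def a b_def field_simps power2_eq_square)
  show ?thesis
  proof (rule R_mult)
    fix q assume "mult R = lam_mult q"
    then show ?thesis using inv[of q] by (intro exI[of _ "b q"]) (simp add: R_simps)
  next
    fix q assume "mult R = (\<lambda>a b. lam_mult q b a)"
    then show ?thesis using inv[of q] by (intro exI[of _ "b q"]) (simp add: R_simps)
  qed
qed

section \<open>Dimensions of modules over the algebra\<close>

lemma k_space_simps [simp]:
  "carrier (k_space M) = carrier M" "zero (k_space M) = zero M" "add (k_space M) = add M"
  "smult (k_space M) = (\<lambda>c v. lam_scalar c \<odot>\<^bsub>M\<^esub> v)"
  "(k_space M)\<lparr>carrier := U\<rparr> = k_space (M\<lparr>carrier := U\<rparr>)"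
  by (simp_all add: k_space_def) (simp add: mk_module_def)

lemma k_space_vectorspace:
  assumes "left_module R M" shows "vectorspace class_ring (k_space M)"
proof -
  interpret left_module R M by fact
  have "abelian_group (k_space M)"
  proof (rule abelian_groupI)
    fix x assume "x \<in> carrier (k_space M)"
    then show "\<exists>y \<in> carrier (k_space M). y \<oplus>\<^bsub>k_space M\<^esub> x = \<zero>\<^bsub>k_space M\<^esub>"
      by (intro bexI[of _ "\<ominus>\<^bsub>M\<^esub> x"]) (simp_all add: M.l_neg)
  qed (simp_all add: M.a_ac)
  then have "Module.module class_ring (k_space M)"
    by (intro moduleI class_cring.cring_axioms)
      (simp_all add: scalar_simps smult_closed smult_l_distr smult_r_distr smult_assoc smult_one)
  then show ?thesis
    by (simp add: vectorspace_def class_field)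
qed

lemma hom_k_linear: "f \<in> module_homs R M N \<Longrightarrow> f \<in> module_homs class_ring (k_space M) (k_space N)"
  using homD[of f R M N] by (intro homI) simp_all

lemma submodule_k_subspace: "Module.submodule U R M \<Longrightarrow> k_subspace (k_space M) U"
  using submoduleD[of U R M] by (auto simp: k_subspace_def)

lemma sub_dim_k_space [simp]: "sub_dim (k_space M) U = k_dim (M\<lparr>carrier := U\<rparr>)"
  by (simp add: sub_dim_def k_dim_def)

lemma dim_k_space: "vectorspace.dim class_ring (k_space M) = k_dim M"
  by (simp add: k_dim_def)

lemma hom_rank_nullity:
  assumes "left_module R M" "left_module R N" "f \<in> module_homs R M N" "finite_dimensional M"
  shows "k_dim (N\<lparr>carrier := f ` carrier M\<rparr>) + k_dim (M\<lparr>carrier := a_kernel M N f\<rparr>) = k_dim M"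
  using k_rank_nullity[OF k_space_vectorspace[OF assms(1)] k_space_vectorspace[OF assms(2)]
      hom_k_linear[OF assms(3)]] assms(4)
  by (simp add: finite_dimensional_def k_dim_def a_kernel_def')

lemma surj_finite_dimensional:
  assumes "left_module R M" "left_module R N" "f \<in> module_homs R M N" "finite_dimensional M"
    "f ` carrier M = carrier N"
  shows "finite_dimensional N"
  using image_fin_dim[OF k_space_vectorspace[OF assms(1)] k_space_vectorspace[OF assms(2)]
      hom_k_linear[OF assms(3)]] assms(4,5)
  by (simp add: finite_dimensional_def)

lemma iso_dim:
  assumes "left_module R M" "left_module R N" "module_iso R M N" "finite_dimensional M"
  shows "finite_dimensional N" "k_dim N = k_dim M"
proof -
  obtain f where f: "f \<in> module_homs R M N" "bij_betw f (carrier M) (carrier N)"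
    using assms(3) by (auto simp: module_iso_def)
  then have s: "f ` carrier M = carrier N" "inj_on f (carrier M)" by (auto simp: bij_betw_def)
  show "finite_dimensional N" by (rule surj_finite_dimensional[OF assms(1,2) f(1) assms(4) s(1)])
  show "k_dim N = k_dim M"
    using sub_dim_image_inj[OF k_space_vectorspace[OF assms(1)] k_space_vectorspace[OF assms(2)]
        hom_k_linear[OF f(1)]] s assms(4)
    by (simp add: finite_dimensional_def k_dim_def)
qed

lemma zero_dim:
  assumes "left_module R M" "carrier M = {\<zero>\<^bsub>M\<^esub>}" shows "k_dim M = 0"
  using sub_dim_zero[OF k_space_vectorspace[OF assms(1)]] assms(2)[symmetric] by simp

text \<open>
  The coordinates are numbered from the socle upwards. In this way \<open>R\<^sup>n\<close>, \<open>J\<^sup>n\<close> and \<open>(J\<^sup>2)\<^sup>n\<close> are the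
  subspaces \<open>tails d n\<close> for \<open>d = 6, 5, 2\<close>, and a single count gives their dimensions.
\<close>

definition coord :: "'k lam \<Rightarrow> nat \<Rightarrow> 'k" where
  "coord a j = [c_zx a, c_yx a, c_z a, c_y a, c_x a, c_1 a] ! j"

definition of_coords :: "(nat \<Rightarrow> 'k) \<Rightarrow> 'k lam" where
  "of_coords g = Lam (g 5) (g 4) (g 3) (g 2) (g 1) (g 0)"

definition tails :: "nat \<Rightarrow> nat \<Rightarrow> (nat \<Rightarrow> 'k lam) set" where
  "tails d n = {v \<in> carrier (free_module R n). \<forall>i<n. \<forall>j<6. d \<le> j \<longrightarrow> coord (v i) j = 0}"

lemma less_6: "j < 6 \<longleftrightarrow> j = 0 \<or> j = 1 \<or> j = 2 \<or> j = 3 \<or> j = 4 \<or> j = (5::nat)" by auto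

lemma coord_of_coords: "j < 6 \<Longrightarrow> coord (of_coords g) j = g j"
  by (auto simp: less_6 coord_def of_coords_def nth_Cons')

lemma coords_eqI: "(\<And>j. j < 6 \<Longrightarrow> coord a j = coord b j) \<Longrightarrow> a = b"
proof -
  assume *: "\<And>j. j < 6 \<Longrightarrow> coord a j = coord b j"
  show "a = b"
    using *[of 0] *[of 1] *[of 2] *[of 3] *[of 4] *[of 5]
    by (cases a; cases b) (simp add: coord_def)
qed

lemma coord_linear:
  assumes "j < 6"
  shows "coord (a \<oplus> b) j = coord a j + coord b j" "coord (lam_scalar c \<otimes> a) j = c * coord a j"
    "coord \<zero> j = 0"
  using assms by (auto simp: less_6 coord_def nth_Cons' scalar_mult)

lemma tails_6: "tails 6 n = carrier (free_module R n)"
  by (auto simp: tails_def)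

lemma tails_5: "tails 5 n = {v \<in> carrier (free_module R n). \<forall>i<n. v i \<in> rad}"
proof -
  have "(\<forall>j<6. 5 \<le> j \<longrightarrow> coord a j = 0) \<longleftrightarrow> a \<in> rad" for a
    unfolding less_6 by (auto simp: coord_def rad_def)
  then show ?thesis by (auto simp: tails_def)
qed

lemma tails_2: "tails 2 n = {v \<in> carrier (free_module R n). \<forall>i<n. v i \<in> soc}"
proof -
  have "(\<forall>j<6. 2 \<le> j \<longrightarrow> coord a j = 0) \<longleftrightarrow> a \<in> soc" for a
    unfolding less_6 by (auto simp: coord_def soc_def)
  then show ?thesis by (auto simp: tails_def)
qed

lemma tails_subspace: "k_subspace (k_space (free_module R n)) (tails d n)"
proof -
  interpret F: left_module R "free_module R n" by (rule left_module_free[OF ring_R])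
  show ?thesis
    unfolding k_subspace_def
  proof (intro conjI ballI allI)
    show "tails d n \<subseteq> carrier (k_space (free_module R n))" by (auto simp: tails_def)
    show "\<zero>\<^bsub>k_space (free_module R n)\<^esub> \<in> tails d n"
      using F.M.zero_closed by (simp add: tails_def coord_linear)
  next
    fix v w assume "v \<in> tails d n" "w \<in> tails d n"
    then show "v \<oplus>\<^bsub>k_space (free_module R n)\<^esub> w \<in> tails d n"
      using F.M.a_closed[of v w] by (simp add: tails_def coord_linear)
  next
    fix c v assume "v \<in> tails d n"
    then show "c \<odot>\<^bsub>k_space (free_module R n)\<^esub> v \<in> tails d n"
      using F.smult_closed[of "lam_scalar c" v] by (simp add: tails_def coord_linear)
  qed
qed

lemma tails_dim:
  assumes d: "d \<le> 6"
  shows "sub_dim (k_space (free_module R n)) (tails d n) = d * n"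
    and "d = 6 \<Longrightarrow> finite_dimensional (free_module R n)"
proof -
  let ?V = "module_vec TYPE('k) (d * n)" and ?W = "k_space (free_module R n)"
  interpret vec_space "TYPE('k)" "d * n" .
  have V: "vectorspace class_ring ?V" by (rule vec_vs)
  have W: "vectorspace class_ring ?W" by (rule k_space_vectorspace[OF left_module_free[OF ring_R]])
  define T where "T w = (\<lambda>i\<in>{..<n}. of_coords (\<lambda>j. if j < d then w $ (d * i + j) else 0))" for w :: "'k vec"
  have ix: "d * i + j < d * n" if "i < n" "j < d" for i j
  proof -
    have "d * i + j < d * i + d" using that by simp
    also have "\<dots> = d * Suc i" by simp
    also have "\<dots> \<le> d * n" using that by (intro mult_le_mono2) simp
    finally show ?thesis .
  qed
  have cT: "coord (T w i) j = (if j < d then w $ (d * i + j) else 0)" if "i < n" "j < 6" for w i j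
    using that by (simp add: T_def coord_of_coords)
  have Tc: "T w \<in> carrier (free_module R n)" for w by (auto simp: T_def free_module_simps(1))
  have eqI: "v = w" if "v \<in> carrier (free_module R n)" "w \<in> carrier (free_module R n)"
    "\<And>i j. i < n \<Longrightarrow> j < 6 \<Longrightarrow> coord (v i) j = coord (w i) j" for v w
    using that by (intro free_eqI[of v R n w] coords_eqI) auto
  have T: "T \<in> module_homs class_ring ?V ?W"
  proof (rule homI)
    fix v w :: "'k vec" assume v: "v \<in> carrier ?V" and w: "w \<in> carrier ?V"
    have "T (v + w) = T v \<oplus>\<^bsub>free_module R n\<^esub> T w"
    proof (rule eqI)
      interpret F: left_module R "free_module R n" by (rule left_module_free[OF ring_R])
      show "T v \<oplus>\<^bsub>free_module R n\<^esub> T w \<in> carrier (free_module R n)"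
        by (rule F.M.a_closed[OF Tc Tc])
      fix i j assume "i < n" "j < (6::nat)"
      then show "coord (T (v + w) i) j = coord ((T v \<oplus>\<^bsub>free_module R n\<^esub> T w) i) j"
        using ix[of i j] v w by (simp add: coord_linear cT module_vec_simps)
    qed (rule Tc)
    then show "T (v \<oplus>\<^bsub>?V\<^esub> w) = T v \<oplus>\<^bsub>?W\<^esub> T w" by (simp add: module_vec_simps)
  next
    fix c and v :: "'k vec" assume v: "v \<in> carrier ?V"
    have "T (c \<cdot>\<^sub>v v) = lam_scalar c \<odot>\<^bsub>free_module R n\<^esub> T v"
    proof (rule eqI)
      interpret F: left_module R "free_module R n" by (rule left_module_free[OF ring_R])
      show "lam_scalar c \<odot>\<^bsub>free_module R n\<^esub> T v \<in> carrier (free_module R n)"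
        by (rule F.smult_closed[OF _ Tc]) simp
      fix i j assume "i < n" "j < (6::nat)"
      then show "coord (T (c \<cdot>\<^sub>v v) i) j = coord ((lam_scalar c \<odot>\<^bsub>free_module R n\<^esub> T v) i) j"
        using ix[of i j] v by (simp add: coord_linear cT module_vec_simps)
    qed (rule Tc)
    then show "T (c \<odot>\<^bsub>?V\<^esub> v) = c \<odot>\<^bsub>?W\<^esub> T v" by (simp add: module_vec_simps)
  qed (simp add: Tc)
  have inj: "inj_on T (carrier ?V)"
  proof (rule inj_onI)
    fix v w assume v: "v \<in> carrier ?V" and w: "w \<in> carrier ?V" and e: "T v = T w"
    show "v = w"
    proof (rule eq_vecI)
      fix p assume "p < dim_vec w"
      then have p: "p < d * n" using w by (simp add: module_vec_simps)
      then have "d > 0" by (cases d) auto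
      then have "p mod d < d" "p div d < n" using p by (auto simp: less_mult_imp_div_less mult.commute)
      then show "v $ p = w $ p"
        using cT[of "p div d" "p mod d" v] cT[of "p div d" "p mod d" w] e d by simp
    qed (use v w in \<open>simp add: module_vec_simps\<close>)
  qed
  have im: "T ` carrier ?V = tails d n"
  proof (intro subset_antisym subsetI)
    fix u assume "u \<in> T ` carrier ?V"
    then show "u \<in> tails d n" using Tc cT by (auto simp: tails_def)
  next
    fix u assume u: "u \<in> tails d n"
    let ?w = "Matrix.vec (d * n) (\<lambda>p. coord (u (p div d)) (p mod d))"
    have "u = T ?w"
    proof (rule eqI)
      fix i j assume ij: "i < n" "j < (6::nat)"
      show "coord (u i) j = coord (T ?w i) j"
      proof (cases "j < d")
        case True
        then have "(d * i + j) div d = i" "(d * i + j) mod d = j" by auto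
        then show ?thesis using True ij ix[OF ij(1) True] by (simp add: cT)
      next
        case False
        then show ?thesis using u ij by (simp add: cT tails_def)
      qed
    qed (use u Tc in \<open>auto simp: tails_def\<close>)
    moreover have "?w \<in> carrier ?V" by (simp add: module_vec_simps)
    ultimately show "u \<in> T ` carrier ?V" by (rule image_eqI)
  qed
  show "sub_dim ?W (tails d n) = d * n"
    using sub_dim_image_inj[OF V W T fin_dim inj] im dim_is_n by simp
  assume "d = 6"
  then have "T ` carrier ?V = carrier ?W" using im tails_6[of n] by simp
  then show "finite_dimensional (free_module R n)"
    using image_fin_dim[OF V W T fin_dim] by (simp add: finite_dimensional_def)
qed

lemma free_dim:
  "finite_dimensional (free_module R n)" "k_dim (free_module R n) = 6 * n"
  using tails_dim[of 6 n] by (simp_all add: tails_6)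

lemma submodule_dim:
  assumes "left_module R M" "finite_dimensional M" "Module.submodule U R M"
  shows "finite_dimensional (M\<lparr>carrier := U\<rparr>)" "k_dim (M\<lparr>carrier := U\<rparr>) \<le> k_dim M"
  using sub_dim_le(1,2)[OF k_space_vectorspace[OF assms(1)] _ submodule_k_subspace[OF assms(3)]] assms(2)
  by (simp_all add: finite_dimensional_def dim_k_space)

lemma finite_dimensional_fin_gen:
  assumes M: "left_module R M" and fd: "finite_dimensional M"
  shows "fin_gen R M"
proof -
  interpret V: vectorspace class_ring "k_space M" by (rule k_space_vectorspace[OF M])
  obtain B where B: "finite B" "B \<subseteq> carrier M" "V.span B = carrier M"
    using fd by (auto simp: finite_dimensional_def V.fin_dim_def)
  obtain x where x: "bij_betw x {0..<card B} B" using ex_bij_betw_nat_finite[OF B(1)] by blast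
  let ?n = "card B" and ?F = "free_module R (card B)"
  have xc: "x i \<in> carrier M" if "i < ?n" for i using x B(2) that by (auto simp: bij_betw_def)
  let ?f = "lin_comb M ?n x"
  have f: "?f \<in> module_homs R ?F M" by (rule lin_comb_hom[OF M xc])
  have sub: "Module.submodule (?f ` carrier ?F) R M"
    by (rule submodule_image[OF f left_module_free[OF ring_R] M submodule_carrier[OF left_module_free[OF ring_R]]])
  have "B \<subseteq> ?f ` carrier ?F"
  proof
    fix b assume "b \<in> B"
    then have "b \<in> x ` {0..<?n}" using x by (simp add: bij_betw_def)
    then obtain i where i: "i < ?n" "b = x i" by auto
    then have "b = ?f (unit_fam R ?n i)" using lin_comb_unit[OF M xc i(1)] by simp
    then show "b \<in> ?f ` carrier ?F" using unit_fam_closed[OF ring_R] by (rule image_eqI)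
  qed
  then have "V.span B \<subseteq> ?f ` carrier ?F"
    using V.span_is_subset k_subspace_submodule(1)[OF k_space_vectorspace[OF M] submodule_k_subspace[OF sub]]
    by simp
  then have "?f ` carrier ?F = carrier M" using B(3) submoduleD(1)[OF sub] by auto
  then show ?thesis using f unfolding fin_gen_def by blast
qed

lemma noetherian_R: "noetherian R"
  unfolding noetherian_def
  by (intro allI impI finite_dimensional_fin_gen left_module_submodule submodule_dim(1)
      left_module_free ring_R free_dim(1))

section \<open>Projective covers and cyclic modules\<close>

lemma left_free: "left_module R (free_module R n)"
  by (rule left_module_free[OF ring_R])

lemma left_regular: "left_module R (regular_module R)"
  by (rule left_module_regular[OF ring_R])

lemma submodule_finsum:
  assumes "left_module R M" "Module.submodule U R M" "\<And>i. i < n \<Longrightarrow> x i \<in> U"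
  shows "finsum M x {..<n::nat} \<in> U"
  using assms(3)
proof (induction n)
  case 0
  interpret left_module R M by fact
  show ?case using submoduleD(2)[OF assms(2)] by simp
next
  case (Suc n)
  interpret left_module R M by fact
  note U = submoduleD[OF assms(2)]
  have "finsum M x {..<Suc n} = x n \<oplus>\<^bsub>M\<^esub> finsum M x {..<n}"
    using Suc.prems U(1) unfolding lessThan_Suc by (subst M.finsum_insert) (auto simp: Pi_def)
  then show ?case using Suc U(3) by simp
qed

text \<open>
  The condition that relations have coefficients in \<open>J\<close> means that the number of generators is
  the least possible.
\<close>

definition minimal_generation :: "('k lam, 'm) module \<Rightarrow> nat \<Rightarrow> ((nat \<Rightarrow> 'k lam) \<Rightarrow> 'm) \<Rightarrow> bool" where
  "minimal_generation M n f \<longleftrightarrow> f \<in> module_homs R (free_module R n) M \<and>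
     f ` carrier (free_module R n) = carrier M \<and>
     (\<forall>v \<in> carrier (free_module R n). f v = \<zero>\<^bsub>M\<^esub> \<longrightarrow> (\<forall>i<n. v i \<in> rad))"

lemma minimal_generationD:
  assumes "minimal_generation M n f"
  shows "f \<in> module_homs R (free_module R n) M" "f ` carrier (free_module R n) = carrier M"
    "\<And>v i. v \<in> carrier (free_module R n) \<Longrightarrow> f v = \<zero>\<^bsub>M\<^esub> \<Longrightarrow> i < n \<Longrightarrow> v i \<in> rad"
  using assms by (auto simp: minimal_generation_def)

text \<open>In a relation with a unit coefficient the corresponding generator is redundant.\<close>

lemma minimal_generation_exists:
  assumes M: "left_module R M" and "fin_gen R M"
  shows "\<exists>n f. minimal_generation M n f"
proof -
  interpret R: ring R by (rule ring_R)
  define P where "P n \<longleftrightarrow> (\<exists>f \<in> module_homs R (free_module R n) M. f ` carrier (free_module R n) = carrier M)" for n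
  have "\<exists>n. P n" using assms(2) by (simp add: P_def fin_gen_def)
  then have PL: "P (LEAST n. P n)" by (rule LeastI_ex)
  then obtain n f where n: "n = (LEAST n. P n)" and f: "f \<in> module_homs R (free_module R n) M"
    "f ` carrier (free_module R n) = carrier M" by (auto simp: P_def)
  have "v i \<in> rad" if v: "v \<in> carrier (free_module R n)" "f v = \<zero>\<^bsub>M\<^esub>" and i: "i < n" for v i
  proof (rule ccontr)
    assume "v i \<notin> rad"
    then obtain b where b: "b \<otimes> v i = \<one>" using inverse_exists by blast
    obtain m where m: "n = Suc m" using i by (cases n) auto
    let ?F = "free_module R n" and ?G = "free_module R m"
    interpret F: left_module R ?F by (rule left_free)
    interpret M: left_module R M by fact
    define g where "g w = (\<lambda>j\<in>{..<n}. if j < i then w j else if j = i then \<zero> else w (j - 1))"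
      for w :: "nat \<Rightarrow> 'k lam"
    have gc: "g w \<in> carrier ?F" for w by (auto simp: g_def free_module_simps(1))
    have g: "g \<in> module_homs R ?G ?F"
    proof (rule homI)
      fix w w' assume "w \<in> carrier ?G" "w' \<in> carrier ?G"
      have "j - 1 < m" if "j < n" "\<not> j < i" "j \<noteq> i" for j using that m by auto
      then show "g (w \<oplus>\<^bsub>?G\<^esub> w') = g w \<oplus>\<^bsub>?F\<^esub> g w'" using i m by (auto simp: g_def)
    next
      fix r w assume "w \<in> carrier ?G"
      have "j - 1 < m" if "j < n" "\<not> j < i" "j \<noteq> i" for j using that m by auto
      then show "g (r \<odot>\<^bsub>?G\<^esub> w) = r \<odot>\<^bsub>?F\<^esub> g w" using i m by (auto simp: g_def)
    qed (rule gc)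
    have "carrier M \<subseteq> (f \<circ> g) ` carrier ?G"
    proof
      fix y assume "y \<in> carrier M"
      then obtain a where a: "a \<in> carrier ?F" "y = f a" using f(2) by blast
      define a' where "a' = a \<oplus>\<^bsub>?F\<^esub> (\<ominus> (a i \<otimes> b)) \<odot>\<^bsub>?F\<^esub> v"
      have a'c: "a' \<in> carrier ?F" using a(1) v(1) unfolding a'_def by (intro F.M.a_closed F.smult_closed) auto
      have cv: "(\<ominus> (a i \<otimes> b)) \<odot>\<^bsub>?F\<^esub> v \<in> carrier ?F" using v(1) by (intro F.smult_closed) auto
      have "f ((\<ominus> (a i \<otimes> b)) \<odot>\<^bsub>?F\<^esub> v) = \<zero>\<^bsub>M\<^esub>"
        using homD(3)[OF f(1) _ v(1), of "\<ominus> (a i \<otimes> b)"] v(2) M.smult_r_null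
        by (simp del: free_module_simps)
      then have "f a' = f a"
        unfolding a'_def homD(2)[OF f(1) a(1) cv] using homD(1)[OF f(1) a(1)] by simp
      moreover have "a' i = a i \<oplus> (\<ominus> (a i \<otimes> (b \<otimes> v i)))"
        using i unfolding a'_def by (simp add: R.l_minus R.m_assoc)
      then have a'i: "a' i = \<zero>" using b by (simp add: R.r_neg)
      define w where "w = (\<lambda>j\<in>{..<m}. if j < i then a' j else a' (Suc j))"
      have w: "w \<in> carrier ?G" by (auto simp: w_def free_module_simps(1))
      have "g w = a'"
      proof (rule free_eqI[OF gc a'c])
        fix j assume "j < n"
        then show "g w j = a' j" using a'i i m by (auto simp: g_def w_def)
      qed
      ultimately show "y \<in> (f \<circ> g) ` carrier ?G" using a(2) w by (intro image_eqI[of _ _ w]) auto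
    qed
    moreover have fg: "f \<circ> g \<in> module_homs R ?G M" by (rule hom_comp[OF g f(1)])
    ultimately have "(f \<circ> g) ` carrier ?G = carrier M" using homD(1)[OF fg] by auto
    then have "P m" using fg unfolding P_def by blast
    then have "n \<le> m" unfolding n by (rule Least_le)
    then show False using m by simp
  qed
  then show ?thesis using f by (auto simp: minimal_generation_def)
qed

lemma minimal_generation_nonzero:
  assumes "minimal_generation M n f" "left_module R M" "carrier M \<noteq> {\<zero>\<^bsub>M\<^esub>}"
  shows "n \<noteq> 0"
proof
  assume "n = 0"
  then have "carrier (free_module R n) = {\<zero>\<^bsub>free_module R n\<^esub>}" by (auto simp: free_module_simps(1))
  then have "carrier M = {f \<zero>\<^bsub>free_module R n\<^esub>}"
    using minimal_generationD(2)[OF assms(1)] by (metis image_empty image_insert)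
  then show False
    using assms(3) hom_zero[OF minimal_generationD(1)[OF assms(1)] left_free assms(2)] by simp
qed

lemma lin_comb_soc:
  assumes "\<And>i. i < n \<Longrightarrow> v i \<otimes> x i \<in> soc"
  shows "lin_comb (regular_module R) n x v \<in> soc"
  unfolding lin_comb_def
proof (rule submodule_finsum[OF left_regular])
  show "Module.submodule soc R (regular_module R)"
    by (rule submoduleI[OF left_regular]) (simp_all add: soc_closed)
qed (simp add: assms)

text \<open>
  Nakayama's lemma in the form needed for covers: if every unit vector is congruent to an element
  of \<open>U\<close> modulo \<open>J\<^sup>n\<close>, then \<open>U\<close> contains first \<open>(J\<^sup>2)\<^sup>n\<close>, then \<open>J\<^sup>n\<close>, then everything.
\<close>

lemma minimal_generation_cover:
  assumes M: "left_module R M" and mg: "minimal_generation M n f"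
  shows "projective_cover R (free_module R n) f M"
  unfolding projective_cover_def
proof (intro conjI allI impI)
  let ?F = "free_module R n"
  interpret F: left_module R ?F by (rule left_free)
  show "projective R ?F" by (rule projective_free[OF ring_R])
  show "f \<in> module_homs R ?F M" "f ` carrier ?F = carrier M"
    using minimal_generationD[OF mg] by auto
  fix U assume "Module.submodule U R ?F \<and> U <+>\<^bsub>?F\<^esub> a_kernel ?F M f = carrier ?F"
  then have U: "Module.submodule U R ?F" and sum: "U <+>\<^bsub>?F\<^esub> a_kernel ?F M f = carrier ?F" by auto
  note Us = submoduleD[OF U]
  have "\<exists>u k. u \<in> U \<and> k \<in> a_kernel ?F M f \<and> unit_fam R n i = u \<oplus>\<^bsub>?F\<^esub> k" for i
  proof -
    have "unit_fam R n i \<in> U <+>\<^bsub>?F\<^esub> a_kernel ?F M f" unfolding sum by (rule unit_fam_closed[OF ring_R])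
    then show ?thesis unfolding set_add_def' by blast
  qed
  then obtain u k where u: "\<And>i. u i \<in> U" and k: "\<And>i. k i \<in> a_kernel ?F M f"
    and uk: "\<And>i. unit_fam R n i = u i \<oplus>\<^bsub>?F\<^esub> k i" by metis
  have kc: "k i \<in> carrier ?F" for i using k[of i] by simp
  have kr: "k i l \<in> rad" if "l < n" for i l
    using minimal_generationD(3)[OF mg kc, of i l] k[of i] that by simp
  have uc: "u i \<in> carrier ?F" for i using u Us(1) by blast
  have step: "v \<in> U" if v: "v \<in> carrier ?F" and vk: "\<And>i. i < n \<Longrightarrow> v i \<odot>\<^bsub>?F\<^esub> k i \<in> U" for v
  proof -
    have "finsum ?F (\<lambda>i. v i \<odot>\<^bsub>?F\<^esub> unit_fam R n i) {..<n} \<in> U"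
    proof (rule submodule_finsum[OF left_free U])
      fix i assume i: "i < n"
      have "v i \<odot>\<^bsub>?F\<^esub> unit_fam R n i = v i \<odot>\<^bsub>?F\<^esub> u i \<oplus>\<^bsub>?F\<^esub> v i \<odot>\<^bsub>?F\<^esub> k i"
        unfolding uk using uc kc by (intro F.smult_r_distr) simp_all
      moreover have "v i \<odot>\<^bsub>?F\<^esub> u i \<in> U" by (rule Us(4)[OF _ u]) simp
      ultimately show "v i \<odot>\<^bsub>?F\<^esub> unit_fam R n i \<in> U" using Us(3) vk[OF i] by metis
    qed
    then show ?thesis using free_expansion[OF ring_R v] by (simp add: lin_comb_def)
  qed
  have sm: "a \<odot>\<^bsub>?F\<^esub> k i \<in> carrier ?F" for a i using kc by (intro F.smult_closed) simp_all
  have 1: "v \<in> U" if v: "v \<in> carrier ?F" "\<And>i. i < n \<Longrightarrow> v i \<in> soc" for v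
  proof (rule step[OF v(1)])
    fix i assume i: "i < n"
    have "v i \<odot>\<^bsub>?F\<^esub> k i = \<zero>\<^bsub>?F\<^esub>"
      using soc_mult_rad[OF v(2)[OF i] kr] by auto
    then show "v i \<odot>\<^bsub>?F\<^esub> k i \<in> U" using Us(2) by simp
  qed
  have 2: "v \<in> U" if v: "v \<in> carrier ?F" "\<And>i. i < n \<Longrightarrow> v i \<in> rad" for v
  proof (rule step[OF v(1)])
    fix i assume "i < n"
    then show "v i \<odot>\<^bsub>?F\<^esub> k i \<in> U"
      using rad_mult_rad[OF v(2) kr] by (intro 1 sm) auto
  qed
  have 3: "v \<in> U" if v: "v \<in> carrier ?F" for v
  proof (rule step[OF v])
    fix i
    show "v i \<odot>\<^bsub>?F\<^esub> k i \<in> U" using rad_closed(3)[OF kr] by (intro 2 sm) auto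
  qed
  show "U = carrier ?F" using 3 Us(1) by blast
qed

definition cyclic :: "('k lam, 'm) module \<Rightarrow> bool" where
  "cyclic M \<longleftrightarrow> (\<exists>x \<in> carrier M. carrier M = (\<lambda>r. r \<odot>\<^bsub>M\<^esub> x) ` UNIV)"

lemma minimal_generation_cyclic:
  assumes "left_module R M" "minimal_generation M 1 f"
  shows "cyclic M"
proof -
  interpret left_module R M by fact
  note f = minimal_generationD[OF assms(2)]
  let ?F = "free_module R 1" and ?e = "unit_fam R 1 0"
  have ec: "?e \<in> carrier ?F" by (rule unit_fam_closed[OF ring_R])
  have fe: "f ?e \<in> carrier M" by (rule homD(1)[OF f(1) ec])
  have "carrier M \<subseteq> (\<lambda>r. r \<odot>\<^bsub>M\<^esub> f ?e) ` UNIV"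
  proof
    fix y assume "y \<in> carrier M"
    then obtain v where v: "v \<in> carrier ?F" "y = f v" using f(2) by blast
    have "f v = f (v 0 \<odot>\<^bsub>?F\<^esub> ?e)" by (rule arg_cong[OF free_1_eq[OF ring_R v(1)]])
    then have "f v = v 0 \<odot>\<^bsub>M\<^esub> f ?e" using homD(3)[OF f(1) _ ec, of "v 0"] by simp
    then show "y \<in> (\<lambda>r. r \<odot>\<^bsub>M\<^esub> f ?e) ` UNIV" using v(2) by blast
  qed
  then show ?thesis using fe unfolding cyclic_def by (intro bexI[of _ "f ?e"]) (auto simp: smult_closed)
qed

text \<open>
  In a cyclic module \<open>R x\<close> every proper submodule lies in \<open>J x\<close>, since an element \<open>a x\<close> with \<open>a\<close>
  outside \<open>J\<close> generates the module.
\<close>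

lemma cyclic_local:
  assumes M: "left_module R M" and cyc: "cyclic M" and nz: "carrier M \<noteq> {\<zero>\<^bsub>M\<^esub>}"
  shows "local_module R M"
proof -
  interpret left_module R M by fact
  obtain x where x: "x \<in> carrier M" "carrier M = (\<lambda>r. r \<odot>\<^bsub>M\<^esub> x) ` UNIV"
    using cyc by (auto simp: cyclic_def)
  define J where "J = (\<lambda>r. r \<odot>\<^bsub>M\<^esub> x) ` rad"
  have as: "(a \<otimes> b) \<odot>\<^bsub>M\<^esub> x = a \<odot>\<^bsub>M\<^esub> (b \<odot>\<^bsub>M\<^esub> x)" for a b using x(1) by (simp add: smult_assoc)
  have dist: "(a \<oplus> b) \<odot>\<^bsub>M\<^esub> x = a \<odot>\<^bsub>M\<^esub> x \<oplus>\<^bsub>M\<^esub> b \<odot>\<^bsub>M\<^esub> x" for a b using x(1) by (simp add: smult_l_distr)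
  have J: "Module.submodule J R M"
  proof (rule submoduleI[OF M])
    show "\<zero>\<^bsub>M\<^esub> \<in> J" unfolding J_def using rad_closed(1) x(1) smult_l_null[OF x(1)] by (metis imageI)
  next
    fix u v assume "u \<in> J" "v \<in> J"
    then obtain a b where ab: "a \<in> rad" "b \<in> rad" "u = a \<odot>\<^bsub>M\<^esub> x" "v = b \<odot>\<^bsub>M\<^esub> x" by (auto simp: J_def)
    then have "u \<oplus>\<^bsub>M\<^esub> v = (a \<oplus> b) \<odot>\<^bsub>M\<^esub> x" by (simp add: dist)
    then show "u \<oplus>\<^bsub>M\<^esub> v \<in> J" unfolding J_def using rad_closed(2)[OF ab(1,2)] by (rule image_eqI)
  next
    fix r u assume "u \<in> J"
    then obtain a where a: "a \<in> rad" "u = a \<odot>\<^bsub>M\<^esub> x" by (auto simp: J_def)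
    then have "r \<odot>\<^bsub>M\<^esub> u = (r \<otimes> a) \<odot>\<^bsub>M\<^esub> x" by (simp add: as)
    then show "r \<odot>\<^bsub>M\<^esub> u \<in> J" unfolding J_def using rad_closed(3)[OF a(1)] by (rule image_eqI)
  qed (use x in \<open>auto simp: J_def\<close>)
  have gen: "U = carrier M" if U: "Module.submodule U R M" "x \<in> U" for U
    using submoduleD[OF U(1)] U(2) x(2) by auto
  have inJ: "U \<subseteq> J" if U: "Module.submodule U R M" "U \<noteq> carrier M" for U
  proof
    fix u assume u: "u \<in> U"
    then obtain a where a: "u = a \<odot>\<^bsub>M\<^esub> x" using submoduleD(1)[OF U(1)] x(2) by blast
    show "u \<in> J"
    proof (cases "a \<in> rad")
      case False
      then obtain b where "b \<otimes> a = \<one>" using inverse_exists by blast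
      then have "b \<odot>\<^bsub>M\<^esub> u = x" using a x(1) by (simp add: as[symmetric] smult_one)
      then have "x \<in> U" using submoduleD(4)[OF U(1) _ u, of b] by simp
      then show ?thesis using gen U by blast
    qed (auto simp: J_def a)
  qed
  have J_proper: "J \<noteq> carrier M"
  proof
    assume "J = carrier M"
    then obtain a where a: "a \<in> rad" "x = a \<odot>\<^bsub>M\<^esub> x" using x(1) by (auto simp: J_def)
    have "\<ominus> a \<oplus> \<one> \<notin> rad"
    proof
      assume "\<ominus> a \<oplus> \<one> \<in> rad"
      then have "a \<oplus> (\<ominus> a \<oplus> \<one>) \<in> rad" by (rule rad_closed(2)[OF a(1)])
      moreover have "a \<oplus> (\<ominus> a \<oplus> \<one>) = \<one>" by (simp add: R.a_assoc[symmetric] R.r_neg)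
      ultimately show False by (simp add: rad_def)
    qed
    then obtain b where b: "b \<otimes> (\<ominus> a \<oplus> \<one>) = \<one>" using inverse_exists by blast
    have "(\<ominus> a \<oplus> \<one>) \<odot>\<^bsub>M\<^esub> x = \<zero>\<^bsub>M\<^esub>"
      using a(2)[symmetric] x(1) by (simp add: dist smult_l_minus smult_one M.l_neg)
    then have "b \<odot>\<^bsub>M\<^esub> ((\<ominus> a \<oplus> \<one>) \<odot>\<^bsub>M\<^esub> x) = \<zero>\<^bsub>M\<^esub>" by simp
    then have "x = \<zero>\<^bsub>M\<^esub>" using b x(1) by (simp add: as[symmetric] smult_one)
    then have "carrier M = {\<zero>\<^bsub>M\<^esub>}" using x(2) by auto
    then show False using nz by simp
  qed
  have maxJ: "maximal_submodule R U M \<longleftrightarrow> U = J" for U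
    unfolding maximal_submodule_def using J J_proper inJ by blast
  have rad: "radical R M = J"
    unfolding radical_def using maxJ submoduleD(1)[OF J] by auto
  note q = quotient_projection[OF M J]
  let ?Q = "quotient_module M J" and ?p = "\<lambda>x. a_r_coset M J x"
  interpret Q: left_module R ?Q by (rule q(1))
  have xJ: "x \<notin> J" using gen[OF J] J_proper by blast
  have "simple_module R ?Q"
    unfolding simple_module_def
  proof (intro conjI allI impI)
    have "?p x \<noteq> \<zero>\<^bsub>?Q\<^esub>" using q(4)[OF x(1)] xJ by blast
    moreover have "?p x \<in> carrier ?Q" by (rule homD(1)[OF q(2) x(1)])
    ultimately show "carrier ?Q \<noteq> {\<zero>\<^bsub>?Q\<^esub>}" by blast
  next
    fix V assume V: "Module.submodule V R ?Q"
    note Vs = submoduleD[OF V]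
    define W where "W = {y \<in> carrier M. ?p y \<in> V}"
    have W: "Module.submodule W R M"
    proof (rule submoduleI[OF M])
      show "\<zero>\<^bsub>M\<^esub> \<in> W" using hom_zero[OF q(2) M q(1)] Vs(2) by (simp add: W_def)
    next
      fix y z assume "y \<in> W" "z \<in> W"
      then show "y \<oplus>\<^bsub>M\<^esub> z \<in> W" using homD(2)[OF q(2), of y z] Vs(3)[of "?p y" "?p z"] by (simp add: W_def)
    next
      fix r y assume "y \<in> W"
      then show "r \<odot>\<^bsub>M\<^esub> y \<in> W"
        using homD(3)[OF q(2), of r y] Vs(4)[of r "?p y"] by (simp add: W_def smult_closed)
    qed (simp add: W_def)
    have VW: "V = ?p ` W"
    proof (intro subset_antisym subsetI)
      fix X assume X: "X \<in> V"
      then have "X \<in> ?p ` carrier M" unfolding q(3) using Vs(1) by blast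
      then show "X \<in> ?p ` W" using X by (auto simp: W_def)
    qed (auto simp: W_def)
    show "V = {\<zero>\<^bsub>?Q\<^esub>} \<or> V = carrier ?Q"
    proof (cases "W = carrier M")
      case True
      then show ?thesis using VW q(3) by simp
    next
      case False
      then have "W \<subseteq> J" by (rule inJ[OF W])
      have "X = \<zero>\<^bsub>?Q\<^esub>" if "X \<in> V" for X
      proof -
        have "X \<in> ?p ` W" using that VW by (simp only:)
        then obtain y where "y \<in> W" "X = ?p y" by (rule imageE)
        then show ?thesis using q(4)[of y] \<open>W \<subseteq> J\<close> by (auto simp: W_def)
      qed
      then show ?thesis using Vs(2) by blast
    qed
  qed
  then show ?thesis by (simp add: local_module_def rad)
qed

text \<open>
  A projective module covering a cyclic module is cyclic, hence a retract \<open>R a\<close> of \<open>R\<close> with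
  \<open>a\<^sup>2 = a\<close>; since \<open>R\<close> is local, \<open>a = 1\<close> or \<open>a = 0\<close>.
\<close>

lemma cyclic_cover_iso:
  fixes P :: "('k lam, 'p) module"
  assumes M: "left_module R M" and cyc: "cyclic M" and nz: "carrier M \<noteq> {\<zero>\<^bsub>M\<^esub>}"
    and cov: "projective_cover R P \<pi> M"
  shows "module_iso R (free_module R 1) P"
proof -
  have P: "projective R P" and pi: "\<pi> \<in> module_homs R P M" "\<pi> ` carrier P = carrier M"
    and ess: "\<And>U. Module.submodule U R P \<Longrightarrow> set_add P U (a_kernel P M \<pi>) = carrier P \<Longrightarrow> U = carrier P"
    using cov by (auto simp: projective_cover_def)
  note PL = projective_left_module[OF P]
  interpret M: left_module R M by fact
  interpret P: left_module R P by (rule PL)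
  interpret R: ring R by (rule ring_R)
  obtain x where x: "x \<in> carrier M" "carrier M = (\<lambda>r. r \<odot>\<^bsub>M\<^esub> x) ` UNIV"
    using cyc by (auto simp: cyclic_def)
  have "x \<in> \<pi> ` carrier P" unfolding pi(2) by (rule x(1))
  then obtain p where p: "p \<in> carrier P" "\<pi> p = x" by blast
  let ?F = "free_module R 1"
  interpret F: left_module R ?F by (rule left_free)
  define \<theta> where "\<theta> v = v 0 \<odot>\<^bsub>P\<^esub> p" for v :: "nat \<Rightarrow> 'k lam"
  have th: "\<theta> \<in> module_homs R ?F P"
    using p(1) by (intro homI) (auto simp: \<theta>_def P.smult_closed P.smult_l_distr P.smult_assoc)
  have one: "(\<lambda>i\<in>{..<1::nat}. r) \<in> carrier ?F" for r
    by (auto simp: free_module_simps(1))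
  have sub: "Module.submodule (\<theta> ` carrier ?F) R P"
    by (rule submodule_image[OF th left_free PL submodule_carrier[OF left_free]])
  have "set_add P (\<theta> ` carrier ?F) (a_kernel P M \<pi>) = carrier P"
  proof (intro subset_antisym subsetI)
    fix y assume "y \<in> set_add P (\<theta> ` carrier ?F) (a_kernel P M \<pi>)"
    then show "y \<in> carrier P" using submoduleD(1)[OF sub] by (auto simp: set_add_def')
  next
    fix y assume y: "y \<in> carrier P"
    have "\<pi> y \<in> carrier M" by (rule homD(1)[OF pi(1) y])
    then obtain r where r: "\<pi> y = r \<odot>\<^bsub>M\<^esub> x" using x(2) by blast
    let ?t = "r \<odot>\<^bsub>P\<^esub> p"
    have t: "?t \<in> carrier P" using p(1) by (simp add: P.smult_closed)
    have "\<pi> ?t = \<pi> y" using homD(3)[OF pi(1) _ p(1), of r] p(2) r by simp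
    then have k: "y \<oplus>\<^bsub>P\<^esub> (\<ominus>\<^bsub>P\<^esub> ?t) \<in> a_kernel P M \<pi>"
      using hom_eq_iff_diff[OF pi(1) PL M y t] by simp
    have "\<theta> (\<lambda>i\<in>{..<1::nat}. r) = ?t" by (simp add: \<theta>_def)
    then have t': "?t \<in> \<theta> ` carrier ?F" using one by (metis imageI)
    have "y = ?t \<oplus>\<^bsub>P\<^esub> (y \<oplus>\<^bsub>P\<^esub> (\<ominus>\<^bsub>P\<^esub> ?t))"
      using y t by (simp add: P.M.a_ac P.M.r_neg)
    then show "y \<in> set_add P (\<theta> ` carrier ?F) (a_kernel P M \<pi>)"
      using t' k unfolding set_add_def' by blast
  qed
  then have surj: "\<theta> ` carrier ?F = carrier P" by (rule ess[OF sub])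
  obtain s where s: "s \<in> module_homs R P ?F" "\<forall>y \<in> carrier P. \<theta> (s y) = y"
    using projective_lift[OF P left_free PL th surj hom_id[OF PL]] by blast
  define a where "a = s p 0"
  have sp: "s p \<in> carrier ?F" by (rule homD(1)[OF s(1) p(1)])
  have sth: "s (\<theta> v) 0 = v 0 \<otimes> a" if "v \<in> carrier ?F" for v
    using homD(3)[OF s(1) _ p(1), of "v 0"] by (simp add: \<theta>_def a_def)
  have "a \<otimes> a = a"
  proof -
    have "s (\<theta> (s p)) 0 = a \<otimes> a" using sth[OF sp] by (simp add: a_def)
    moreover have "\<theta> (s p) = p" using s(2) p(1) by blast
    ultimately show ?thesis by (simp add: a_def)
  qed
  have a1: "a \<notin> rad"
  proof
    assume ar: "a \<in> rad"
    have "a \<otimes> a \<in> soc" by (rule rad_mult_rad[OF ar ar])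
    then have "a \<in> soc" using \<open>a \<otimes> a = a\<close> by simp
    then have "a \<otimes> a = \<zero>" by (rule rad_mult_soc[OF ar])
    then have a0: "a = \<zero>" using \<open>a \<otimes> a = a\<close> by simp
    have "p = \<theta> (s p)" using s(2) p(1) by simp
    also have "\<dots> = a \<odot>\<^bsub>P\<^esub> p" by (simp add: \<theta>_def a_def)
    finally have "p = \<zero>\<^bsub>P\<^esub>" using a0 p(1) by simp
    then have "x = \<zero>\<^bsub>M\<^esub>" using hom_zero[OF pi(1) PL M] p(2) by simp
    then show False using nz x(2) by auto
  qed
  have "inj_on \<theta> (carrier ?F)"
  proof (rule hom_inj_onI[OF th left_free PL])
    fix v assume v: "v \<in> carrier ?F" "\<theta> v = \<zero>\<^bsub>P\<^esub>"
    obtain b where b: "a \<otimes> b = \<one>" using inverse_exists[OF a1] by blast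
    have "v 0 \<otimes> a = \<zero>" using sth[OF v(1)] v(2) hom_zero[OF s(1) PL left_free] by simp
    then have "v 0 \<otimes> (a \<otimes> b) = \<zero>" by (simp add: M.R.m_assoc[symmetric])
    then have "v 0 = \<zero>" using b by simp
    then show "v = \<zero>\<^bsub>?F\<^esub>" using v(1) F.M.zero_closed by (intro free_eqI[of v R 1]) auto
  qed
  then show ?thesis using th surj unfolding module_iso_def bij_betw_def by blast
qed

section \<open>Counting dimensions\<close>

text \<open>
  If all homomorphisms \<open>U \<rightarrow> R\<close> extend along \<open>j : U \<rightarrow> R\<^sup>t\<close>, then so do those with values in \<open>J\<^sup>2\<close>, of
  which there are as many as linear maps \<open>U/JU \<rightarrow> J\<^sup>2\<close>. As \<open>j\<close> maps to \<open>J\<^sup>t\<close>, the elements of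
  \<open>(J\<^sup>2)\<^sup>t\<close> do not contribute, whereas some coordinate function does not have values in \<open>J\<^sup>2\<close>.
\<close>

lemma extension_bound:
  fixes U :: "('k lam, 'u) module"
  assumes U: "left_module R U" and mg: "minimal_generation U n f"
    and j: "j \<in> module_homs R U (free_module R t)"
    and jrad: "\<And>x l. x \<in> carrier U \<Longrightarrow> l < t \<Longrightarrow> j x l \<in> rad"
    and ext: "\<And>\<phi>. \<phi> \<in> module_homs R U (regular_module R) \<Longrightarrow>
      \<exists>a \<in> carrier (free_module R t). \<forall>x \<in> carrier U. \<phi> x = pairing R t (j x) a"
    and nsoc: "x \<in> carrier U" "l < t" "j x l \<notin> soc"
  shows "2 * n + 1 \<le> 4 * t"
proof -
  interpret R: ring R by (rule ring_R)
  interpret O: lam_ring "opposite R" by (rule lam_ring_opposite)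
  let ?O = "opposite R"
  let ?V = "free_module ?O t" and ?W = "free_module ?O n"
  note f = minimal_generationD[OF mg]
  define T where "T a = (\<lambda>i\<in>{..<n}. pairing R t (j (f (unit_fam R n i))) a)" for a
  have fe: "f (unit_fam R n i) \<in> carrier U" for i by (rule homD(1)[OF f(1) unit_fam_closed[OF ring_R]])
  have je: "j (f (unit_fam R n i)) \<in> carrier (free_module R t)" for i by (rule homD(1)[OF j fe])
  have T: "T \<in> module_homs ?O ?V ?W"
  proof (rule homI)
    fix a b assume "a \<in> carrier ?V" "b \<in> carrier ?V"
    then show "T (a \<oplus>\<^bsub>?V\<^esub> b) = T a \<oplus>\<^bsub>?W\<^esub> T b"
      using homD(2)[OF pairing_hom_right[OF ring_R je]] by (auto simp: T_def)
  next
    fix r a assume "a \<in> carrier ?V"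
    then show "T (r \<odot>\<^bsub>?V\<^esub> a) = r \<odot>\<^bsub>?W\<^esub> T a"
      using homD(3)[OF pairing_hom_right[OF ring_R je]] by (auto simp: T_def)
  qed (auto simp: T_def free_module_simps(1))
  note Vs = O.k_space_vectorspace[OF O.left_free[of t]] and Ws = O.k_space_vectorspace[OF O.left_free[of n]]
  have Tk: "T \<in> module_homs class_ring (k_space ?V) (k_space ?W)" by (rule O.hom_k_linear[OF T])
  have fdV: "vectorspace.fin_dim class_ring (k_space ?V)" and fdW: "vectorspace.fin_dim class_ring (k_space ?W)"
    using O.free_dim by (simp_all add: finite_dimensional_def)
  let ?im = "T ` carrier ?V" and ?ker = "{a \<in> carrier ?V. T a = \<zero>\<^bsub>?W\<^esub>}"
  have rn: "sub_dim (k_space ?W) ?im + sub_dim (k_space ?V) ?ker = 6 * t"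
    using k_rank_nullity[OF Vs Ws Tk fdV] O.free_dim(2)[of t] O.dim_k_space[of ?V] by simp
  have imsub: "k_subspace (k_space ?W) ?im"
    by (rule O.submodule_k_subspace[OF submodule_image[OF T O.left_free O.left_free submodule_carrier[OF O.left_free]]])
  have kersub: "k_subspace (k_space ?V) ?ker"
    using O.submodule_k_subspace[OF submodule_kernel[OF T O.left_free O.left_free]] by (simp add: a_kernel_def')

  have kersup: "O.tails 2 t \<subseteq> ?ker"
  proof
    fix a assume "a \<in> O.tails 2 t"
    then have a: "a \<in> carrier ?V" "\<And>l. l < t \<Longrightarrow> a l \<in> soc" by (auto simp: O.tails_2)
    have "pairing R t (j (f (unit_fam R n i))) a = \<zero>" for i
      by (rule pairing_eq_zero[OF ring_R rad_mult_soc[OF jrad[OF fe] a(2)]])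
    then show "a \<in> ?ker" using a(1) by (auto simp: T_def)
  qed
  have ker: "2 * t \<le> sub_dim (k_space ?V) ?ker"
    using sub_dim_mono(1)[OF Vs fdV O.tails_subspace kersub kersup] O.tails_dim(1)[of 2 t] by simp
  have sub: "O.tails 2 n \<subseteq> ?im"
  proof
    fix w assume "w \<in> O.tails 2 n"
    then have w: "w \<in> carrier (free_module R n)" "\<And>i. i < n \<Longrightarrow> w i \<in> soc" by (auto simp: O.tails_2)
    have "pairing R n v w = \<zero>" if v: "v \<in> carrier (free_module R n)" "f v = \<zero>\<^bsub>U\<^esub>" for v
      by (rule pairing_eq_zero[OF ring_R rad_mult_soc[OF f(3)[OF v] w(2)]])
    then obtain \<phi> where \<phi>: "\<phi> \<in> module_homs R U (regular_module R)"
      "\<forall>v \<in> carrier (free_module R n). \<phi> (f v) = pairing R n v w"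
      using hom_factor[OF f(1) pairing_hom_left[OF ring_R w(1)] left_free U left_regular f(2)] by auto
    obtain a where a: "a \<in> carrier (free_module R t)" "\<forall>x \<in> carrier U. \<phi> x = pairing R t (j x) a"
      using ext[OF \<phi>(1)] by blast
    have "T a = w"
    proof (rule free_eqI[of _ ?O n])
      show "T a \<in> carrier ?W" by (auto simp: T_def free_module_simps(1))
      fix i assume i: "i < n"
      have "w i = pairing R n (unit_fam R n i) w" by (rule pairing_unit_left[OF ring_R w(1) i, symmetric])
      also have "\<dots> = \<phi> (f (unit_fam R n i))" by (rule bspec[OF \<phi>(2) unit_fam_closed[OF ring_R], symmetric])
      also have "\<dots> = pairing R t (j (f (unit_fam R n i))) a" by (rule bspec[OF a(2) fe])
      finally show "T a i = w i" using i by (simp add: T_def)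
    qed (use w in simp)
    then show "w \<in> ?im" using a(1) by auto
  qed
  have "?im \<noteq> O.tails 2 n"
  proof
    assume eq: "?im = O.tails 2 n"
    have je_soc: "j (f (unit_fam R n i)) l \<in> soc" if "i < n" for i
    proof -
      have "T (unit_fam R t l) \<in> O.tails 2 n"
        unfolding eq[symmetric] using unit_fam_closed[OF ring_R] by simp
      then have "T (unit_fam R t l) i \<in> soc" using that by (simp add: O.tails_2)
      then show ?thesis using pairing_unit_right[OF ring_R je nsoc(2)] that by (simp add: T_def)
    qed
    obtain v where v: "v \<in> carrier (free_module R n)" "x = f v" using f(2) nsoc(1) by blast
    have h: "(\<lambda>v. v l) \<circ> (j \<circ> f) \<in> module_homs R (free_module R n) (regular_module R)"
      by (rule hom_comp[OF hom_comp[OF f(1) j] free_coord_hom[OF nsoc(2)]])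
    have "j x l = lin_comb (regular_module R) n (\<lambda>i. j (f (unit_fam R n i)) l) v"
      using hom_free_eq[OF h left_regular v(1)] v(2) by simp
    also have "\<dots> \<in> soc" by (intro lin_comb_soc soc_closed(3) je_soc)
    finally show False using nsoc(3) by simp
  qed
  then have "2 * n + 1 \<le> sub_dim (k_space ?W) ?im"
    using sub_dim_mono[OF Ws fdW O.tails_subspace imsub sub] O.tails_dim(1)[of 2 n] by fastforce
  then show ?thesis using rn ker by simp
qed

text \<open>
  With \<open>t\<close> generators for \<open>M\<close> and \<open>n\<close> for \<open>U = \<Omega>M\<close>, there are the bounds \<open>6 t - dim M \<le> n + 2 t\<close>
  and \<open>2 n + 1 \<le> 4 t\<close>. They give \<open>4 t + 1 \<le> 2 dim M\<close>, so \<open>t = 1\<close> and \<open>dim M = 3\<close>.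
\<close>

lemma Ext1_vanishing_cyclic:
  fixes M :: "('k lam, 'm) module"
  assumes M: "left_module R M" "finite_dimensional M" "carrier M \<noteq> {\<zero>\<^bsub>M\<^esub>}" "k_dim M \<le> 3"
    and ext: "Ext_vanishes R 1 M (regular_module R)"
  shows "cyclic M" "k_dim M = 3"
proof -
  interpret R: ring R by (rule ring_R)
  obtain t p where mg: "minimal_generation M t p"
    using minimal_generation_exists[OF M(1) finite_dimensional_fin_gen[OF M(1,2)]] by blast
  note p = minimal_generationD[OF mg]
  let ?F = "free_module R t" and ?K = "a_kernel (free_module R t) M p"
  let ?U = "?F\<lparr>carrier := ?K\<rparr>"
  interpret F: left_module R ?F by (rule left_free)
  have Ksub: "Module.submodule ?K R ?F" by (rule submodule_kernel[OF p(1) left_free M(1)])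
  have U: "left_module R ?U" by (rule left_module_submodule[OF left_free Ksub])
  have fdU: "finite_dimensional ?U" by (rule submodule_dim(1)[OF left_free free_dim(1) Ksub])
  obtain n f where mgU: "minimal_generation ?U n f"
    using minimal_generation_exists[OF U finite_dimensional_fin_gen[OF U fdU]] by blast
  note f = minimal_generationD[OF mgU]
  have t0: "t \<noteq> 0" by (rule minimal_generation_nonzero[OF mg M(1,3)])
  have dimU: "k_dim M + k_dim ?U = 6 * t"
  proof -
    have "M\<lparr>carrier := p ` carrier ?F\<rparr> = M" unfolding p(2) by simp
    then show ?thesis using hom_rank_nullity[OF left_free M(1) p(1) free_dim(1)] free_dim(2)[of t] by simp
  qed
  have Krad: "v l \<in> rad" if "v \<in> ?K" "l < t" for v l using p(3)[of v l] that by simp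
  note se = short_exact_kernel[OF left_free M(1) p(1,2)]
  have incl: "(\<lambda>v. v) \<in> module_homs R ?U ?F" using se by (simp add: short_exact_def)
  have extU: "\<exists>a \<in> carrier ?F. \<forall>v \<in> carrier ?U. \<phi> v = pairing R t v a"
    if \<phi>: "\<phi> \<in> module_homs R ?U (regular_module R)" for \<phi>
  proof -
    obtain g where g: "g \<in> module_homs R ?F (regular_module R)" "\<forall>v \<in> carrier ?U. g v = \<phi> v"
      using Ext1_extend[OF se projective_free[OF ring_R] ext noetherian_R
          finite_dimensional_fin_gen[OF U fdU] left_regular \<phi>] by blast
    have "\<forall>v \<in> carrier ?U. \<phi> v = pairing R t v (\<lambda>i\<in>{..<t}. g (unit_fam R t i))"
      using g(2) hom_free_pairing[OF ring_R g(1)] by simp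
    moreover have "(\<lambda>i\<in>{..<t}. g (unit_fam R t i)) \<in> carrier ?F" by (auto simp: free_module_simps(1))
    ultimately show ?thesis by blast
  qed
  note Fv = k_space_vectorspace[OF left_free[of t]]
  have fdF: "vectorspace.fin_dim class_ring (k_space ?F)"
    using free_dim by (simp add: finite_dimensional_def)
  have nsoc: "\<exists>v \<in> ?K. \<exists>l<t. v l \<notin> soc"
  proof (rule ccontr)
    assume "\<not> ?thesis"
    then have "?K \<subseteq> tails 2 t" by (auto simp: tails_2)
    then have "k_dim ?U \<le> 2 * t"
      using sub_dim_mono(1)[OF Fv fdF submodule_k_subspace[OF Ksub] tails_subspace, of 2] tails_dim(1)[of 2 t] by simp
    then show False using dimU M(4) t0 by simp
  qed
  then have nt: "2 * n + 1 \<le> 4 * t"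
    using extension_bound[OF U mgU incl _ extU] Krad by auto
  have "k_dim ?U \<le> n + 2 * t"
  proof -
    \<comment> \<open>The relations between the generators lie in \<open>J\<^sup>n\<close>, and \<open>J\<^sup>n\<close> is mapped to \<open>(J\<^sup>2)\<^sup>t\<close>.\<close>
    let ?G = "free_module R n"
    note Gv = k_space_vectorspace[OF left_free[of n]]
    have fdG: "vectorspace.fin_dim class_ring (k_space ?G)"
      using free_dim by (simp add: finite_dimensional_def)
    have fF: "f \<in> module_homs R ?G ?F"
      by (rule hom_codomain_extend[OF f(1) submoduleD(1)[OF Ksub]])
    let ?ker = "a_kernel ?G ?F f"
    have kerU: "a_kernel ?G ?U f = ?ker" by (simp add: a_kernel_def')
    have kersub: "Module.submodule ?ker R ?G" by (rule submodule_kernel[OF fF left_free left_free])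
    have 1: "k_dim ?U + k_dim (?G\<lparr>carrier := ?ker\<rparr>) = 6 * n"
    proof -
      have "?F\<lparr>carrier := f ` carrier ?G\<rparr> = ?U" using f(2) by simp
      then show ?thesis
        using hom_rank_nullity[OF left_free left_free fF free_dim(1)] free_dim(2)[of n] by simp
    qed
    let ?J = "tails 5 n"
    have Jsub: "k_subspace (k_space ?G) ?J" by (rule tails_subspace)
    have kJ: "?ker \<subseteq> ?J" using f(3) by (auto simp: tails_5)
    let ?JJ = "(k_space ?G)\<lparr>carrier := ?J\<rparr>"
    have JJ: "vectorspace class_ring ?JJ" "vectorspace.fin_dim class_ring ?JJ"
      by (rule k_subspace_submodule(3)[OF Gv Jsub], rule sub_dim_le(1)[OF Gv fdG Jsub])
    have JG: "?J \<subseteq> carrier ?G" by (auto simp: tails_def)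
    have fJ: "f \<in> module_homs class_ring ?JJ (k_space ?F)"
      using homD[OF hom_k_linear[OF fF]] JG by (intro homI) (auto simp: subset_iff)
    have "sub_dim (k_space ?F) (f ` ?J) + sub_dim ?JJ {x \<in> ?J. f x = \<zero>\<^bsub>?F\<^esub>} = 5 * n"
      using k_rank_nullity[OF JJ(1) Fv fJ JJ(2)] tails_dim(1)[of 5 n] by (simp add: sub_dim_def)
    moreover have "{x \<in> ?J. f x = \<zero>\<^bsub>?F\<^esub>} = ?ker" using kJ JG by auto
    ultimately have 2: "sub_dim (k_space ?F) (f ` ?J) + k_dim (?G\<lparr>carrier := ?ker\<rparr>) = 5 * n"
      by (simp add: sub_dim_def k_dim_def)
    have "f ` ?J \<subseteq> tails 2 t"
    proof
      fix y assume "y \<in> f ` ?J"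
      then obtain v where v: "v \<in> carrier ?G" "\<And>i. i < n \<Longrightarrow> v i \<in> rad" "y = f v" by (auto simp: tails_5)
      have yc: "y \<in> carrier ?F" using homD(1)[OF fF v(1)] v(3) by simp
      have "y l \<in> soc" if l: "l < t" for l
      proof -
        have h: "(\<lambda>v. v l) \<circ> f \<in> module_homs R ?G (regular_module R)"
          by (rule hom_comp[OF fF free_coord_hom[OF l]])
        have fK: "f (unit_fam R n i) l \<in> rad" for i
          using homD(1)[OF f(1) unit_fam_closed[OF ring_R], of i] Krad[OF _ l] by simp
        have "y l = lin_comb (regular_module R) n (\<lambda>i. f (unit_fam R n i) l) v"
          using hom_free_eq[OF h left_regular v(1)] v(3) by simp
        also have "\<dots> \<in> soc" by (intro lin_comb_soc rad_mult_rad fK v(2))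
        finally show ?thesis .
      qed
      then show "y \<in> tails 2 t" using yc by (simp add: tails_2)
    qed
    then have "sub_dim (k_space ?F) (f ` ?J) \<le> 2 * t"
      using sub_dim_mono(1)[OF Fv fdF _ tails_subspace] tails_dim(1)[of 2 t]
        k_subspace_image[OF JJ(1) Fv fJ, of ?J] k_subspace_sub[OF Jsub Jsub] by fastforce
    then show ?thesis using 1 2 by simp
  qed
  then have "4 * t + 1 \<le> 2 * k_dim M" using nt dimU by linarith
  then have "t = 1" "k_dim M = 3" using M(4) t0 by linarith+
  then show "k_dim M = 3" "cyclic M" using minimal_generation_cyclic[OF M(1)] mg by auto
qed

lemma k_dim_pos_nonzero:
  assumes "left_module R M" "k_dim M \<noteq> 0"
  shows "carrier M \<noteq> {\<zero>\<^bsub>M\<^esub>}"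
  using zero_dim[OF assms(1)] assms(2) by auto

section \<open>Syzygies\<close>

text \<open>The property which is handed on from a module to its syzygy.\<close>

definition semi_GP_3 :: "('k lam, 'm) module \<Rightarrow> bool" where
  "semi_GP_3 M \<longleftrightarrow> left_module R M \<and> finite_dimensional M \<and> k_dim M = 3 \<and>
     semi_Gorenstein_projective R M"

lemma semi_GP_dim_3:
  fixes M :: "('k lam, 'm) module"
  assumes "left_module R M" "finite_dimensional M" "carrier M \<noteq> {\<zero>\<^bsub>M\<^esub>}" "k_dim M \<le> 3"
    "semi_Gorenstein_projective R M"
  shows "semi_GP_3 M" "cyclic M" "local_module R M"
proof -
  have "Ext_vanishes R 1 M (regular_module R)"
    using assms(5) unfolding semi_Gorenstein_projective_def by blast
  note c = Ext1_vanishing_cyclic[OF assms(1-4) this]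
  show "semi_GP_3 M" using assms c by (simp add: semi_GP_3_def)
  show "cyclic M" by (rule c)
  show "local_module R M" by (rule cyclic_local[OF assms(1) c(1) assms(3)])
qed

lemma semi_GP_3_facts:
  assumes "semi_GP_3 M"
  shows "cyclic M" "local_module R M" "carrier M \<noteq> {\<zero>\<^bsub>M\<^esub>}"
proof -
  have M: "left_module R M" "finite_dimensional M" "k_dim M = 3" "semi_Gorenstein_projective R M"
    using assms by (auto simp: semi_GP_3_def)
  then have "carrier M \<noteq> {\<zero>\<^bsub>M\<^esub>}" by (intro k_dim_pos_nonzero) simp_all
  then show "cyclic M" "local_module R M" "carrier M \<noteq> {\<zero>\<^bsub>M\<^esub>}"
    using semi_GP_dim_3[of M] M by simp_all
qed

lemma semi_GP_3_iso:
  assumes "semi_GP_3 M" "left_module R N" "module_iso R N M"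
  shows "semi_GP_3 N"
proof -
  have M: "left_module R M" "finite_dimensional M" "k_dim M = 3" "semi_Gorenstein_projective R M"
    using assms(1) by (auto simp: semi_GP_3_def)
  note iso = module_iso_sym[OF assms(3,2)]
  show ?thesis
    using iso_dim[OF M(1) assms(2) iso M(2)] M(3) semi_Gorenstein_projective_iso[OF assms(3,2) M(1,4)] assms(2)
    by (simp add: semi_GP_3_def)
qed

text \<open>
  The projective cover of a cyclic module is \<open>R\<close>, so the kernel has dimension \<open>6 - 3\<close>.
\<close>

lemma semi_GP_3_cover_kernel:
  fixes M :: "('k lam, 'm) module" and P :: "'k lam fgmodule"
  assumes S: "semi_GP_3 M" and cov: "projective_cover R P \<pi> M"
  shows "semi_GP_3 (P\<lparr>carrier := a_kernel P M \<pi>\<rparr>)"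
proof -
  have M: "left_module R M" "finite_dimensional M" "k_dim M = 3" "semi_Gorenstein_projective R M"
    using S by (auto simp: semi_GP_3_def)
  have P: "projective R P" and pi: "\<pi> \<in> module_homs R P M" "\<pi> ` carrier P = carrier M"
    using cov by (auto simp: projective_cover_def)
  note PL = projective_left_module[OF P]
  let ?K = "a_kernel P M \<pi>"
  let ?U = "P\<lparr>carrier := ?K\<rparr>"
  have Ksub: "Module.submodule ?K R P" by (rule submodule_kernel[OF pi(1) PL M(1)])
  have U: "left_module R ?U" by (rule left_module_submodule[OF PL Ksub])
  note iso = cyclic_cover_iso[OF M(1) semi_GP_3_facts(1,3)[OF S] cov]
  have dP: "finite_dimensional P" "k_dim P = 6"
    using iso_dim[OF left_free PL iso free_dim(1)] free_dim(2)[of 1] by simp_all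
  have "M\<lparr>carrier := \<pi> ` carrier P\<rparr> = M" unfolding pi(2) by simp
  then have "k_dim ?U = 3" using hom_rank_nullity[OF PL M(1) pi(1) dP(1)] dP(2) M(3) by simp
  moreover have "finite_dimensional ?U" by (rule submodule_dim(1)[OF PL dP(1) Ksub])
  moreover have "semi_Gorenstein_projective R ?U"
    by (rule semi_Gorenstein_projective_kernel[OF short_exact_kernel[OF PL M(1) pi] P M(4)])
  ultimately show ?thesis using U by (simp add: semi_GP_3_def)
qed

lemma semi_GP_3_Omega:
  assumes "semi_GP_3 M"
  shows "is_Omega R M N \<Longrightarrow> semi_GP_3 N" and "\<exists>N :: 'k lam fgmodule. is_Omega R M N"
proof -
  assume "is_Omega R M N"
  then obtain P :: "'k lam fgmodule" and \<pi> where "projective_cover R P \<pi> M" "left_module R N"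
    "module_iso R N (P\<lparr>carrier := a_kernel P M \<pi>\<rparr>)" by (auto simp: is_Omega_def)
  then show "semi_GP_3 N" using semi_GP_3_iso[OF semi_GP_3_cover_kernel[OF assms]] by blast
next
  have M: "left_module R M" "finite_dimensional M" using assms by (auto simp: semi_GP_3_def)
  obtain n f where "minimal_generation M n f"
    using minimal_generation_exists[OF M(1) finite_dimensional_fin_gen[OF M]] by blast
  then have cov: "projective_cover R (free_module R n) f M" by (rule minimal_generation_cover[OF M(1)])
  let ?U = "(free_module R n)\<lparr>carrier := a_kernel (free_module R n) M f\<rparr>"
  have U: "left_module R ?U"
    using semi_GP_3_cover_kernel[OF assms cov] by (simp add: semi_GP_3_def)
  have "module_iso R ?U ?U"
    unfolding module_iso_def using hom_id[OF U] by (intro bexI[of _ "\<lambda>x. x"]) (auto simp: bij_betw_def)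
  then show "\<exists>N :: 'k lam fgmodule. is_Omega R M N" using U cov unfolding is_Omega_def by blast
qed

lemma fgmodule_copy:
  assumes M: "left_module R M" "finite_dimensional M"
  shows "\<exists>N :: 'k lam fgmodule. left_module R N \<and> module_iso R N M"
proof -
  obtain n f where f: "f \<in> module_homs R (free_module R n) M" "f ` carrier (free_module R n) = carrier M"
    using finite_dimensional_fin_gen[OF M] by (auto simp: fin_gen_def)
  let ?F = "free_module R n"
  have sub: "Module.submodule (a_kernel ?F M f) R ?F" by (rule submodule_kernel[OF f(1) left_free M(1)])
  obtain N :: "'k lam fgmodule" and c where N: "left_module R N" "c \<in> module_homs R ?F N"
    "c ` carrier ?F = carrier N" "\<forall>x \<in> carrier ?F. c x = \<zero>\<^bsub>N\<^esub> \<longleftrightarrow> x \<in> a_kernel ?F M f"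
    using quotient_copy[OF left_free sub] by blast
  then have "module_iso R N M"
    using iso_of_same_kernel[OF N(2) f(1) left_free N(1) M(1) N(3) f(2)] unfolding module_iso_def by auto
  then show ?thesis using N(1) by blast
qed

theorem semi_GP_3_Omega_pow:
  fixes M :: "('k lam, 'm) module"
  assumes "semi_GP_3 M"
  shows "(\<exists>N. is_Omega_pow R t M N) \<and> (\<forall>N. is_Omega_pow R t M N \<longrightarrow> semi_GP_3 N)"
proof (induction t)
  case 0
  have M: "left_module R M" "finite_dimensional M" using assms by (auto simp: semi_GP_3_def)
  show ?case using fgmodule_copy[OF M] semi_GP_3_iso[OF assms] by auto
next
  case (Suc t)
  then obtain K where K: "is_Omega_pow R t M K" "semi_GP_3 K" by blast
  obtain N :: "'k lam fgmodule" where "is_Omega R K N" using semi_GP_3_Omega(2)[OF K(2)] by blast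
  then have "is_Omega_pow R (Suc t) M N" using K(1) by auto
  moreover have "semi_GP_3 N" if "is_Omega_pow R (Suc t) M N" for N
    using that Suc semi_GP_3_Omega(1) by auto
  ultimately show ?case by blast
qed

section \<open>Approximations of reflexive modules of dimension at most three\<close>

lemma regular_dim:
  "finite_dimensional (regular_module R)" "k_dim (regular_module R) = 6"
proof -
  have "module_iso R (free_module R 1) (regular_module R)"
    unfolding module_iso_def
  proof (intro bexI[of _ "\<lambda>v. v 0"] free_coord_hom)
    have "inj_on (\<lambda>v. v 0) (carrier (free_module R 1))"
      by (intro inj_onI free_eqI[of _ R 1]) auto
    moreover have "a \<in> (\<lambda>v. v 0) ` carrier (free_module R 1)" for a
      by (rule image_eqI[of _ _ "\<lambda>i\<in>{..<1}. a"]) (auto simp: free_module_simps(1))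
    ultimately show "bij_betw (\<lambda>v. v 0) (carrier (free_module R 1)) (carrier (regular_module R))"
      by (auto simp: bij_betw_def)
  qed simp
  from iso_dim[OF left_free left_regular this free_dim(1)] free_dim(2)[of 1]
  show "finite_dimensional (regular_module R)" "k_dim (regular_module R) = 6" by simp_all
qed

lemma inj_image_dim:
  assumes "left_module R M" "left_module R N" "f \<in> module_homs R M N" "finite_dimensional M"
    "inj_on f (carrier M)"
  shows "k_dim (N\<lparr>carrier := f ` carrier M\<rparr>) = k_dim M"
  using sub_dim_image_inj[OF k_space_vectorspace[OF assms(1)] k_space_vectorspace[OF assms(2)]
      hom_k_linear[OF assms(3)]] assms(4,5)
  by (simp add: finite_dimensional_def k_dim_def)

text \<open>
  The right module \<open>M\<^sup>*\<close> is generated by the monomorphism \<open>F\<close>; in other words, \<open>F\<close> is an injective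
  left \<open>add(R)\<close>-approximation of \<open>M\<close>.
\<close>

definition left_generates_dual :: "('k lam, 'm) module \<Rightarrow> ('m \<Rightarrow> 'k lam) \<Rightarrow> bool" where
  "left_generates_dual M F \<longleftrightarrow> F \<in> module_homs R M (regular_module R) \<and> inj_on F (carrier M) \<and>
     (\<forall>g \<in> module_homs R M (regular_module R). \<exists>r. \<forall>x \<in> carrier M. g x = F x \<otimes> r)"

text \<open>
  Let \<open>f\<^sub>1, \<dots>, f\<^sub>p\<close> be a minimal system of generators of the right module \<open>M\<^sup>*\<close>. For each
  \<open>w\<close> in \<open>(J\<^sup>2)\<^sup>p\<close> there is a homomorphism \<open>M\<^sup>* \<rightarrow> R\<close> sending \<open>f\<^sub>i\<close> to \<open>w\<^sub>i\<close>, because the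
  relations have coefficients in \<open>J\<close>. By reflexivity it is the evaluation at an element of \<open>M\<close>. So
  \<open>x \<mapsto> (f\<^sub>1 x, \<dots>, f\<^sub>p x)\<close> embeds \<open>M\<close> in \<open>R\<^sup>p\<close> with an image containing \<open>(J\<^sup>2)\<^sup>p\<close>, and \<open>2 p \<le> 3\<close>.
\<close>

lemma reflexive_left_generates_dual:
  fixes M :: "('k lam, 'm) module"
  assumes M: "left_module R M" "finite_dimensional M" "carrier M \<noteq> {\<zero>\<^bsub>M\<^esub>}" "k_dim M \<le> 3"
    and refl: "reflexive_module R M"
  shows "\<exists>F. left_generates_dual M F \<and> soc \<subseteq> F ` carrier M"
proof -
  interpret M: left_module R M by (rule M(1))
  interpret O: lam_ring "opposite R" by (rule lam_ring_opposite)
  let ?O = "opposite R" and ?D = "dual R M"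
  have D: "left_module ?O ?D" by (rule left_module_dual[OF M(1)])
  obtain a \<pi> where pi: "\<pi> \<in> module_homs R (free_module R a) M" "\<pi> ` carrier (free_module R a) = carrier M"
    using finite_dimensional_fin_gen[OF M(1,2)] by (auto simp: fin_gen_def)
  have "fin_gen ?O ?D"
    by (rule fin_gen_embedded[OF O.noetherian_R D dual_embedding(1,2)[OF M(1) pi]])
  then obtain p f where mg: "O.minimal_generation ?D p f"
    using O.minimal_generation_exists[OF D] by blast
  note f = O.minimal_generationD[OF mg]
  let ?G = "free_module ?O p" and ?e = "unit_fam R p"
  have fc: "f v \<in> carrier ?D" if "v \<in> carrier (free_module R p)" for v
    using homD(1)[OF f(1)] that by simp
  have u: "?e i \<in> carrier (free_module R p)" for i by (rule unit_fam_closed[OF ring_R])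
  define F where "F x = (\<lambda>i\<in>{..<p}. f (?e i) x)" for x
  have fv: "f v x = pairing R p (F x) v" if "v \<in> carrier (free_module R p)" "x \<in> carrier M" for v x
  proof -
    have "(\<lambda>v. f v x) \<in> module_homs ?O ?G (regular_module ?O)"
      using homD[OF f(1)] that(2) by (intro homI) (simp_all add: restrict_def)
    from hom_free_pairing_opposite[OF ring_R this that(1)] show ?thesis by (simp add: F_def)
  qed
  have fh: "g \<in> module_homs R M (regular_module R)" if "g \<in> carrier ?D" for g
    using that by (simp add: HomD(1))
  have F: "F \<in> module_homs R M (free_module R p)"
  proof (rule homI)
    fix x y assume "x \<in> carrier M" "y \<in> carrier M"
    then show "F (x \<oplus>\<^bsub>M\<^esub> y) = F x \<oplus>\<^bsub>free_module R p\<^esub> F y"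
      using homD(2)[OF fh[OF fc[OF u]]] by (auto simp: F_def)
  next
    fix r x assume "x \<in> carrier M"
    then show "F (r \<odot>\<^bsub>M\<^esub> x) = r \<odot>\<^bsub>free_module R p\<^esub> F x"
      using homD(3)[OF fh[OF fc[OF u]]] by (auto simp: F_def)
  qed (auto simp: F_def free_module_simps(1))
  have gF: "\<exists>v \<in> carrier (free_module R p). \<forall>x \<in> carrier M. g x = pairing R p (F x) v"
    if g: "g \<in> module_homs R M (regular_module R)" for g
  proof -
    have "restrict g (carrier M) \<in> f ` carrier ?G" unfolding f(2) by (rule dual_mem[OF M(1) g])
    then obtain v where v: "v \<in> carrier (free_module R p)" "restrict g (carrier M) = f v" by auto
    have "g x = f v x" if "x \<in> carrier M" for x using fun_cong[OF v(2), of x] that by simp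
    then show ?thesis using fv v(1) by auto
  qed
  have F_inj: "inj_on F (carrier M)"
  proof (rule hom_inj_onI[OF F M(1) left_free])
    fix x assume x: "x \<in> carrier M" "F x = \<zero>\<^bsub>free_module R p\<^esub>"
    have "g x = \<zero>" if g: "g \<in> carrier ?D" for g
    proof -
      obtain v where v: "v \<in> carrier (free_module R p)" "g x = pairing R p (F x) v"
        using gF[OF fh[OF g]] x(1) by blast
      then show ?thesis
        using hom_zero[OF pairing_hom_left[OF ring_R v(1)] left_free left_regular] x(2) by simp
    qed
    then show "x = \<zero>\<^bsub>M\<^esub>" using refl x(1) unfolding reflexive_module_def by blast
  qed
  have soc: "tails 2 p \<subseteq> F ` carrier M"
  proof
    fix w assume "w \<in> tails 2 p"
    then have w: "w \<in> carrier (free_module R p)" "\<And>i. i < p \<Longrightarrow> w i \<in> soc" by (auto simp: tails_2)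
    have "pairing R p w v = \<zero>" if v: "v \<in> carrier ?G" "f v = \<zero>\<^bsub>?D\<^esub>" for v
      by (rule pairing_eq_zero[OF ring_R soc_mult_rad[OF w(2) f(3)[OF v]]])
    then obtain \<phi> where \<phi>: "\<phi> \<in> module_homs ?O ?D (regular_module ?O)"
      "\<forall>v \<in> carrier ?G. \<phi> (f v) = pairing R p w v"
      using hom_factor[OF f(1) pairing_hom_right[OF ring_R w(1)] O.left_free D O.left_regular f(2)] by auto
    obtain x where x: "x \<in> carrier M" "\<forall>g \<in> carrier ?D. \<phi> g = g x"
      using refl \<phi>(1) unfolding reflexive_module_def by blast
    have "w = F x"
    proof (rule free_eqI[OF w(1) homD(1)[OF F x(1)]])
      fix i assume i: "i < p"
      have "w i = pairing R p w (?e i)" by (rule pairing_unit_right[OF ring_R w(1) i, symmetric])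
      also have "\<dots> = \<phi> (f (?e i))" using \<phi>(2) u[of i] by simp
      also have "\<dots> = f (?e i) x" by (rule bspec[OF x(2) fc[OF u]])
      finally show "w i = F x i" using i by (simp add: F_def)
    qed
    then show "w \<in> F ` carrier M" using x(1) by (rule image_eqI)
  qed
  note Fv = k_space_vectorspace[OF left_free[of p]]
  have fdF: "vectorspace.fin_dim class_ring (k_space (free_module R p))"
    using free_dim by (simp add: finite_dimensional_def)
  have imsub: "k_subspace (k_space (free_module R p)) (F ` carrier M)"
    by (rule submodule_k_subspace[OF submodule_image[OF F M(1) left_free submodule_carrier[OF M(1)]]])
  have "2 * p \<le> k_dim M"
    using sub_dim_mono(1)[OF Fv fdF tails_subspace imsub soc] tails_dim(1)[of 2 p]
      inj_image_dim[OF M(1) left_free F M(2) F_inj] by simp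
  moreover have "p \<noteq> 0"
  proof
    assume "p = 0"
    then have "F x = \<zero>\<^bsub>free_module R p\<^esub>" for x by (auto simp: F_def)
    then have "x = \<zero>\<^bsub>M\<^esub>" if "x \<in> carrier M" for x using inj_onD[OF F_inj, of x "\<zero>\<^bsub>M\<^esub>"] that by simp
    then show False using M(3) M.M.zero_closed by blast
  qed
  ultimately have p: "p = 1" using M(4) by linarith
  have p1: "pairing R p w v = w 0 \<otimes> v 0" if "w \<in> carrier (free_module R p)" "v \<in> carrier (free_module R p)" for v w
  proof -
    interpret L: left_module R "regular_module R" by (rule left_regular)
    show ?thesis by (simp add: pairing_def lin_comb_def p lessThan_Suc)
  qed
  have inj0: "inj_on (\<lambda>x. F x 0) (carrier M)"
  proof (rule inj_onI)
    fix x y assume xy: "x \<in> carrier M" "y \<in> carrier M" "F x 0 = F y 0"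
    have "F x = F y"
      by (rule free_eqI[OF homD(1)[OF F xy(1)] homD(1)[OF F xy(2)]]) (use xy(3) p in auto)
    then show "x = y" using inj_onD[OF F_inj] xy by blast
  qed
  have F0: "(\<lambda>x. F x 0) \<in> module_homs R M (regular_module R)"
    using hom_comp[OF F free_coord_hom[of 0 p]] p by (simp add: comp_def)
  have "soc \<subseteq> (\<lambda>x. F x 0) ` carrier M"
  proof
    fix s assume s: "s \<in> soc"
    have "(\<lambda>i\<in>{..<p}. s) \<in> tails 2 p" using s by (auto simp: tails_2 free_module_simps(1))
    then obtain x where x: "x \<in> carrier M" "(\<lambda>i\<in>{..<p}. s) = F x" using soc by blast
    have "s = (\<lambda>i\<in>{..<p}. s) 0" using p by simp
    also have "\<dots> = F x 0" using x(2) by (rule fun_cong)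
    finally have "s = F x 0" .
    then show "s \<in> (\<lambda>x. F x 0) ` carrier M" using x(1) by (rule image_eqI)
  qed
  moreover have "\<exists>r. \<forall>x \<in> carrier M. g x = F x 0 \<otimes> r"
    if g: "g \<in> module_homs R M (regular_module R)" for g
    using gF[OF g] p1 homD(1)[OF F] by fastforce
  ultimately show ?thesis using F0 inj0 unfolding left_generates_dual_def by blast
qed

text \<open>
  An element \<open>a\<close> of \<open>R\<close> acts on \<open>J\<^sup>2\<close> as the scalar \<open>c_1 a\<close>, so all linear endomorphisms of \<open>J\<^sup>2\<close> are
  homomorphisms. The one used here maps \<open>yx\<close> to \<open>zx\<close> and \<open>zx\<close> to \<open>0\<close>.
\<close>

lemma socle_map:
  assumes F: "F \<in> module_homs R M (regular_module R)" and s: "\<And>x. x \<in> carrier M \<Longrightarrow> F x \<in> soc"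
  shows "(\<lambda>x. Lam 0 0 0 0 0 (c_yx (F x))) \<in> module_homs R M (regular_module R)"
proof (rule homI)
  fix x y assume "x \<in> carrier M" "y \<in> carrier M"
  then show "Lam 0 0 0 0 0 (c_yx (F (x \<oplus>\<^bsub>M\<^esub> y))) =
      Lam 0 0 0 0 0 (c_yx (F x)) \<oplus>\<^bsub>regular_module R\<^esub> Lam 0 0 0 0 0 (c_yx (F y))"
    using homD(2)[OF F] by simp (simp add: R_simps lam_add_def)
next
  fix r x assume x: "x \<in> carrier M"
  have "F (r \<odot>\<^bsub>M\<^esub> x) = lam_scalar (c_1 r) \<otimes> F x"
    using homD(3)[OF F _ x, of r] mult_soc[OF s[OF x], of r] by simp
  moreover have "r \<otimes> Lam 0 0 0 0 0 (c_yx (F x)) = lam_scalar (c_1 r) \<otimes> Lam 0 0 0 0 0 (c_yx (F x))"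
    by (rule mult_soc) (simp add: soc_def)
  ultimately show "Lam 0 0 0 0 0 (c_yx (F (r \<odot>\<^bsub>M\<^esub> x))) = r \<odot>\<^bsub>regular_module R\<^esub> Lam 0 0 0 0 0 (c_yx (F x))"
    by (simp add: scalar_mult)
qed simp

text \<open>
  The image of \<open>F\<close> is a left ideal of dimension at most \<open>3\<close> containing \<open>J\<^sup>2\<close>. It is contained in \<open>J\<close>,
  since otherwise it is \<open>R\<close>; and it is not \<open>J\<^sup>2\<close>, since the endomorphisms of \<open>J\<^sup>2\<close> are not all right
  multiplications. The bound of \<open>extension_bound\<close> with \<open>t = 1\<close> leaves a single generator.
\<close>

lemma reflexive_dim_3:
  fixes M :: "('k lam, 'm) module"
  assumes M: "left_module R M" "finite_dimensional M" "carrier M \<noteq> {\<zero>\<^bsub>M\<^esub>}" "k_dim M \<le> 3"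
    and refl: "reflexive_module R M"
  shows "k_dim M = 3" "cyclic M"
proof -
  interpret R: ring R by (rule ring_R)
  interpret M: left_module R M by (rule M(1))
  obtain F where gd: "left_generates_dual M F" and soc: "soc \<subseteq> F ` carrier M"
    using reflexive_left_generates_dual[OF M refl] by blast
  have F: "F \<in> module_homs R M (regular_module R)" and inj: "inj_on F (carrier M)"
    and gen: "\<And>g. g \<in> module_homs R M (regular_module R) \<Longrightarrow> \<exists>r. \<forall>x \<in> carrier M. g x = F x \<otimes> r"
    using gd by (auto simp: left_generates_dual_def)
  have dimF: "k_dim ((regular_module R)\<lparr>carrier := F ` carrier M\<rparr>) = k_dim M"
    by (rule inj_image_dim[OF M(1) left_regular F M(2) inj])
  have Frad: "F x \<in> rad" if x: "x \<in> carrier M" for x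
  proof (rule ccontr)
    assume "F x \<notin> rad"
    then obtain b where b: "b \<otimes> F x = \<one>" using inverse_exists by blast
    have "a \<in> F ` carrier M" for a
    proof (rule image_eqI)
      show "(a \<otimes> b) \<odot>\<^bsub>M\<^esub> x \<in> carrier M" using x by (simp add: M.smult_closed)
      show "a = F ((a \<otimes> b) \<odot>\<^bsub>M\<^esub> x)" using homD(3)[OF F _ x, of "a \<otimes> b"] b by (simp add: R.m_assoc)
    qed
    then have "F ` carrier M = carrier (regular_module R)" by auto
    then have "(regular_module R)\<lparr>carrier := F ` carrier M\<rparr> = regular_module R" by (simp only:) simp
    then have "k_dim M = 6" using dimF regular_dim(2) by simp
    then show False using M(4) by simp
  qed
  have nsoc: "\<exists>x \<in> carrier M. F x \<notin> soc"
  proof (rule ccontr)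
    assume "\<not> ?thesis"
    \<comment> \<open>The endomorphism \<open>yx \<mapsto> zx, zx \<mapsto> 0\<close> of \<open>J\<^sup>2\<close> is not a right multiplication.\<close>
    then obtain r where r: "\<forall>x \<in> carrier M. Lam 0 0 0 0 0 (c_yx (F x)) = F x \<otimes> r"
      using gen[OF socle_map[OF F]] by blast
    have y: "Lam 0 0 0 0 1 0 \<in> soc" by (simp add: soc_def)
    then obtain x where "x \<in> carrier M" "F x = Lam 0 0 0 0 1 0" using soc by (metis imageE subsetD)
    then have "Lam 0 0 0 0 0 1 = Lam 0 0 0 0 1 0 \<otimes> r" using r by force
    then show False unfolding soc_mult[OF y] by (simp add: scalar_mult)
  qed
  obtain n f where mg: "minimal_generation M n f"
    using minimal_generation_exists[OF M(1) finite_dimensional_fin_gen[OF M(1,2)]] by blast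
  define j where "j x = (\<lambda>i\<in>{..<1::nat}. F x)" for x
  have j: "j \<in> module_homs R M (free_module R 1)"
    using homD[OF F] by (intro homI) (auto simp: j_def free_module_simps(1))
  have ext: "\<exists>a \<in> carrier (free_module R 1). \<forall>x \<in> carrier M. \<phi> x = pairing R 1 (j x) a"
    if \<phi>: "\<phi> \<in> module_homs R M (regular_module R)" for \<phi>
  proof -
    obtain r where r: "\<forall>x \<in> carrier M. \<phi> x = F x \<otimes> r" using gen[OF \<phi>] by blast
    interpret L: left_module R "regular_module R" by (rule left_regular)
    have "pairing R 1 (j x) (\<lambda>i\<in>{..<1}. r) = F x \<otimes> r" for x
      by (simp add: pairing_def lin_comb_def j_def lessThan_Suc)
    then show ?thesis using r by (intro bexI[of _ "\<lambda>i\<in>{..<1}. r"]) (auto simp: free_module_simps(1))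
  qed
  obtain x where x: "x \<in> carrier M" "F x \<notin> soc" using nsoc by blast
  have "2 * n + 1 \<le> 4 * 1"
    by (rule extension_bound[OF M(1) mg j _ ext x(1), of 0]) (use Frad x(2) in \<open>auto simp: j_def\<close>)
  moreover have "n \<noteq> 0" by (rule minimal_generation_nonzero[OF mg M(1,3)])
  ultimately have "n = 1" by simp
  then show "cyclic M" using minimal_generation_cyclic[OF M(1)] mg by simp
  have jinj: "inj_on j (carrier M)"
  proof (rule inj_onI)
    fix a b assume ab: "a \<in> carrier M" "b \<in> carrier M" "j a = j b"
    have "F a = j a 0" "F b = j b 0" by (simp_all add: j_def)
    then have "F a = F b" using ab(3) by simp
    then show "a = b" using inj_onD[OF inj] ab by blast
  qed
  have "tails 2 1 \<subseteq> j ` carrier M"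
  proof
    fix v assume v: "v \<in> tails 2 1"
    then have "v 0 \<in> F ` carrier M" using soc by (auto simp: tails_2)
    then obtain a where a: "a \<in> carrier M" "v 0 = F a" by blast
    have "v = j a" using v homD(1)[OF j a(1)] a(2) by (intro free_eqI[of v R 1]) (auto simp: tails_2 j_def)
    then show "v \<in> j ` carrier M" using a(1) by (rule image_eqI)
  qed
  moreover have "tails 2 1 \<noteq> j ` carrier M"
  proof
    assume "tails 2 1 = j ` carrier M"
    then have "j x \<in> tails 2 1" using x(1) by simp
    then show False using x(2) by (simp add: tails_2 j_def)
  qed
  ultimately have "sub_dim (k_space (free_module R 1)) (tails 2 1) < sub_dim (k_space (free_module R 1)) (j ` carrier M)"
    using sub_dim_mono[OF k_space_vectorspace[OF left_free] _ tails_subspace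
        submodule_k_subspace[OF submodule_image[OF j M(1) left_free submodule_carrier[OF M(1)]]], of 2]
      free_dim(1)[of 1]
    unfolding finite_dimensional_def by (metis le_neq_implies_less)
  then have "2 < k_dim M"
    using tails_dim(1)[of 2 1] inj_image_dim[OF M(1) left_free j M(2) jinj] by simp
  then show "k_dim M = 3" using M(4) by simp
qed

section \<open>Cosyzygies\<close>

lemma fixing_not_rad:
  assumes "a \<otimes> s = a" "a \<noteq> \<zero>"
  shows "s \<notin> rad"
proof
  interpret R: ring R by (rule ring_R)
  assume s: "s \<in> rad"
  have "a = (a \<otimes> s) \<otimes> s \<otimes> s" using assms(1) by simp
  also have "\<dots> = a \<otimes> (s \<otimes> (s \<otimes> s))" by (simp add: R.m_assoc)
  also have "\<dots> = \<zero>" using rad_mult_soc[OF s rad_mult_rad[OF s s]] by simp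
  finally show False using assms(2) by simp
qed

text \<open>
  The two approximations factor through each other; minimality makes the composition on \<open>P\<close>
  bijective, and the composition on \<open>R\<close> is multiplication by an element fixing \<open>F M \<noteq> 0\<close>, hence
  a unit.
\<close>

lemma minimal_left_approximation_regular:
  fixes M :: "('k lam, 'm) module"
  assumes M: "left_module R M" "carrier M \<noteq> {\<zero>\<^bsub>M\<^esub>}" and gd: "left_generates_dual M F"
    and app: "minimal_left_approximation R M P g"
  shows "\<exists>h \<in> module_homs R P (regular_module R).
    bij_betw h (carrier P) (carrier (regular_module R)) \<and> (\<forall>x \<in> carrier M. h (g x) = F x)"
proof -
  interpret R: ring R by (rule ring_R)
  interpret M: left_module R M by (rule M(1))
  have F: "F \<in> module_homs R M (regular_module R)" and inj: "inj_on F (carrier M)"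
    and gen: "\<And>g. g \<in> module_homs R M (regular_module R) \<Longrightarrow> \<exists>r. \<forall>x \<in> carrier M. g x = F x \<otimes> r"
    using gd by (auto simp: left_generates_dual_def)
  have P: "projective R P" and g: "g \<in> module_homs R M P"
    and ext: "\<And>\<phi>. \<phi> \<in> module_homs R M (regular_module R) \<Longrightarrow>
      \<exists>h \<in> module_homs R P (regular_module R). \<forall>x \<in> carrier M. \<phi> x = h (g x)"
    and min: "\<And>h. h \<in> module_homs R P P \<Longrightarrow> (\<forall>x \<in> carrier M. h (g x) = g x) \<Longrightarrow> bij_betw h (carrier P) (carrier P)"
    using app by (auto simp: minimal_left_approximation_def)
  note PL = projective_left_module[OF P]
  obtain h where h: "h \<in> module_homs R P (regular_module R)" "\<forall>x \<in> carrier M. F x = h (g x)"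
    using ext[OF F] by blast
  obtain n i p where i: "i \<in> module_homs R P (free_module R n)"
    and p: "p \<in> module_homs R (free_module R n) P" and pi: "\<And>x. x \<in> carrier P \<Longrightarrow> p (i x) = x"
    using P by (auto simp: projective_def)
  have "\<exists>r. \<forall>x \<in> carrier M. i (g x) l = F x \<otimes> r" if l: "l < n" for l
    using gen[OF hom_comp[OF hom_comp[OF g i] free_coord_hom[OF l]]] by simp
  then obtain r where r: "\<And>l x. l < n \<Longrightarrow> x \<in> carrier M \<Longrightarrow> i (g x) l = F x \<otimes> r l" by metis
  define m where "m a = (\<lambda>l\<in>{..<n}. a \<otimes> r l)" for a
  have m: "m \<in> module_homs R (regular_module R) (free_module R n)"
    by (intro homI) (auto simp: m_def free_module_simps(1) R.l_distr R.m_assoc)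
  have mF: "m (F x) = i (g x)" if "x \<in> carrier M" for x
    using homD(1)[OF m, of "F x"] homD(1)[OF hom_comp[OF g i] that] r[OF _ that]
    by (intro free_eqI[of _ R n]) (simp_all add: m_def)
  define h' where "h' = p \<circ> m"
  have h': "h' \<in> module_homs R (regular_module R) P" unfolding h'_def by (rule hom_comp[OF m p])
  have h'F: "h' (F x) = g x" if "x \<in> carrier M" for x
    using mF[OF that] pi[OF homD(1)[OF g that]] by (simp add: h'_def)
  have "h' \<circ> h \<in> module_homs R P P" by (rule hom_comp[OF h(1) h'])
  moreover have "\<forall>x \<in> carrier M. (h' \<circ> h) (g x) = g x" using h(2) h'F by simp
  ultimately have bij: "bij_betw (h' \<circ> h) (carrier P) (carrier P)" by (rule min)
  have h_inj: "inj_on h (carrier P)"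
    using bij unfolding bij_betw_def by (metis inj_on_imageI2)
  define s where "s = h (h' \<one>)"
  have hh': "h (h' a) = a \<otimes> s" for a
    using homD(3)[OF hom_comp[OF h' h(1)], of a "\<one>"] by (simp add: s_def)
  obtain x where x: "x \<in> carrier M" "x \<noteq> \<zero>\<^bsub>M\<^esub>" using M(2) M.M.zero_closed by blast
  have Fx: "F x \<noteq> \<zero>"
    using inj_onD[OF inj, of x "\<zero>\<^bsub>M\<^esub>"] x hom_zero[OF F M(1) left_regular] by auto
  have "F x \<otimes> s = F x" using hh'[of "F x"] h'F[OF x(1)] h(2) x(1) by simp
  then have "s \<notin> rad" by (rule fixing_not_rad[OF _ Fx])
  then obtain b where b: "b \<otimes> s = \<one>" using inverse_exists by blast
  have "y \<in> h ` carrier P" for y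
  proof (rule image_eqI)
    show "y = h (h' (y \<otimes> b))" unfolding hh' using b by (simp add: R.m_assoc)
    show "h' (y \<otimes> b) \<in> carrier P" using homD(1)[OF h'] by simp
  qed
  then have "bij_betw h (carrier P) (carrier (regular_module R))"
    using h_inj by (auto simp: bij_betw_def)
  then show ?thesis using h by (intro bexI[of _ h]) auto
qed

text \<open>
  An endomorphism of \<open>R\<close> which fixes the values of \<open>F\<close> is the right multiplication by a unit.
\<close>

lemma regular_minimal_left_approximation:
  fixes M :: "('k lam, 'm) module"
  assumes M: "left_module R M" "carrier M \<noteq> {\<zero>\<^bsub>M\<^esub>}" and gd: "left_generates_dual M F"
  shows "minimal_left_approximation R M (free_module R 1) (\<lambda>x. \<lambda>i\<in>{..<1}. F x)"
proof -
  interpret R: ring R by (rule ring_R)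
  interpret M: left_module R M by (rule M(1))
  interpret L: left_module R "free_module R 1" by (rule left_free)
  have F: "F \<in> module_homs R M (regular_module R)" and inj: "inj_on F (carrier M)"
    and gen: "\<And>g. g \<in> module_homs R M (regular_module R) \<Longrightarrow> \<exists>r. \<forall>x \<in> carrier M. g x = F x \<otimes> r"
    using gd by (auto simp: left_generates_dual_def)
  let ?P = "free_module R 1" and ?j = "\<lambda>x. \<lambda>i\<in>{..<1::nat}. F x" and ?e = "unit_fam R 1 0"
  have j: "?j \<in> module_homs R M ?P"
    using homD[OF F] by (intro homI) (auto simp: free_module_simps(1))
  have one: "(\<lambda>i\<in>{..<1::nat}. r) \<in> carrier ?P" for r by (auto simp: free_module_simps(1))
  show ?thesis
    unfolding minimal_left_approximation_def
  proof (intro conjI ballI impI)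
    show "projective R ?P" by (rule projective_free[OF ring_R])
    fix \<phi> assume "\<phi> \<in> module_homs R M (regular_module R)"
    then obtain r where r: "\<forall>x \<in> carrier M. \<phi> x = F x \<otimes> r" using gen by blast
    have "(\<lambda>v. v 0 \<otimes> r) \<in> module_homs R ?P (regular_module R)"
      by (intro homI) (auto simp: R.l_distr R.m_assoc)
    then show "\<exists>h\<in>module_homs R ?P (regular_module R). \<forall>x\<in>carrier M. \<phi> x = h (?j x)"
      using r by (intro bexI[of _ "\<lambda>v. v 0 \<otimes> r"]) auto
  next
    fix h assume h: "h \<in> module_homs R ?P ?P" and fix_j: "\<forall>x\<in>carrier M. h (?j x) = ?j x"
    define s where "s = h ?e 0"
    have ec: "?e \<in> carrier ?P" by (rule unit_fam_closed[OF ring_R])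
    have hv: "h v 0 = v 0 \<otimes> s" if v: "v \<in> carrier ?P" for v
    proof -
      have "h v = h (v 0 \<odot>\<^bsub>?P\<^esub> ?e)" by (rule arg_cong[OF free_1_eq[OF ring_R v]])
      then have "h v = v 0 \<odot>\<^bsub>?P\<^esub> h ?e" using homD(3)[OF h _ ec, of "v 0"] by simp
      then show ?thesis by (simp add: s_def)
    qed
    obtain x where x: "x \<in> carrier M" "x \<noteq> \<zero>\<^bsub>M\<^esub>" using M(2) M.M.zero_closed by blast
    have Fx: "F x \<noteq> \<zero>"
      using inj_onD[OF inj, of x "\<zero>\<^bsub>M\<^esub>"] x hom_zero[OF F M(1) left_regular] by auto
    have "F x \<otimes> s = F x" using hv[OF one, of "F x"] fix_j x(1) by simp
    then have "s \<notin> rad" by (rule fixing_not_rad[OF _ Fx])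
    then obtain b where b: "b \<otimes> s = \<one>" "s \<otimes> b = \<one>" using inverse_exists by blast
    have "inj_on h (carrier ?P)"
    proof (rule hom_inj_onI[OF h left_free left_free])
      fix v assume v: "v \<in> carrier ?P" "h v = \<zero>\<^bsub>?P\<^esub>"
      have "v 0 = v 0 \<otimes> (s \<otimes> b)" using b(2) by simp
      also have "\<dots> = h v 0 \<otimes> b" using hv[OF v(1)] by (simp add: R.m_assoc)
      also have "\<dots> = \<zero>" using v(2) by simp
      finally show "v = \<zero>\<^bsub>?P\<^esub>" using v(1) L.M.zero_closed by (intro free_eqI[of v R 1]) auto
    qed
    moreover have "carrier ?P \<subseteq> h ` carrier ?P"
    proof
      fix v assume v: "v \<in> carrier ?P"
      let ?w = "\<lambda>i\<in>{..<1::nat}. v 0 \<otimes> b"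
      have "v = h ?w"
        using v homD(1)[OF h one, of "v 0 \<otimes> b"] hv[OF one, of "v 0 \<otimes> b"] b(1)
        by (intro free_eqI[of v R 1]) (simp_all add: R.m_assoc)
      then show "v \<in> h ` carrier ?P" using one by (rule image_eqI)
    qed
    ultimately show "bij_betw h (carrier ?P) (carrier ?P)"
      using homD(1)[OF h] by (auto simp: bij_betw_def)
  qed (rule j)
qed

text \<open>The property which is handed on from a module to its cosyzygy.\<close>

definition torsionfree_3 :: "('k lam, 'm) module \<Rightarrow> bool" where
  "torsionfree_3 M \<longleftrightarrow> left_module R M \<and> finite_dimensional M \<and> k_dim M = 3 \<and>
     reflexive_dual_semi_GP R M"

lemma torsionfree_3_facts:
  assumes "torsionfree_3 M"
  shows "left_module R M" "finite_dimensional M" "k_dim M = 3" "carrier M \<noteq> {\<zero>\<^bsub>M\<^esub>}"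
    "local_module R M" "\<exists>F. left_generates_dual M F"
proof -
  show M: "left_module R M" "finite_dimensional M" "k_dim M = 3"
    using assms by (auto simp: torsionfree_3_def)
  have refl: "reflexive_module R M" using assms by (simp add: torsionfree_3_def reflexive_dual_semi_GP_def)
  show nz: "carrier M \<noteq> {\<zero>\<^bsub>M\<^esub>}" using M by (intro k_dim_pos_nonzero) simp_all
  have d: "k_dim M \<le> 3" using M(3) by simp
  show "\<exists>F. left_generates_dual M F" using reflexive_left_generates_dual[OF M(1,2) nz d refl] by blast
  show "local_module R M" by (rule cyclic_local[OF M(1) reflexive_dim_3(2)[OF M(1,2) nz d refl] nz])
qed

text \<open>
  Along the isomorphism of the target \<open>P\<close> of the approximation with \<open>R\<close>, the cosyzygy becomes
  \<open>R/F(M)\<close>, which has dimension \<open>6 - 3\<close>.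
\<close>

lemma torsionfree_3_mho:
  fixes M :: "('k lam, 'm) module" and N :: "('k lam, 'n) module"
  assumes S: "torsionfree_3 M" and N: "is_mho R M N"
  shows "torsionfree_3 N"
proof -
  note M = torsionfree_3_facts(1-4)[OF S]
  obtain F where gd: "left_generates_dual M F" using torsionfree_3_facts(6)[OF S] by blast
  then have F: "F \<in> module_homs R M (regular_module R)" and inj: "inj_on F (carrier M)"
    and gen: "\<And>g. g \<in> module_homs R M (regular_module R) \<Longrightarrow> \<exists>r. \<forall>x \<in> carrier M. g x = F x \<otimes> r"
    by (auto simp: left_generates_dual_def)
  obtain P :: "'k lam fgmodule" and g where NL: "left_module R N"
    and app: "minimal_left_approximation R M P g" and iso: "module_iso R N (quotient_module P (g ` carrier M))"
    using N by (auto simp: is_mho_def)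
  have P: "left_module R P" and g: "g \<in> module_homs R M P"
    using app by (auto simp: minimal_left_approximation_def projective_def)
  have sub: "Module.submodule (g ` carrier M) R P"
    by (rule submodule_image[OF g M(1) P submodule_carrier[OF M(1)]])
  obtain c where c: "c \<in> module_homs R P N" "c ` carrier P = carrier N"
    "\<forall>y \<in> carrier P. c y = \<zero>\<^bsub>N\<^esub> \<longleftrightarrow> y \<in> g ` carrier M"
    using iso unfolding iso_quotient_iff[OF P NL sub] by blast
  obtain h where h: "h \<in> module_homs R P (regular_module R)"
    "bij_betw h (carrier P) (carrier (regular_module R))" "\<forall>x \<in> carrier M. h (g x) = F x"
    using minimal_left_approximation_regular[OF M(1,4) gd app] by blast
  let ?k = "inv_into (carrier P) h"
  note k = hom_inv_into[OF h(1) P h(2)]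
  let ?c = "c \<circ> ?k"
  have c': "?c \<in> module_homs R (regular_module R) N" by (rule hom_comp[OF k(1) c(1)])
  have c'_surj: "?c ` carrier (regular_module R) = carrier N"
    using k(2) c(2) unfolding bij_betw_def by (simp only: image_comp[symmetric])
  have ker: "?c r = \<zero>\<^bsub>N\<^esub> \<longleftrightarrow> r \<in> F ` carrier M" for r
  proof -
    have kr: "?k r \<in> carrier P" using homD(1)[OF k(1), of r] by simp
    have hk: "h (?k r) = r" using bij_betw_inv_into_right[OF h(2)] by simp
    have "?c r = \<zero>\<^bsub>N\<^esub> \<longleftrightarrow> ?k r \<in> g ` carrier M" using bspec[OF c(3) kr] by simp
    also have "\<dots> \<longleftrightarrow> r \<in> F ` carrier M"
    proof
      assume "?k r \<in> g ` carrier M"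
      then obtain x where x: "x \<in> carrier M" "?k r = g x" by blast
      then have "r = F x" using hk h(3) by simp
      then show "r \<in> F ` carrier M" using x(1) by (rule image_eqI)
    next
      assume "r \<in> F ` carrier M"
      then obtain x where x: "x \<in> carrier M" "r = F x" by blast
      then have "?k r = ?k (h (g x))" using h(3) by simp
      also have "\<dots> = g x" by (rule bij_betw_inv_into_left[OF h(2) homD(1)[OF g x(1)]])
      finally show "?k r \<in> g ` carrier M" using x(1) by (rule image_eqI)
    qed
    finally show ?thesis .
  qed
  have "noetherian (opposite R)" by (rule lam_ring.noetherian_R[OF lam_ring_opposite])
  then have "reflexive_dual_semi_GP R N"
    using S gen c'_surj ker unfolding torsionfree_3_def
    by (intro reflexive_dual_semi_GP_cokernel[OF _ M(1) NL _ F _ c']) auto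
  moreover have "finite_dimensional N"
    by (rule surj_finite_dimensional[OF left_regular NL c' regular_dim(1) c'_surj])
  moreover have "k_dim N = 3"
  proof -
    have "a_kernel (regular_module R) N ?c = F ` carrier M" using ker unfolding a_kernel_def' by auto
    moreover have "N\<lparr>carrier := ?c ` carrier (regular_module R)\<rparr> = N" unfolding c'_surj by simp
    ultimately show ?thesis
      using hom_rank_nullity[OF left_regular NL c' regular_dim(1)] regular_dim(2)
        inj_image_dim[OF M(1) left_regular F M(2) inj] M(3) by simp
  qed
  ultimately show ?thesis using NL by (simp add: torsionfree_3_def)
qed

lemma mho_exists:
  fixes M :: "('k lam, 'm) module"
  assumes S: "torsionfree_3 M"
  shows "\<exists>N :: 'k lam fgmodule. is_mho R M N"
proof -
  note M = torsionfree_3_facts(1-4)[OF S]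
  obtain F where gd: "left_generates_dual M F" using torsionfree_3_facts(6)[OF S] by blast
  note app = regular_minimal_left_approximation[OF M(1,4) gd]
  let ?P = "free_module R 1" and ?j = "\<lambda>x. \<lambda>i\<in>{..<1::nat}. F x"
  have j: "?j \<in> module_homs R M ?P" using app by (simp add: minimal_left_approximation_def)
  have sub: "Module.submodule (?j ` carrier M) R ?P"
    by (rule submodule_image[OF j M(1) left_free submodule_carrier[OF M(1)]])
  obtain N :: "'k lam fgmodule" and c where N: "left_module R N" "c \<in> module_homs R ?P N"
    "c ` carrier ?P = carrier N" "\<forall>x \<in> carrier ?P. c x = \<zero>\<^bsub>N\<^esub> \<longleftrightarrow> x \<in> ?j ` carrier M"
    using quotient_copy[OF left_free sub] by blast
  then have "module_iso R N (quotient_module ?P (?j ` carrier M))"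
    unfolding iso_quotient_iff[OF left_free N(1) sub] by blast
  then show ?thesis using N(1) app unfolding is_mho_def by blast
qed

lemma infinitely_torsionfree_3:
  fixes M :: "('k lam, 'm) module"
  assumes M: "left_module R M" "finite_dimensional M" "carrier M \<noteq> {\<zero>\<^bsub>M\<^esub>}" "k_dim M \<le> 3"
    and tf: "infinitely_torsionfree R M"
  shows "torsionfree_3 M"
proof -
  obtain a \<pi> where mg: "minimal_generation M a \<pi>"
    using minimal_generation_exists[OF M(1) finite_dimensional_fin_gen[OF M(1,2)]] by blast
  let ?K = "a_kernel (free_module R a) M \<pi>"
  let ?U = "(free_module R a)\<lparr>carrier := ?K\<rparr>"
  have sub: "Module.submodule ?K R (free_module R a)"
    by (rule submodule_kernel[OF minimal_generationD(1)[OF mg] left_free M(1)])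
  have U: "left_module R ?U" by (rule left_module_submodule[OF left_free sub])
  have fdU: "finite_dimensional ?U" by (rule submodule_dim(1)[OF left_free free_dim(1) sub])
  obtain b p where mgU: "minimal_generation ?U b p"
    using minimal_generation_exists[OF U finite_dimensional_fin_gen[OF U fdU]] by blast
  have S: "reflexive_dual_semi_GP R M"
    by (rule infinitely_torsionfree_reflexive[OF lam_ring.noetherian_R[OF lam_ring_opposite] M(1)
        minimal_generation_cover[OF M(1) mg] minimal_generation_cover[OF U mgU] tf])
  then have "reflexive_module R M" by (simp add: reflexive_dual_semi_GP_def)
  then have "k_dim M = 3" by (rule reflexive_dim_3(1)[OF M])
  then show ?thesis using M S by (simp add: torsionfree_3_def)
qed

lemma projective_cover_iso:
  assumes "projective_cover R P \<pi> N" "left_module R N" "left_module R M"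
    and f: "f \<in> module_homs R N M" "bij_betw f (carrier N) (carrier M)"
  shows "projective_cover R P (f \<circ> \<pi>) M" "a_kernel P M (f \<circ> \<pi>) = a_kernel P N \<pi>"
proof -
  interpret N: left_module R N by fact
  have pi: "\<pi> \<in> module_homs R P N" "\<pi> ` carrier P = carrier N"
    using assms(1) by (auto simp: projective_cover_def)
  have "f (\<pi> x) = \<zero>\<^bsub>M\<^esub> \<longleftrightarrow> \<pi> x = \<zero>\<^bsub>N\<^esub>" if "x \<in> carrier P" for x
    by (rule hom_inj_zero_iff[OF f(1) assms(2,3) bij_betw_imp_inj_on[OF f(2)] homD(1)[OF pi(1) that]])
  then show ker: "a_kernel P M (f \<circ> \<pi>) = a_kernel P N \<pi>" unfolding a_kernel_def' comp_def by blast
  have "(f \<circ> \<pi>) ` carrier P = carrier M"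
    using pi(2) f(2) unfolding bij_betw_def by (simp only: image_comp[symmetric])
  then show "projective_cover R P (f \<circ> \<pi>) M"
    using assms(1) hom_comp[OF pi(1) f(1)] unfolding projective_cover_def ker by blast
qed

text \<open>
  A projective cover of \<open>N\<close>, followed by the isomorphism, is a projective cover of \<open>M\<close> with the same kernel,
  so the transposes of \<open>N\<close> are transposes of \<open>M\<close>.
\<close>

lemma infinitely_torsionfree_iso:
  assumes "infinitely_torsionfree R M" "left_module R N" "left_module R M" "module_iso R N M"
  shows "infinitely_torsionfree R N"
proof -
  obtain f where f: "f \<in> module_homs R N M" "bij_betw f (carrier N) (carrier M)"
    using assms(4) by (auto simp: module_iso_def)
  have "is_transpose R M T" if T: "is_transpose R N T" for T :: "'k lam fgmodule"
  proof -
    obtain P0 P1 :: "'k lam fgmodule" and \<pi> p where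
      "left_module (opposite R) T" and c: "projective_cover R P0 \<pi> N"
      "projective_cover R P1 p (P0\<lparr>carrier := a_kernel P0 N \<pi>\<rparr>)"
      "module_iso (opposite R) T (quotient_module (dual R P1)
         ((\<lambda>g. compose (carrier P1) g p) ` carrier (dual R P0)))"
      using T unfolding is_transpose_def by blast
    moreover note ci = projective_cover_iso[OF c(1) assms(2,3) f]
    moreover have "projective_cover R P1 p (P0\<lparr>carrier := a_kernel P0 M (f \<circ> \<pi>)\<rparr>)"
      unfolding ci(2) by (rule c(2))
    ultimately show ?thesis unfolding is_transpose_def by blast
  qed
  then show ?thesis using assms(1) unfolding infinitely_torsionfree_def by blast
qed

theorem torsionfree_3_mho_pow:
  fixes M :: "('k lam, 'm) module"
  assumes M: "left_module R M" "finite_dimensional M" "carrier M \<noteq> {\<zero>\<^bsub>M\<^esub>}" "k_dim M \<le> 3"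
    and tf: "infinitely_torsionfree R M"
  shows "(\<exists>N. is_mho_pow R t M N) \<and> (\<forall>N. is_mho_pow R t M N \<longrightarrow> torsionfree_3 N)"
proof (induction t)
  case 0
  have "torsionfree_3 N" if N: "left_module R N" "module_iso R N M" for N :: "'k lam fgmodule"
  proof -
    have d: "finite_dimensional N" "k_dim N = k_dim M"
      using iso_dim[OF M(1) N(1) module_iso_sym[OF N(2,1)] M(2)] by auto
    have "k_dim M = 3" using infinitely_torsionfree_3[OF M tf] by (simp add: torsionfree_3_def)
    then show ?thesis
      using d infinitely_torsionfree_iso[OF tf N(1) M(1) N(2)] k_dim_pos_nonzero[OF N(1)]
      by (intro infinitely_torsionfree_3 N(1)) simp_all
  qed
  then show ?case using fgmodule_copy[OF M(1,2)] by auto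
next
  case (Suc t)
  then obtain K where K: "is_mho_pow R t M K" "torsionfree_3 K" by blast
  obtain N :: "'k lam fgmodule" where "is_mho R K N" using mho_exists[OF K(2)] by blast
  then have "is_mho_pow R (Suc t) M N" using K(1) by auto
  moreover have "torsionfree_3 N" if "is_mho_pow R (Suc t) M N" for N
    using that Suc torsionfree_3_mho by auto
  ultimately show ?case by blast
qed

end

theorem mainTheorem2:
  fixes q :: "'k::field" and M :: "('k lam, 'm) module"
  assumes "q \<noteq> 0"
    and "left_module (Lambda q) M" and "finite_dimensional M"
    and "carrier M \<noteq> {\<zero>\<^bsub>M\<^esub>}" and "k_dim M \<le> 3"
  shows "(semi_Gorenstein_projective (Lambda q) M \<longrightarrow>
      (\<forall>t. (\<exists>N. is_Omega_pow (Lambda q) t M N) \<and>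
        (\<forall>N. is_Omega_pow (Lambda q) t M N \<longrightarrow>
          finite_dimensional N \<and> k_dim N = 3 \<and> local_module (Lambda q) N)))
    \<and> (infinitely_torsionfree (Lambda q) M \<longrightarrow>
      (\<forall>t. (\<exists>N. is_mho_pow (Lambda q) t M N) \<and>
        (\<forall>N. is_mho_pow (Lambda q) t M N \<longrightarrow>
          finite_dimensional N \<and> k_dim N = 3 \<and> local_module (Lambda q) N)))
    \<and> (Gorenstein_projective (Lambda q) M \<longrightarrow>
      (\<forall>t. (\<exists>N. is_Omega_pow (Lambda q) t M N) \<and> (\<exists>N. is_mho_pow (Lambda q) t M N) \<and>
        (\<forall>N. is_Omega_pow (Lambda q) t M N \<or> is_mho_pow (Lambda q) t M N \<longrightarrow>
          finite_dimensional N \<and> k_dim N = 3 \<and> local_module (Lambda q) N)))"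
proof -
  note M = assms(2-5)
  interpret lam_ring "Lambda q" by (rule lam_ring_Lambda)
  have Omega: "(\<exists>N. is_Omega_pow (Lambda q) t M N) \<and> (\<forall>N. is_Omega_pow (Lambda q) t M N \<longrightarrow>
      finite_dimensional N \<and> k_dim N = 3 \<and> local_module (Lambda q) N)"
    if "semi_Gorenstein_projective (Lambda q) M" for t
    using semi_GP_3_Omega_pow[OF semi_GP_dim_3(1)[OF M that], of t] semi_GP_3_facts(2)
    unfolding semi_GP_3_def by blast
  have mho: "(\<exists>N. is_mho_pow (Lambda q) t M N) \<and> (\<forall>N. is_mho_pow (Lambda q) t M N \<longrightarrow>
      finite_dimensional N \<and> k_dim N = 3 \<and> local_module (Lambda q) N)"
    if "infinitely_torsionfree (Lambda q) M" for t
    using torsionfree_3_mho_pow[OF M that, of t] torsionfree_3_facts(2,3,5) by blast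
  show ?thesis
    using Omega mho unfolding Gorenstein_projective_def by blast
qed

end
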